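(* Let $T>0$, and let $\mathcal{V}$ and $\mathcal{H}$ be real separable Hilbert spaces such that $\mathcal{V}$ is densely and continuously embedded into $\mathcal{H}$; identify $\mathcal{H}$ with its dual, so that $\mathcal{V}\hookrightarrow\mathcal{H}\hookrightarrow\mathcal{V}'$. Let $\mathfrak{a}:\mathcal{V}\times\mathcal{V}\to\mathbb{R}$ be a symmetric bilinear form for which there are constants $M,\kappa>0$ and $d\ge0$ with $$|\mathfrak{a}(\tilde v,v)|\le M\|\tilde v\|_{\mathcal{V}}\|v\|_{\mathcal{V}},\qquad\mathfrak{a}(v,v)\ge\kappa\|v\|_{\mathcal{V}}^2-d\|v\|_{\mathcal{H}}^2\qquad\text{for all }\tilde v,v\in\mathcal{V}.$$ Let $(k,l)\in\mathcal{PC}$ and assume that $k$ is completely monotone. Let $u_0\in\mathcal{H}$, $f\in L_2((0,T);\mathcal{V}')$, $w\in L_2((0,T);\mathcal{V})$, $u\in L_2((0,T);\mathcal{H})$ and $k\ast u\in C([0,T];\mathcal{H})$ such that $(k\ast u)|_{t=0}=0$. If the pair $(u,w)$ satisfies $$\frac{d}{dt}\big([k\ast(u-u_0)](t),v\big)_{\mathcal{H}}+\mathfrak{a}(w(t),v)=\langle f(t),v\rangle_{\mathcal{V}'\times\mathcal{V}},\quad v\in\mathcal{V},\ \text{a.a. }t\in(0,T),$$ where $d/dt$ means the generalized derivative of real functions on $(0,T)$, then $$\begin{aligned}&\int_0^T(w,u)_{\mathcal{H}}\,dt+\frac12\int_0^T\big[k(T-t)+k(t)\big]\,\|(l\overset{T}{\ast}A^{\frac12}w)(t)\|_{\mathcal{H}}^2\,dt\\&\quad+\frac12\int_0^T\!\!\int_0^t\frac1s\big[k(s)-k(2s)\big]\,\big\|(l\overset{T}{\ast}A^{\frac12}w)(t)-(l\overset{T}{\ast}A^{\frac12}w)(t-s)\big\|_{\mathcal{H}}^2\,ds\,dt\\&\le\int_0^T(u_0,w)_{\mathcal{H}}\,dt+\int_0^T\langle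 l\ast f,w\rangle_{\mathcal{V}'\times\mathcal{V}}\,dt+d\int_0^T(w,l\ast w)_{\mathcal{H}}\,dt.\end{aligned}$$
   Context: Condition $\mathcal{PC}$: $(k,l)\in\mathcal{PC}$ means that $k\in L_{1,loc}([0,\infty))$ is nonnegative and nonincreasing and $l\in L_{1,loc}([0,\infty))$ satisfies $k\ast l=1$ on $(0,\infty)$ (such $l$ is automatically nonnegative). $k$ is completely monotone if $k\in C^\infty((0,\infty))$ and $(-1)^jk^{(j)}\ge0$ on $(0,\infty)$ for all $j\in\mathbb{N}_0$. Convolutions in time: $(k\ast v)(t)=\int_0^t k(t-\tau)v(\tau)\,d\tau$ and $(l\overset{T}{\ast}g)(t)=\int_t^T l(\tau-t)g(\tau)\,d\tau$ for $t\in(0,T)$; $u_0$ is regarded as constant in time in $k\ast(u-u_0)$. $(\cdot,\cdot)_{\mathcal{H}}$ is the inner product of $\mathcal{H}$ and $\langle\cdot,\cdot\rangle_{\mathcal{V}'\times\mathcal{V}}$ the duality pairing, with $(h,v)_{\mathcal{H}}=\langle h,v\rangle_{\mathcal{V}'\times\mathcal{V}}$ for $h\in\mathcal{H}$, $v\in\mathcal{V}$. The operator $A$: set $\tilde{\mathfrak{a}}(w,v)=\mathfrak{a}(w,v)+d(w,v)_{\mathcal{H}}$, which is a nonnegative form. $A:D(A)\to\mathcal{H}$ is the operator on $\mathcal{H}$ (with maximal domain) associated with $\tilde{\mathfrak{a}}$, i.e. $\tilde{\mathfrak{a}}(w,v)=(Aw,v)_{\mathcal{H}}$ for $w\in D(A)$,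 $v\in\mathcal{V}$. It is nonnegative and self-adjoint, and its self-adjoint square root $A^{1/2}$ has domain $D(A^{1/2})=\mathcal{V}$ and satisfies $\tilde{\mathfrak{a}}(w,v)=(A^{1/2}w,A^{1/2}v)_{\mathcal{H}}$ for $w,v\in\mathcal{V}$. *)

theory Defs
  imports "HOL-Analysis.Analysis"
begin

text \<open>The dual of \<^typ>\<open>'v\<close> is \<^typ>\<open>'v \<Rightarrow>\<^sub>L real\<close>. Bochner integrals require second countability of
  the target type. The instance below provides it for this type: the dual of a separable Hilbert
  space is separable.\<close>

lemma riesz_representation:
  fixes \<phi> :: "'v::{real_inner, banach} \<Rightarrow> real"
  assumes "bounded_linear \<phi>"
  shows "\<exists>r. \<forall>x. \<phi> x = r \<bullet> x"
proof -
  interpret bounded_linear \<phi> by fact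
  define J where "J x = (norm x)\<^sup>2 - 2 * \<phi> x" for x
  obtain K where K: "\<And>x. norm (\<phi> x) \<le> norm x * K" using bounded by blast
  have below: "- (K\<^sup>2) \<le> J x" for x
  proof -
    have "\<phi> x \<le> norm x * K" using K[of x] by auto
    moreover have "0 \<le> (norm x - K)\<^sup>2" by simp
    ultimately show ?thesis unfolding J_def power2_diff by (simp add: mult.assoc)
  qed
  have para: "J x + J y = 2 * J ((1/2) *\<^sub>R (x + y)) + (norm (x - y))\<^sup>2 / 2" for x y
    unfolding J_def power2_norm_eq_inner
    by (simp add: scaleR add inner_add_left inner_add_right inner_diff_left inner_diff_right
        inner_commute field_simps)
  define m where "m = Inf (range J)"
  have bdd: "bdd_below (range J)" using below by (auto intro!: bdd_belowI)
  have m_le: "m \<le> J x" for x unfolding m_def by (rule cInf_lower) (use bdd in auto)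
  have "\<exists>x. J x < m + 1 / (real n + 1)" for n
  proof -
    have "Inf (range J) < m + 1 / (real n + 1)" unfolding m_def by simp
    from cInf_lessD[OF _ this] show ?thesis by auto
  qed
  then obtain X where X: "\<And>n. J (X n) < m + 1 / (real n + 1)" by metis
  have dist2: "(norm (X n - X p))\<^sup>2 \<le> 2 / (real n + 1) + 2 / (real p + 1)" for n p
    using para[of "X n" "X p"] m_le[of "(1/2) *\<^sub>R (X n + X p)"] X[of n] X[of p] by simp
  have "Cauchy X"
  proof (rule CauchyI)
    fix e :: real assume "0 < e"
    obtain N where N: "4 / e\<^sup>2 < real N" using reals_Archimedean2 by blast
    show "\<exists>M. \<forall>m\<ge>M. \<forall>n\<ge>M. norm (X m - X n) < e"
    proof (intro exI allI impI)
      fix p n assume pn: "N \<le> p" "N \<le> n"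
      have "4 < e\<^sup>2 * (real N + 1)"
        using N \<open>0 < e\<close> by (simp add: field_simps) (smt (verit) zero_less_power)
      then have small: "2 / (real N + 1) < e\<^sup>2 / 2" by (simp add: field_simps)
      have mono: "2 / (real q + 1) \<le> 2 / (real N + 1)" if "N \<le> q" for q
        using that by (intro divide_left_mono) auto
      have "(norm (X p - X n))\<^sup>2 < e\<^sup>2"
        using dist2[of p n] small mono[OF pn(1)] mono[OF pn(2)] by simp
      then show "norm (X p - X n) < e" using \<open>0 < e\<close> by (simp add: power_less_imp_less_base)
    qed
  qed
  then obtain r where r: "X \<longlonglongrightarrow> r" using Cauchy_convergent convergent_def by blast
  have "(\<lambda>n. J (X n)) \<longlonglongrightarrow> J r"
    unfolding J_def by (intro tendsto_intros tendsto r)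
  moreover have "(\<lambda>n. m + 1 / (real n + 1)) \<longlonglongrightarrow> m + 0"
    using LIMSEQ_inverse_real_of_nat
    by (intro tendsto_intros) (simp add: inverse_eq_divide add.commute)
  ultimately have "J r \<le> m"
    using X by (intro LIMSEQ_le[of "\<lambda>n. J (X n)" "J r"]) (auto intro: less_imp_le)
  have "\<phi> y = r \<bullet> y" for y
  proof -
    define c where "c = r \<bullet> y - \<phi> y"
    have ineq: "0 \<le> t\<^sup>2 * (norm y)\<^sup>2 + 2 * t * c" for t
    proof -
      have "J r \<le> J (r + t *\<^sub>R y)" using \<open>J r \<le> m\<close> m_le order_trans by blast
      then show ?thesis
        unfolding J_def c_def power2_norm_eq_inner
        by (simp add: add scaleR algebra_simps inner_commute power2_eq_square)
    qed
    have "c = 0"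
    proof (cases "y = 0")
      case True then show ?thesis unfolding c_def by (simp add: zero)
    next
      case False
      then have "norm y > 0" by simp
      have "0 \<le> (- c / (norm y)\<^sup>2)\<^sup>2 * (norm y)\<^sup>2 + 2 * (- c / (norm y)\<^sup>2) * c" by (rule ineq)
      also have "\<dots> = - (c\<^sup>2 / (norm y)\<^sup>2)"
        using \<open>norm y > 0\<close> by (simp add: field_simps power2_eq_square)
      finally have "c\<^sup>2 \<le> 0" using \<open>norm y > 0\<close> by (simp add: field_simps)
      then show ?thesis by simp
    qed
    then show ?thesis unfolding c_def by simp
  qed
  then show ?thesis by blast
qed

lemma ex_countable_basis_of_dense:
  fixes D :: "'a::metric_space set"
  assumes "countable D" and dense: "\<And>x e. 0 < e \<Longrightarrow> \<exists>d\<in>D. dist d x < e"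
  shows "\<exists>B::'a set set. countable B \<and> open = generate_topology B"
proof -
  define B where "B = (\<lambda>(d, n::nat). ball d (1 / (real n + 1))) ` (D \<times> UNIV)"
  have "topological_basis B"
  proof (rule topological_basisI)
    show "open b" if "b \<in> B" for b using that unfolding B_def by auto
  next
    fix U :: "'a set" and x assume "open U" "x \<in> U"
    then obtain e where e: "e > 0" "ball x e \<subseteq> U" by (meson open_contains_ball)
    obtain N where N: "2 / e < real N" using reals_Archimedean2 by blast
    define \<delta> where "\<delta> = 1 / (real N + 1)"
    have \<delta>: "0 < \<delta>" "2 * \<delta> < e"
      using N e(1) unfolding \<delta>_def by (auto simp: field_simps)
    obtain d where d: "d \<in> D" "dist d x < \<delta>" using dense[OF \<delta>(1)] by blast
    have "ball d \<delta> \<subseteq> ball x e"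
    proof
      fix y assume "y \<in> ball d \<delta>"
      then show "y \<in> ball x e"
        using d(2) \<delta>(2) dist_triangle[of x y d] by (simp add: dist_commute)
    qed
    moreover have "ball d \<delta> \<in> B" unfolding B_def \<delta>_def using d(1) by auto
    ultimately show "\<exists>b\<in>B. x \<in> b \<and> b \<subseteq> U" using d e by (intro bexI[of _ "ball d \<delta>"]) auto
  qed
  moreover have "countable B" unfolding B_def using assms(1) by auto
  ultimately show ?thesis using topological_basis_imp_subbasis by blast
qed

instance blinfun :: ("{real_inner, banach, second_countable_topology}", euclidean_space)
  second_countable_topology
proof
  obtain D :: "'a set" where D: "countable D" "\<And>X. open X \<Longrightarrow> X \<noteq> {} \<Longrightarrow> \<exists>d\<in>D. d \<in> X"
    using countable_dense_setE by blast
  define G :: "('b \<Rightarrow> 'a) \<Rightarrow> 'a \<Rightarrow>\<^sub>L 'b"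
    where "G c = Blinfun (\<lambda>x. \<Sum>b\<in>Basis. (c b \<bullet> x) *\<^sub>R b)" for c
  have G: "blinfun_apply (G c) = (\<lambda>x. \<Sum>b\<in>Basis. (c b \<bullet> x) *\<^sub>R b)" for c
    unfolding G_def by (intro bounded_linear_Blinfun_apply bounded_linear_intros)
  define C where "C = G ` (PiE Basis (\<lambda>_. D))"
  have "countable C" unfolding C_def using D(1) by (intro countable_image countable_PiE) auto
  moreover have "\<exists>g\<in>C. dist g f < e" if "0 < e" for f :: "'a \<Rightarrow>\<^sub>L 'b" and e
  proof -
    have "\<forall>b. \<exists>r. \<forall>x. blinfun_apply f x \<bullet> b = r \<bullet> x"
      by (intro allI riesz_representation bounded_linear_intros)
    then obtain r where r: "\<And>b x. blinfun_apply f x \<bullet> b = r b \<bullet> x" by metis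
    define \<epsilon> where "\<epsilon> = e / (2 * DIM('b))"
    have "0 < \<epsilon>" unfolding \<epsilon>_def using that by simp
    then have "\<forall>b. \<exists>d\<in>D. d \<in> ball (r b) \<epsilon>" by (intro allI D(2)) auto
    then obtain c0 where c0: "\<And>b. c0 b \<in> D" "\<And>b. c0 b \<in> ball (r b) \<epsilon>" by metis
    define c where "c = restrict c0 Basis"
    have "norm (G c - f) \<le> e / 2"
    proof (rule norm_blinfun_bound)
      show "0 \<le> e / 2" using that by simp
      fix x
      have "blinfun_apply f x = (\<Sum>b\<in>Basis. (r b \<bullet> x) *\<^sub>R b)"
        by (subst euclidean_representation[symmetric]) (simp add: r)
      then have "norm (blinfun_apply (G c - f) x) = norm (\<Sum>b\<in>Basis. ((c0 b - r b) \<bullet> x) *\<^sub>R (b::'b))"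
        by (simp add: blinfun.diff_left G c_def inner_diff_left scaleR_diff_left sum_subtractf)
      also have "\<dots> \<le> (\<Sum>b\<in>(Basis::'b set). \<epsilon> * norm x)"
      proof (rule sum_norm_le)
        fix b :: 'b assume b: "b \<in> Basis"
        have "\<bar>(c0 b - r b) \<bullet> x\<bar> \<le> norm (c0 b - r b) * norm x" by (rule Cauchy_Schwarz_ineq2)
        also have "\<dots> \<le> \<epsilon> * norm x"
          using c0(2)[of b] by (intro mult_right_mono) (auto simp: dist_norm norm_minus_commute)
        finally show "norm (((c0 b - r b) \<bullet> x) *\<^sub>R b) \<le> \<epsilon> * norm x" using b by simp
      qed
      also have "\<dots> = e / 2 * norm x" unfolding \<epsilon>_def by simp
      finally show "norm (blinfun_apply (G c - f) x) \<le> e / 2 * norm x" .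
    qed
    moreover have "G c \<in> C" unfolding C_def c_def using c0(1) by auto
    ultimately show ?thesis using that by (intro bexI[of _ "G c"]) (auto simp: dist_norm)
  qed
  ultimately show "\<exists>B::('a \<Rightarrow>\<^sub>L 'b) set set. countable B \<and> open = generate_topology B"
    by (rule ex_countable_basis_of_dense)
qed

text \<open>Elements of $L_p$ spaces are given by Borel measurable representatives on \<^typ>\<open>real\<close>; their values
  outside the time interval are irrelevant.\<close>

definition L1_loc :: "(real \<Rightarrow> real) \<Rightarrow> bool"
  where "L1_loc k \<longleftrightarrow> (\<forall>T>0. set_integrable lborel {0..T} k)"

definition L2 :: "real \<Rightarrow> (real \<Rightarrow> 'a::{banach, second_countable_topology}) set"
  where "L2 T = {g. set_borel_measurable lborel {0<..<T} g \<and>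
                    set_integrable lborel {0<..<T} (\<lambda>t. (norm (g t))\<^sup>2)}"

definition conv :: "(real \<Rightarrow> real) \<Rightarrow> (real \<Rightarrow> 'a::{banach, second_countable_topology}) \<Rightarrow> real \<Rightarrow> 'a"
  where "conv k g t = (LINT \<tau>:{0<..<t}|lborel. k (t - \<tau>) *\<^sub>R g \<tau>)"

definition conv_backward ::
    "real \<Rightarrow> (real \<Rightarrow> real) \<Rightarrow> (real \<Rightarrow> 'a::{banach, second_countable_topology}) \<Rightarrow> real \<Rightarrow> 'a"
  where "conv_backward T l g t = (LINT \<tau>:{t<..<T}|lborel. l (\<tau> - t) *\<^sub>R g \<tau>)"

text \<open>\<open>k * l = 1\<close> is an identity of locally integrable functions, hence holds almost everywhere.\<close>

definition PC :: "((real \<Rightarrow> real) \<times> (real \<Rightarrow> real)) set"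
  where "PC = {(k, l). L1_loc k \<and> (\<forall>t>0. 0 \<le> k t) \<and> antimono_on {0<..} k \<and>
                       L1_loc l \<and> (AE t in lborel. 0 < t \<longrightarrow> conv k l t = 1)}"

text \<open>Intended for open \<open>S\<close>, since \<^const>\<open>deriv\<close> is the two-sided derivative.\<close>

definition smooth_on :: "real set \<Rightarrow> (real \<Rightarrow> real) \<Rightarrow> bool"
  where "smooth_on S \<psi> \<longleftrightarrow> (\<forall>n. \<forall>x\<in>S. (deriv ^^ n) \<psi> field_differentiable (at x))"

definition completely_monotone :: "(real \<Rightarrow> real) \<Rightarrow> bool"
  where "completely_monotone k \<longleftrightarrow>
           smooth_on {0<..} k \<and> (\<forall>n. \<forall>t>0. 0 \<le> (-1) ^ n * (deriv ^^ n) k t)"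

definition test_function :: "real \<Rightarrow> (real \<Rightarrow> real) \<Rightarrow> bool"
  where "test_function T \<psi> \<longleftrightarrow> smooth_on UNIV \<psi> \<and>
           (\<exists>a b. 0 < a \<and> a \<le> b \<and> b < T \<and> (\<forall>t. t \<notin> {a..b} \<longrightarrow> \<psi> t = 0))"

definition has_generalized_derivative :: "real \<Rightarrow> (real \<Rightarrow> real) \<Rightarrow> (real \<Rightarrow> real) \<Rightarrow> bool"
  where "has_generalized_derivative T g g' \<longleftrightarrow>
           (\<forall>a b. 0 < a \<and> a \<le> b \<and> b < T \<longrightarrow>
              set_integrable lborel {a..b} g \<and> set_integrable lborel {a..b} g') \<and>
           (\<forall>\<psi>. test_function T \<psi> \<longrightarrow>
              (LINT t:{0<..<T}|lborel. g t * deriv \<psi> t) = - (LINT t:{0<..<T}|lborel. g' t * \<psi> t))"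

definition adjoint_graph :: "('h::real_inner \<times> 'h) set \<Rightarrow> ('h \<times> 'h) set"
  where "adjoint_graph G = {(y, z). \<forall>(x, Gx)\<in>G. Gx \<bullet> y = x \<bullet> z}"

definition nonneg_self_adjoint :: "('h::real_inner \<times> 'h) set \<Rightarrow> bool"
  where "nonneg_self_adjoint G \<longleftrightarrow>
           subspace G \<and> single_valued G \<and> closure (Domain G) = UNIV \<and>
           adjoint_graph G = G \<and> (\<forall>(x, y)\<in>G. 0 \<le> y \<bullet> x)"

text \<open>The relational composition \<^term>\<open>R O R\<close> is the graph of the square of the operator, with the
  natural domain of all $x \in D(R)$ with $R x \in D(R)$.\<close>

definition is_operator_sqrt :: "('h::real_inner \<times> 'h) set \<Rightarrow> ('h \<times> 'h) set \<Rightarrow> bool"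
  where "is_operator_sqrt R A \<longleftrightarrow> nonneg_self_adjoint R \<and> R O R = A"

definition op_apply :: "('h \<times> 'h) set \<Rightarrow> 'h \<Rightarrow> 'h"
  where "op_apply G x = (THE y. (x, y) \<in> G)"

text \<open>The operator on the pivot space associated with the form \<open>b\<close>, where \<open>\<iota>\<close> embeds the form domain
  into the pivot space.\<close>

definition form_operator :: "('v \<Rightarrow> 'h::real_inner) \<Rightarrow> ('v \<Rightarrow> 'v \<Rightarrow> real) \<Rightarrow> ('h \<times> 'h) set"
  where "form_operator \<iota> b = {(\<iota> w, h) | w h. \<forall>v. b w v = h \<bullet> \<iota> v}"

end

theory Submission
  imports Defs
begin

text \<open>Write \<open>z\<close> for the backward convolution of \<open>l\<close> with \<open>g = A\<^sup>1\<^sup>/\<^sup>2 w\<close>. The inequality is an identity between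
  \<open>u\<close>, \<open>w\<close> and \<open>f\<close>, combined with a lower bound for the integral of \<open>(g, l * g)\<close> in terms of \<open>z\<close>.

  The identity. Tested with \<open>v\<close>, the equation says that \<open>k * p\<close>, where \<open>p = (u - u0, v)\<close>, has the
  generalized derivative \<open>q = \<langle>f, v\<rangle> - a(w, v)\<close>. Since \<open>k * u\<close> vanishes at time 0 and \<open>k * u0\<close> tends to 0
  there, \<open>k * p\<close> is the primitive of \<open>q\<close> (\<open>generalized_derivative_imp_primitive\<close>), that is,
  \<open>k * p = 1 * q\<close>. Convolution with \<open>l\<close> and \<open>l * k = 1\<close> give \<open>1 * p = 1 * (l * q)\<close>, hence
  \<open>p = l * q\<close> almost everywhere (\<open>memory_equation_solved\<close>). By separability \<open>v = w t\<close> may be inserted.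
  The form \<open>a\<close> differs by \<open>d (\<cdot>, \<cdot>)\<close> from the form of \<open>A\<close>, which is \<open>(A\<^sup>1\<^sup>/\<^sup>2 \<cdot>, A\<^sup>1\<^sup>/\<^sup>2 \<cdot>)\<close> on the whole
  form domain (\<open>second_representation_theorem\<close>). Integration in time leaves the integral of
  \<open>(g, l * g)\<close>, which equals that of \<open>(z, g)\<close> because the two convolutions with \<open>l\<close> are adjoint.

  The lower bound (\<open>energy_inequality\<close>). Backward in time, \<open>k * z = 1 * g\<close>, so formally \<open>g\<close> is
  minus the derivative of \<open>k * z\<close>. The polarization identity turns the integral of \<open>(z, g)\<close> into half
  the integral of \<open>(k (T - t) + k t) |z t|\<^sup>2\<close> plus half the double integral of
  \<open>- k' s |z t - z (t - s)|\<^sup>2\<close>, and by convexity \<open>- k' s\<close> is at least \<open>(k s - k (2 s)) / s\<close>.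
  To avoid differentiating the singular kernel, the derivative is replaced by a difference quotient of
  step \<open>h\<close>. Then the polarization is exact (\<open>energy_step\<close>), at the price of an error from lags
  \<open>s \<le> h\<close>, which is of order \<open>h\<close> if \<open>z\<close> is Lipschitz. This settles Lipschitz \<open>g\<close>. The general case
  follows by approximation: the left side is lower semicontinuous by Fatou's lemma, and the integral of
  \<open>(z, g)\<close> is continuous under dominated convergence.\<close>

section \<open>Integration on the real line\<close>

lemma norm_integral_le_AE:
  fixes f :: "'a \<Rightarrow> 'b::{banach, second_countable_topology}"
  assumes "integrable M g" "f \<in> borel_measurable M" "AE x in M. norm (f x) \<le> g x"
  shows "integrable M f" "norm (integral\<^sup>L M f) \<le> integral\<^sup>L M g"
proof -
  have ae: "AE x in M. norm (f x) \<le> norm (g x)" using assms(3) by eventually_elim simp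
  show f: "integrable M f" by (rule Bochner_Integration.integrable_bound[OF assms(1,2) ae])
  have "norm (integral\<^sup>L M f) \<le> (LINT x|M. norm (f x))" by (rule integral_norm_bound)
  also have "\<dots> \<le> integral\<^sup>L M g" using f assms by (intro integral_mono_AE) auto
  finally show "norm (integral\<^sup>L M f) \<le> integral\<^sup>L M g" .
qed

lemma integrable_indicator_Ioc: "integrable lborel (indicator {b<..c::real} :: real \<Rightarrow> real)"
  by (cases "b \<le> c") (auto intro!: integrable_real_indicator)

lemma lborel_translate:
  fixes f :: "real \<Rightarrow> 'a::{banach, second_countable_topology}"
  shows "integrable lborel (\<lambda>t. f (t - s)) \<longleftrightarrow> integrable lborel f"
    and "(LINT t|lborel. f (t - s)) = integral\<^sup>L lborel f"
    and "integrable lborel (\<lambda>t. f (s - t)) \<longleftrightarrow> integrable lborel f"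
    and "(LINT t|lborel. f (s - t)) = integral\<^sup>L lborel f"
    and "integrable lborel (\<lambda>t. f (s + t)) \<longleftrightarrow> integrable lborel f"
    and "(LINT t|lborel. f (s + t)) = integral\<^sup>L lborel f"
  using lborel_integrable_real_affine_iff[of 1 f "- s"] lborel_integral_real_affine[of 1 f "- s"]
    lborel_integrable_real_affine_iff[of "-1" f s] lborel_integral_real_affine[of "-1" f s]
    lborel_integrable_real_affine_iff[of 1 f s] lborel_integral_real_affine[of 1 f s]
  by simp_all

lemma AE_lborel_affine:
  fixes c :: real
  assumes "AE x in lborel. P x" "c \<noteq> 0"
  shows "AE x in lborel. P (t + c * x)"
proof -
  obtain N where N: "{x. \<not> P x} \<subseteq> N" "N \<in> sets borel" "emeasure lborel N = 0"
    using assms(1) by (elim AE_E) auto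
  have "AE x in lborel. x \<notin> N" using N by (intro AE_not_in) auto
  then have "AE x in lborel. t + c * x \<notin> N"
    by (intro AE_borel_affine[OF assms(2)]) (use N in auto)
  then show ?thesis by eventually_elim (use N in auto)
qed

lemma AE_imp_witness:
  fixes a b :: real
  assumes "AE t in lborel. P t" "a < b"
  shows "\<exists>t. a < t \<and> t < b \<and> P t"
proof (rule ccontr)
  assume "\<not> ?thesis"
  then have "AE t in lborel. t \<notin> {a<..<b}" using assms(1) by (auto elim: eventually_mono)
  then have "emeasure lborel {a<..<b} = 0" by (subst (asm) AE_iff_null_sets[symmetric]) auto
  with assms(2) show False by simp
qed

text \<open>The positive and the negative part of the function are densities of two finite measures that agree
  on all half-lines, so the measures coincide and their densities do.\<close>
lemma AE_zero_if_interval_integrals_zero: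
  fixes f :: "real \<Rightarrow> real"
  assumes f: "set_integrable lborel {0<..<T} f"
    and z: "\<And>b c. 0 < b \<Longrightarrow> b < c \<Longrightarrow> c < T \<Longrightarrow> (LINT t:{b<..c}|lborel. f t) = 0"
  shows "AE t in lborel. t \<in> {0<..<T} \<longrightarrow> f t = 0"
proof -
  define F where "F t = indicator {0<..<T} t * f t" for t
  have F: "integrable lborel F" using f by (simp add: F_def[abs_def] set_integrable_def)
  have [measurable]: "F \<in> borel_measurable borel" using F by auto
  have I0: "(LINT t|lborel. indicator {x<..} t * F t) = 0" for x
  proof -
    define b where "b n = max x 0 + 1 / real (Suc n)" for n
    define c where "c n = T - 1 / real (Suc n)" for n
    have b: "b \<longlonglongrightarrow> max x 0" and c: "c \<longlonglongrightarrow> T"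
      using tendsto_add[OF tendsto_const[of "max x 0"] LIMSEQ_inverse_real_of_nat]
        tendsto_diff[OF tendsto_const[of T] LIMSEQ_inverse_real_of_nat]
      by (simp_all add: b_def[abs_def] c_def[abs_def] inverse_eq_divide)
    have "(\<lambda>n. LINT t|lborel. indicator {b n<..c n} t * F t) \<longlonglongrightarrow> (LINT t|lborel. indicator {x<..} t * F t)"
    proof (rule integral_dominated_convergence[where w="\<lambda>t. norm (F t)"])
      show "AE t in lborel. (\<lambda>n. indicator {b n<..c n} t * F t) \<longlonglongrightarrow> indicator {x<..} t * F t"
      proof (intro always_eventually allI)
        fix t
        show "(\<lambda>n. indicator {b n<..c n} t * F t) \<longlonglongrightarrow> indicator {x<..} t * F t"
        proof (cases "max x 0 < t \<and> t < T")
          case True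
          then have "\<forall>\<^sub>F n in sequentially. b n < t" "\<forall>\<^sub>F n in sequentially. t < c n"
            using order_tendstoD[OF b] order_tendstoD[OF c] by auto
          then have "\<forall>\<^sub>F n in sequentially. indicator {b n<..c n} t * F t = indicator {x<..} t * F t"
            by eventually_elim (use True in \<open>auto simp: indicator_def\<close>)
          then show ?thesis by (rule tendsto_eventually)
        next
          case False
          then have "indicator {x<..} t * F t = 0" by (auto simp: F_def indicator_def)
          moreover have "indicator {b n<..c n} t * F t = 0" for n
          proof -
            have "max x 0 < b n" by (simp add: b_def)
            moreover have "c n < T" by (simp add: c_def)
            ultimately have "t \<notin> {b n<..c n}" using False by auto
            then show ?thesis by simp
          qed
          ultimately show ?thesis by (simp only: tendsto_const)
        qed
      qed
    qed (use F in \<open>auto simp: indicator_def\<close>)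
    moreover have "(LINT t|lborel. indicator {b n<..c n} t * F t) = 0" for n
    proof (cases "b n < c n")
      case True
      have bn: "0 < b n" by (simp add: b_def add_nonneg_pos)
      have cn: "c n < T" by (simp add: c_def)
      have "(\<lambda>t. indicator {b n<..c n} t * F t) = (\<lambda>t. indicator {b n<..c n} t *\<^sub>R f t)"
        using bn cn by (auto simp: F_def indicator_def)
      with z[OF bn True cn] show ?thesis by (simp add: set_lebesgue_integral_def)
    qed simp
    ultimately show ?thesis by (simp add: LIMSEQ_const_iff)
  qed
  have nn: "(\<integral>\<^sup>+t. ennreal (g t) * indicator {x<..} t \<partial>lborel) = ennreal (LINT t|lborel. indicator {x<..} t * max 0 (g t))"
    if g: "integrable lborel g" for g :: "real \<Rightarrow> real" and x
  proof -
    have i: "integrable lborel (\<lambda>t. indicator {x<..} t * max 0 (g t))"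
      by (rule Bochner_Integration.integrable_bound[OF g]) (use g in \<open>auto simp: indicator_def\<close>)
    have "(\<integral>\<^sup>+t. ennreal (g t) * indicator {x<..} t \<partial>lborel) = (\<integral>\<^sup>+t. ennreal (indicator {x<..} t * max 0 (g t)) \<partial>lborel)"
      by (intro nn_integral_cong) (auto simp: indicator_def max_def ennreal_neg)
    also have "\<dots> = ennreal (LINT t|lborel. indicator {x<..} t * max 0 (g t))"
      by (rule nn_integral_eq_integral[OF i]) auto
    finally show ?thesis .
  qed
  have eq: "(LINT t|lborel. indicator {x<..} t * max 0 (F t)) = (LINT t|lborel. indicator {x<..} t * max 0 (- F t))" for x
  proof -
    have i: "integrable lborel (\<lambda>t. indicator {x<..} t * max 0 (F t))" "integrable lborel (\<lambda>t. indicator {x<..} t * max 0 (- F t))"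
      by (rule Bochner_Integration.integrable_bound[OF F]; use F in \<open>auto simp: indicator_def\<close>)+
    have "(\<lambda>t. indicator {x<..} t * F t) = (\<lambda>t. indicator {x<..} t * max 0 (F t) - indicator {x<..} t * max 0 (- F t))"
      by (auto simp: indicator_def max_def)
    with I0[of x] i show ?thesis by simp
  qed
  have "density lborel (\<lambda>t. ennreal (F t)) = density lborel (\<lambda>t. ennreal (- F t))"
    by (rule measure_eqI_lessThan) (use F in \<open>auto simp: emeasure_density nn eq\<close>)
  then have "AE t in lborel. ennreal (F t) = ennreal (- F t)"
    by (intro sigma_finite_measure.density_unique[OF lborel.sigma_finite_measure_axioms]) auto
  then have "AE t in lborel. F t = 0"
  proof eventually_elim
    case (elim t)
    show ?case
    proof (cases "0 \<le> F t")
      case True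
      then have "ennreal (F t) = 0" using elim by (simp add: ennreal_neg)
      with True show ?thesis by (simp add: ennreal_eq_0_iff)
    next
      case False
      then have "ennreal (- F t) = 0" using elim by (simp add: ennreal_neg)
      with False show ?thesis by (simp add: ennreal_eq_0_iff)
    qed
  qed
  then show ?thesis by eventually_elim (auto simp: F_def)
qed

text \<open>The points at which the primitive is known to vanish are dense, hence it vanishes everywhere by
  dominated convergence.\<close>
lemma AE_zero_if_primitive_zero_AE:
  fixes D :: "real \<Rightarrow> real"
  assumes D: "integrable lborel D"
    and F: "AE t in lborel. t \<in> {0<..<T} \<longrightarrow> (LINT s|lborel. indicator {0<..<t} s * D s) = 0"
  shows "AE t in lborel. t \<in> {0<..<T} \<longrightarrow> D t = 0"
proof (rule AE_zero_if_interval_integrals_zero)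
  have [measurable]: "D \<in> borel_measurable borel" using D by auto
  have i: "integrable lborel (\<lambda>s. indicator A s * D s)" if [measurable]: "A \<in> sets borel" for A
    by (rule Bochner_Integration.integrable_bound[OF D]) (auto simp: indicator_def)
  show "set_integrable lborel {0<..<T} D" using i[of "{0<..<T}"] by (simp add: set_integrable_def)
  have zero: "(LINT s|lborel. indicator {0<..c} s * D s) = 0" if c: "0 < c" "c < T" for c
  proof -
    define e where "e n = min T (c + inverse (real (Suc n)))" for n
    have ce: "c < e n" for n using c by (simp add: e_def)
    have "\<forall>n. \<exists>t. c < t \<and> t < e n \<and> (t \<in> {0<..<T} \<longrightarrow> (LINT s|lborel. indicator {0<..<t} s * D s) = 0)"
      using AE_imp_witness[OF F ce] by blast
    from choice[OF this] obtain x where x: "\<And>n. c < x n" "\<And>n. x n < e n"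
      and xF: "\<And>n. x n \<in> {0<..<T} \<longrightarrow> (LINT s|lborel. indicator {0<..<x n} s * D s) = 0" by blast
    have xT: "x n \<in> {0<..<T}" for n using x(1)[of n] x(2)[of n] c by (simp add: e_def)
    have xlim: "x \<longlonglongrightarrow> c"
    proof (rule tendsto_sandwich[of "\<lambda>n. c" _ _ "\<lambda>n. c + inverse (real (Suc n))"])
      show "(\<lambda>n. c + inverse (real (Suc n))) \<longlonglongrightarrow> c"
        using tendsto_add[OF tendsto_const LIMSEQ_inverse_real_of_nat, of c] by simp
      show "\<forall>\<^sub>F n in sequentially. x n \<le> c + inverse (real (Suc n))"
        using x(2) by (intro always_eventually allI) (simp add: e_def less_imp_le del: of_nat_Suc)
    qed (use x(1) in \<open>auto intro!: always_eventually less_imp_le\<close>)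
    have "(\<lambda>n. LINT s|lborel. indicator {0<..<x n} s * D s) \<longlonglongrightarrow> (LINT s|lborel. indicator {0<..c} s * D s)"
    proof (rule integral_dominated_convergence[where w="\<lambda>s. norm (D s)"])
      show "AE s in lborel. (\<lambda>n. indicator {0<..<x n} s * D s) \<longlonglongrightarrow> indicator {0<..c} s * D s"
      proof (intro AE_I2 tendsto_eventually)
        fix s
        show "\<forall>\<^sub>F n in sequentially. indicator {0<..<x n} s * D s = indicator {0<..c} s * D s"
        proof (cases "s \<le> c")
          case True
          then have "indicator {0<..<x n} s = (indicator {0<..c} s :: real)" for n
            using x(1)[of n] by (auto simp: indicator_def)
          then show ?thesis by simp
        next
          case False
          then have "\<forall>\<^sub>F n in sequentially. x n < s" using order_tendstoD(2)[OF xlim] by simp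
          then show ?thesis by eventually_elim (use False in \<open>auto simp: indicator_def\<close>)
        qed
      qed
    qed (use D in \<open>auto simp: indicator_def\<close>)
    then show ?thesis using xF xT by (simp add: LIMSEQ_const_iff)
  qed
  fix b c :: real assume bc: "0 < b" "b < c" "c < T"
  have "(LINT s|lborel. indicator {b<..c} s *\<^sub>R D s) = (LINT s|lborel. indicator {0<..c} s * D s - indicator {0<..b} s * D s)"
    using bc by (intro Bochner_Integration.integral_cong refl) (auto simp: indicator_def)
  also have "\<dots> = 0" using zero[of b] zero[of c] bc i by simp
  finally show "(LINT t:{b<..c}|lborel. D t) = 0" by (simp add: set_lebesgue_integral_def)
qed

lemma liminf_add_le:
  fixes A B :: "nat \<Rightarrow> ennreal"
  shows "liminf A + liminf B \<le> liminf (\<lambda>n. A n + B n)"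
proof -
  have inc: "incseq (\<lambda>n. INF m\<in>{n..}. f m)" for f :: "nat \<Rightarrow> ennreal"
    by (auto simp: incseq_def intro!: INF_superset_mono)
  have "liminf A + liminf B = (SUP n. (INF m\<in>{n..}. A m) + (INF m\<in>{n..}. B m))"
    unfolding liminf_SUP_INF by (rule ennreal_SUP_add[symmetric, OF inc inc])
  also have "\<dots> \<le> (SUP n. INF m\<in>{n..}. A m + B m)"
    by (intro SUP_mono bexI INF_greatest add_mono INF_lower) auto
  finally show ?thesis unfolding liminf_SUP_INF .
qed

lemma nn_integral_le_liminf_AE:
  assumes [measurable]: "\<And>n. f n \<in> borel_measurable M" and "AE t in M. g t \<le> liminf (\<lambda>n. f n t)"
  shows "(\<integral>\<^sup>+t. g t \<partial>M) \<le> liminf (\<lambda>n. \<integral>\<^sup>+t. f n t \<partial>M)"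
  using nn_integral_mono_AE[OF assms(2)] nn_integral_liminf[of f M] by (auto intro: order_trans)

lemma le_liminf_tendsto:
  fixes x :: "nat \<Rightarrow> real"
  assumes "x \<longlonglongrightarrow> y"
  shows "ennreal y \<le> liminf (\<lambda>n. ennreal (x n))"
  using lim_imp_Liminf[OF _ tendsto_ennrealI[OF assms]] by simp

lemma tendsto_indicator_less:
  fixes h :: "nat \<Rightarrow> real"
  assumes "h \<longlonglongrightarrow> 0" "0 < x"
  shows "(\<lambda>n. of_bool (h n < x) :: real) \<longlonglongrightarrow> 1"
proof (rule tendsto_eventually)
  show "\<forall>\<^sub>F n in sequentially. of_bool (h n < x) = (1::real)"
    using order_tendstoD(2)[OF assms] by eventually_elim simp
qed

lemma square_integrable_imp_integrable:
  fixes g :: "real \<Rightarrow> 'a::{banach, second_countable_topology}"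
  assumes [measurable]: "g \<in> borel_measurable borel" and g2: "integrable lborel (\<lambda>t. (norm (g t))\<^sup>2)"
    and g0: "\<And>t. t \<notin> {0<..<T} \<Longrightarrow> g t = 0"
  shows "integrable lborel g"
proof (rule norm_integral_le_AE(1))
  show "integrable lborel (\<lambda>t. indicator {0<..T} t + (norm (g t))\<^sup>2)"
    using g2 integrable_indicator_Ioc by (intro Bochner_Integration.integrable_add)
  have "x \<le> 1 + x\<^sup>2" for x :: real
  proof -
    have "2 * x \<le> x\<^sup>2 + 1" using zero_le_power2[of "x - 1"] by (simp add: power2_diff)
    then show ?thesis using zero_le_power2[of x] by linarith
  qed
  then show "AE t in lborel. norm (g t) \<le> indicator {0<..T} t + (norm (g t))\<^sup>2"
    using g0 by (auto simp: indicator_def)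
qed measurable

text \<open>All convolutions are taken over the whole line. Functions on the time interval enter them
  extended by zero.\<close>
lemma L2_zero_extension:
  assumes "g \<in> L2 T"
  shows "(\<lambda>t. indicator {0<..<T} t *\<^sub>R g t) \<in> borel_measurable borel"
    and "integrable lborel (\<lambda>t. (norm (indicator {0<..<T} t *\<^sub>R g t))\<^sup>2)"
    and "integrable lborel (\<lambda>t. indicator {0<..<T} t *\<^sub>R g t)"
proof -
  show m: "(\<lambda>t. indicator {0<..<T} t *\<^sub>R g t) \<in> borel_measurable borel"
    using assms by (simp add: L2_def set_borel_measurable_def)
  have "(norm (indicator {0<..<T} t *\<^sub>R g t))\<^sup>2 = indicator {0<..<T} t *\<^sub>R (norm (g t))\<^sup>2" for t
    by (simp add: indicator_def)
  then show 2: "integrable lborel (\<lambda>t. (norm (indicator {0<..<T} t *\<^sub>R g t))\<^sup>2)"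
    using assms by (simp add: L2_def set_integrable_def)
  show "integrable lborel (\<lambda>t. indicator {0<..<T} t *\<^sub>R g t)"
    by (rule square_integrable_imp_integrable[OF m 2, of T]) auto
qed

lemma integrable_lborel_pair_scaleR:
  fixes g :: "real \<Rightarrow> 'a::{banach, second_countable_topology}"
  assumes a: "integrable lborel a" and g: "integrable lborel g"
  shows "integrable (lborel \<Otimes>\<^sub>M lborel) (\<lambda>(t, s). a s *\<^sub>R g t)"
proof (rule lborel_pair.Fubini_integrable)
  have [measurable]: "a \<in> borel_measurable borel" "g \<in> borel_measurable borel" using a g by auto
  show "(\<lambda>(t, s). a s *\<^sub>R g t) \<in> borel_measurable (lborel \<Otimes>\<^sub>M lborel)" by measurable
qed (use a g in simp_all)

text \<open>For fixed \<open>s\<close> the shear is a translation in \<open>t\<close>, so integrating in \<open>t\<close> first shows that it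
  preserves integrability and integrals.\<close>
lemma integrable_shear:
  fixes F :: "real \<Rightarrow> real \<Rightarrow> 'a::{banach, second_countable_topology}"
  assumes F: "integrable (lborel \<Otimes>\<^sub>M lborel) (\<lambda>(t, s). F t s)"
  shows "integrable (lborel \<Otimes>\<^sub>M lborel) (\<lambda>(t, s). F (t - s) s)"
    and "(LINT t|lborel. LINT s|lborel. F (t - s) s) = (LINT t|lborel. LINT s|lborel. F t s)"
proof -
  have [measurable]: "(\<lambda>(t, s). F t s) \<in> borel_measurable (borel \<Otimes>\<^sub>M borel)"
    using borel_measurable_integrable[OF F] by (simp add: measurable_lborel1 cong: measurable_cong_sets)
  have m: "(\<lambda>x. F (snd x - fst x) (fst x)) \<in> borel_measurable (borel \<Otimes>\<^sub>M borel)"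
    using measurable_compose[OF _ \<open>(\<lambda>(t, s). F t s) \<in> borel_measurable (borel \<Otimes>\<^sub>M borel)\<close>, of "\<lambda>x. (snd x - fst x, fst x)"]
    by simp
  have I': "integrable (lborel \<Otimes>\<^sub>M lborel) (\<lambda>x. F (snd x - fst x) (fst x))"
  proof (rule lborel_pair.Fubini_integrable)
    show "(\<lambda>x. F (snd x - fst x) (fst x)) \<in> borel_measurable (lborel \<Otimes>\<^sub>M lborel)"
      using m by (simp cong: measurable_cong_sets)
    have "integrable (lborel \<Otimes>\<^sub>M lborel) (\<lambda>(t, s). norm (F t s))"
      using integrable_norm[OF F] by (simp add: case_prod_beta')
    from lborel_pair.integrable_snd[OF this]
    show "integrable lborel (\<lambda>x. LINT y|lborel. norm (F (snd (x, y) - fst (x, y)) (fst (x, y))))"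
      by (simp add: lborel_translate(2)[of "\<lambda>y. norm (F y _)"])
    show "AE x in lborel. integrable lborel (\<lambda>y. F (snd (x, y) - fst (x, y)) (fst (x, y)))"
      using lborel_pair.AE_integrable_snd[OF F]
      by eventually_elim (simp add: lborel_translate(1)[of "\<lambda>y. F y _"])
  qed
  have I: "integrable (lborel \<Otimes>\<^sub>M lborel) (\<lambda>(s, t). F (t - s) s)"
    using I' by (simp add: case_prod_beta')
  show I2: "integrable (lborel \<Otimes>\<^sub>M lborel) (\<lambda>(t, s). F (t - s) s)"
    using lborel_pair.integrable_product_swap[OF I] by simp
  have "(LINT t|lborel. LINT s|lborel. F (t - s) s) = (LINT s|lborel. LINT t|lborel. F (t - s) s)"
    using lborel_pair.Fubini_integral[OF I2] by simp
  also have "\<dots> = (LINT s|lborel. LINT t|lborel. F t s)"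
    by (simp add: lborel_translate(2)[of "\<lambda>y. F y _"])
  also have "\<dots> = (LINT t|lborel. LINT s|lborel. F t s)"
    using lborel_pair.Fubini_integral[OF F] by simp
  finally show "(LINT t|lborel. LINT s|lborel. F (t - s) s) = (LINT t|lborel. LINT s|lborel. F t s)" .
qed

lemma integrable_reflect_snd:
  fixes F :: "real \<Rightarrow> real \<Rightarrow> 'a::{banach, second_countable_topology}"
  assumes F: "integrable (lborel \<Otimes>\<^sub>M lborel) (\<lambda>(t, s). F t s)"
  shows "integrable (lborel \<Otimes>\<^sub>M lborel) (\<lambda>(t, s). F t (- s))"
proof (rule lborel_pair.Fubini_integrable)
  have [measurable]: "(\<lambda>(t, s). F t s) \<in> borel_measurable (borel \<Otimes>\<^sub>M borel)"
    using borel_measurable_integrable[OF F] by (simp cong: measurable_cong_sets)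
  have "(\<lambda>x. F (fst x) (- snd x)) \<in> borel_measurable (borel \<Otimes>\<^sub>M borel)"
    using measurable_compose[OF _ \<open>(\<lambda>(t, s). F t s) \<in> borel_measurable (borel \<Otimes>\<^sub>M borel)\<close>, of "\<lambda>x. (fst x, - snd x)"]
    by simp
  then show "(\<lambda>(t, s). F t (- s)) \<in> borel_measurable (lborel \<Otimes>\<^sub>M lborel)"
    by (simp add: case_prod_beta' cong: measurable_cong_sets)
  have "integrable (lborel \<Otimes>\<^sub>M lborel) (\<lambda>(t, s). norm (F t s))"
    using integrable_norm[OF F] by (simp add: case_prod_beta')
  from lborel_pair.integrable_fst[OF this]
  show "integrable lborel (\<lambda>x. LINT y|lborel. norm (case (x, y) of (t, s) \<Rightarrow> F t (- s)))"
    using lborel_translate(4)[of "\<lambda>y. norm (F _ y)" 0] by simp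
  show "AE x in lborel. integrable lborel (\<lambda>y. case (x, y) of (t, s) \<Rightarrow> F t (- s))"
    using lborel_pair.AE_integrable_fst[OF F] lborel_translate(3)[of "\<lambda>y. F _ y" 0] by simp
qed

section \<open>Smooth step functions\<close>

text \<open>A set of functions that is closed under differentiation consists of smooth functions. This avoids
  formulas for the iterated derivatives.\<close>
lemma smooth_on_coinduct:
  assumes "f \<in> S" "\<And>g. g \<in> S \<Longrightarrow> \<exists>g'\<in>S. \<forall>x. (g has_real_derivative g' x) (at x)"
  shows "smooth_on UNIV f"
proof -
  have d: "deriv g \<in> S \<and> (\<forall>x. g field_differentiable at x)" if g: "g \<in> S" for g
  proof -
    obtain g' where g': "g' \<in> S" "\<And>x. (g has_real_derivative g' x) (at x)" using assms(2)[OF g] by blast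
    then have "deriv g = g'" by (intro ext DERIV_imp_deriv)
    with g' show ?thesis by (auto simp: field_differentiable_def)
  qed
  have "(deriv ^^ n) f \<in> S" for n
    by (induction n) (use assms(1) d in auto)
  with d show ?thesis unfolding smooth_on_def by blast
qed

lemma smooth_on_UNIV_deriv:
  assumes "smooth_on UNIV f"
  shows "smooth_on UNIV (deriv f)" "(f has_real_derivative deriv f x) (at x)"
proof -
  show "smooth_on UNIV (deriv f)" unfolding smooth_on_def
  proof (intro allI ballI)
    fix n and x :: real
    have "(deriv ^^ Suc n) f field_differentiable at x" using assms unfolding smooth_on_def by blast
    then show "(deriv ^^ n) (deriv f) field_differentiable at x" by (simp only: funpow_Suc_right comp_def)
  qed
  have "(deriv ^^ 0) f field_differentiable at x" using assms unfolding smooth_on_def by blast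
  then show "(f has_real_derivative deriv f x) (at x)"
    by (simp add: DERIV_deriv_iff_field_differentiable)
qed

lemma smooth_on_UNIV_primitive:
  assumes "smooth_on UNIV f" "\<And>x. (F has_real_derivative f x) (at x)"
  shows "smooth_on UNIV F"
  by (rule smooth_on_coinduct[of F "insert F (Collect (smooth_on UNIV))"])
    (use assms smooth_on_UNIV_deriv in blast)+

lemma smooth_on_UNIV_const: "smooth_on UNIV (\<lambda>x. c)"
  by (rule smooth_on_coinduct[of _ "range (\<lambda>c x. c)"]) (auto intro!: derivative_eq_intros)

lemma smooth_on_UNIV_combination:
  assumes "smooth_on UNIV f" "smooth_on UNIV g"
  shows "smooth_on UNIV (\<lambda>x. c * f (\<alpha> * x + \<beta>) + g x)"
proof (rule smooth_on_coinduct)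
  let ?S = "{h. \<exists>c f g. smooth_on UNIV f \<and> smooth_on UNIV g \<and> h = (\<lambda>x. c * f (\<alpha> * x + \<beta>) + g x)}"
  show "(\<lambda>x. c * f (\<alpha> * x + \<beta>) + g x) \<in> ?S" using assms by blast
  fix h assume "h \<in> ?S"
  then obtain c f g where h: "smooth_on UNIV f" "smooth_on UNIV g" "h = (\<lambda>x. c * f (\<alpha> * x + \<beta>) + g x)" by auto
  show "\<exists>g'\<in>?S. \<forall>x. (h has_real_derivative g' x) (at x)"
  proof (intro bexI allI)
    fix x
    have "((\<lambda>x. \<alpha> * x + \<beta>) has_real_derivative \<alpha>) (at x)" by (auto intro!: derivative_eq_intros)
    from DERIV_chain2[OF smooth_on_UNIV_deriv(2)[OF h(1)] this]
    show "(h has_real_derivative (c * \<alpha>) * deriv f (\<alpha> * x + \<beta>) + deriv g x) (at x)"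
      unfolding h(3) by (auto intro!: derivative_eq_intros smooth_on_UNIV_deriv(2)[OF h(2)])
  next
    show "(\<lambda>x. (c * \<alpha>) * deriv f (\<alpha> * x + \<beta>) + deriv g x) \<in> ?S"
      using smooth_on_UNIV_deriv(1)[OF h(1)] smooth_on_UNIV_deriv(1)[OF h(2)] by auto
  qed
qed

text \<open>The powers of \<open>1 / x\<close> in front of \<open>exp (- (1 / x))\<close> make the family closed under differentiation.\<close>
definition flat_exp :: "nat \<Rightarrow> real \<Rightarrow> real"
  where "flat_exp n x = (if 0 < x then (1 / x) ^ n * exp (- (1 / x)) else 0)"

lemma flat_exp_tendsto_0: "(flat_exp n \<longlongrightarrow> 0) (at 0)"
proof -
  have "(flat_exp n \<longlongrightarrow> 0) (at_left 0)"
    by (rule tendsto_eventually) (auto simp: flat_exp_def eventually_at_filter)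
  moreover have "(flat_exp n \<longlongrightarrow> 0) (at_right 0)"
    unfolding filterlim_at_right_to_top
  proof (rule Lim_transform_eventually[OF tendsto_power_div_exp_0])
    show "eventually (\<lambda>x. x ^ n / exp x = flat_exp n (inverse x)) at_top"
      using eventually_gt_at_top[of 0] by eventually_elim (simp add: flat_exp_def inverse_eq_divide exp_minus)
  qed
  ultimately show ?thesis by (rule filterlim_split_at)
qed

lemma DERIV_flat_exp:
  "(flat_exp n has_real_derivative flat_exp (n + 2) x - real n * flat_exp (n + 1) x) (at x)"
proof (cases x "0::real" rule: linorder_cases)
  case less
  have "((\<lambda>x. 0::real) has_real_derivative 0) (at x)" by simp
  then have "(flat_exp n has_real_derivative 0) (at x)"
    by (rule has_field_derivative_transform_within_open[of _ _ _ "{..<0}"]) (use less in \<open>auto simp: flat_exp_def\<close>)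
  with less show ?thesis by (simp add: flat_exp_def)
next
  case equal
  have "((\<lambda>h. (flat_exp n (0 + h) - flat_exp n 0) / h) \<longlongrightarrow> 0) (at 0)"
  proof (rule Lim_transform_eventually[OF flat_exp_tendsto_0[of "n + 1"]])
    show "\<forall>\<^sub>F h in at 0. flat_exp (n + 1) h = (flat_exp n (0 + h) - flat_exp n 0) / h"
      unfolding eventually_at_filter by (rule always_eventually) (auto simp: flat_exp_def)
  qed
  with equal show ?thesis by (simp add: DERIV_def flat_exp_def)
next
  case greater
  have inv: "((\<lambda>x. 1 / x) has_real_derivative - ((1 / x)\<^sup>2)) (at x)"
    using greater by (auto intro!: derivative_eq_intros simp: field_simps power2_eq_square)
  have "((\<lambda>x. (1 / x) ^ n * exp (- (1 / x))) has_real_derivative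
     flat_exp (n + 2) x - real n * flat_exp (n + 1) x) (at x)"
    by (rule derivative_eq_intros inv refl)+
      (use greater in \<open>cases n; simp add: flat_exp_def power2_eq_square algebra_simps\<close>)
  then show ?thesis
    by (rule has_field_derivative_transform_within_open[of _ _ _ "{0<..}"]) (use greater in \<open>auto simp: flat_exp_def\<close>)
qed

text \<open>Closed under differentiation by the product rule, and containing the bump
  \<open>flat_exp 0 x * flat_exp 0 (1 - x)\<close>.\<close>
inductive_set flat_algebra :: "(real \<Rightarrow> real) set" where
  gen: "(\<lambda>x. flat_exp n (\<alpha> * x + \<beta>)) \<in> flat_algebra"
| const: "(\<lambda>x. c) \<in> flat_algebra"
| add: "f \<in> flat_algebra \<Longrightarrow> g \<in> flat_algebra \<Longrightarrow> (\<lambda>x. f x + g x) \<in> flat_algebra"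
| mult: "f \<in> flat_algebra \<Longrightarrow> g \<in> flat_algebra \<Longrightarrow> (\<lambda>x. f x * g x) \<in> flat_algebra"

lemma smooth_on_flat_algebra:
  assumes "f \<in> flat_algebra" shows "smooth_on UNIV f"
proof (rule smooth_on_coinduct[OF assms])
  show "\<exists>g'\<in>flat_algebra. \<forall>x. (g has_real_derivative g' x) (at x)" if "g \<in> flat_algebra" for g
    using that
  proof induction
    case (gen n \<alpha> \<beta>)
    let ?g' = "\<lambda>x. \<alpha> * (flat_exp (n + 2) (\<alpha> * x + \<beta>) + (- real n) * flat_exp (n + 1) (\<alpha> * x + \<beta>))"
    have "?g' \<in> flat_algebra" by (intro flat_algebra.intros)
    moreover have "((\<lambda>x. flat_exp n (\<alpha> * x + \<beta>)) has_real_derivative ?g' x) (at x)" for x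
    proof -
      have "((\<lambda>x. \<alpha> * x + \<beta>) has_real_derivative \<alpha>) (at x)" by (auto intro!: derivative_eq_intros)
      from DERIV_chain2[OF DERIV_flat_exp this] show ?thesis by (simp add: mult.commute)
    qed
    ultimately show ?case by (intro bexI[of _ ?g']) auto
  next
    case (const c)
    show ?case by (rule bexI[of _ "\<lambda>x. 0"]) (auto intro: flat_algebra.intros)
  next
    case (add f g)
    then obtain f' g' where "f' \<in> flat_algebra" "\<And>x. (f has_real_derivative f' x) (at x)"
      "g' \<in> flat_algebra" "\<And>x. (g has_real_derivative g' x) (at x)" by blast
    then show ?case by (intro bexI[of _ "\<lambda>x. f' x + g' x"]) (auto intro: flat_algebra.intros derivative_eq_intros)
  next
    case (mult f g)
    then obtain f' g' where "f' \<in> flat_algebra" "\<And>x. (f has_real_derivative f' x) (at x)"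
      "g' \<in> flat_algebra" "\<And>x. (g has_real_derivative g' x) (at x)" by blast
    with mult show ?case
      by (intro bexI[of _ "\<lambda>x. f' x * g x + f x * g' x"]) (auto intro!: flat_algebra.intros derivative_eq_intros)
  qed
qed

lemma continuous_has_primitive:
  fixes f :: "real \<Rightarrow> real"
  assumes "continuous_on UNIV f"
  shows "\<exists>F. \<forall>x. (F has_real_derivative f x) (at x)"
proof -
  have "\<exists>F. \<forall>x::real. -\<infinity> < ereal x \<longrightarrow> ereal x < \<infinity> \<longrightarrow> (F has_vector_derivative f x) (at x)"
    by (rule einterval_antiderivative) (use assms in \<open>auto simp: continuous_on_eq_continuous_at\<close>)
  then show ?thesis by (simp add: has_real_derivative_iff_has_vector_derivative)
qed

text \<open>\<open>\<Phi>\<close> is a smoothed Heaviside function with its transition in the unit interval, \<open>\<theta>\<close> is its derivative,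
  and its primitive \<open>\<Psi>\<close> is a smoothed positive part, off by the constant \<open>c\<close> after the transition.\<close>
definition smooth_step :: "(real \<Rightarrow> real) \<Rightarrow> (real \<Rightarrow> real) \<Rightarrow> (real \<Rightarrow> real) \<Rightarrow> real \<Rightarrow> bool"
  where "smooth_step \<theta> \<Phi> \<Psi> c \<longleftrightarrow>
    (\<forall>x. (\<Phi> has_real_derivative \<theta> x) (at x) \<and> (\<Psi> has_real_derivative \<Phi> x) (at x)) \<and>
    smooth_on UNIV \<Phi> \<and> smooth_on UNIV \<Psi> \<and> continuous_on UNIV \<theta> \<and>
    (\<forall>x. 0 \<le> \<theta> x \<and> 0 \<le> \<Phi> x \<and> \<Phi> x \<le> 1) \<and>
    (\<forall>x\<le>0. \<Phi> x = 0 \<and> \<Psi> x = 0) \<and> (\<forall>x\<ge>1. \<Phi> x = 1 \<and> \<Psi> x = x - c)"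

lemma smooth_step_exists: "\<exists>\<theta> \<Phi> \<Psi> c. smooth_step \<theta> \<Phi> \<Psi> c"
proof -
  define \<beta> where "\<beta> x = flat_exp 0 x * flat_exp 0 (1 - x)" for x
  have "(\<lambda>x. flat_exp 0 (1 * x + 0) * flat_exp 0 ((-1) * x + 1)) \<in> flat_algebra"
    by (intro flat_algebra.intros)
  then have \<beta>_alg: "\<beta> \<in> flat_algebra" by (simp add: \<beta>_def[abs_def])
  then have \<beta>_smooth: "smooth_on UNIV \<beta>" by (rule smooth_on_flat_algebra)
  have \<beta>_cont: "continuous_on UNIV \<beta>"
    by (intro continuous_at_imp_continuous_on ballI DERIV_isCont[OF smooth_on_UNIV_deriv(2)[OF \<beta>_smooth]])
  obtain B where B: "\<And>x. (B has_real_derivative \<beta> x) (at x)"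
    using continuous_has_primitive[OF \<beta>_cont] by blast
  have \<beta>0: "0 \<le> \<beta> x" for x by (simp add: \<beta>_def flat_exp_def)
  have mono: "B x \<le> B y" if "x \<le> y" for x y
    by (rule DERIV_nonneg_imp_nondecreasing[OF that]) (use B \<beta>0 in blast)
  have B_flat: "(B has_real_derivative 0) (at x)" if "x \<le> 0 \<or> 1 \<le> x" for x
    using B[of x] that by (auto simp: \<beta>_def flat_exp_def)
  have B_cont: "continuous_on S B" for S
    by (rule DERIV_continuous_on) (rule has_field_derivative_at_within[OF B])
  have B_left: "B x = B 0" if "x \<le> 0" for x
  proof (cases "x = 0")
    case False
    have "B 0 = B x"
    proof (rule DERIV_isconst2[of x 0])
      show "(B has_real_derivative 0) (at y)" if "y < 0" for y using that by (intro B_flat) simp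
    qed (use that False B_cont in auto)
    then show ?thesis by simp
  qed simp
  have B_right: "B x = B 1" if "1 \<le> x" for x
  proof (cases "x = 1")
    case False
    show ?thesis
    proof (rule DERIV_isconst2[of 1 x])
      show "(B has_real_derivative 0) (at y)" if "1 < y" for y using that by (intro B_flat) simp
    qed (use that False B_cont in auto)
  qed simp
  have B01: "B 0 < B 1"
  proof (rule DERIV_pos_imp_increasing_open[of 0 1 B])
    show "\<exists>y. (B has_real_derivative y) (at x) \<and> 0 < y" if "0 < x" "x < 1" for x
      using B[of x] that by (intro exI[of _ "\<beta> x"]) (auto simp: \<beta>_def flat_exp_def)
    show "continuous_on {0..1} B" by (rule B_cont)
  qed simp
  define m where "m = B 1 - B 0"
  have m: "0 < m" using B01 by (simp add: m_def)
  define \<Phi> where "\<Phi> x = (B x - B 0) / m" for x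
  define \<theta> where "\<theta> x = \<beta> x / m" for x
  have \<Phi>: "(\<Phi> has_real_derivative \<theta> x) (at x)" for x
    unfolding \<Phi>_def[abs_def] \<theta>_def using B m by (auto intro!: derivative_eq_intros)
  have \<Phi>_cont: "continuous_on UNIV \<Phi>"
    by (rule DERIV_continuous_on) (rule has_field_derivative_at_within[OF \<Phi>])
  obtain P where P: "\<And>x. (P has_real_derivative \<Phi> x) (at x)"
    using continuous_has_primitive[OF \<Phi>_cont] by blast
  define \<Psi> where "\<Psi> x = P x - P 0" for x
  have \<Psi>: "(\<Psi> has_real_derivative \<Phi> x) (at x)" for x
    unfolding \<Psi>_def[abs_def] using P by (auto intro!: derivative_eq_intros)
  have sm\<Phi>: "smooth_on UNIV \<Phi>"
  proof (rule smooth_on_UNIV_primitive[OF _ \<Phi>])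
    show "smooth_on UNIV \<theta>"
      using smooth_on_UNIV_combination[OF \<beta>_smooth smooth_on_UNIV_const, of "1/m" 1 0 0]
      by (simp add: \<theta>_def[abs_def])
  qed
  have sm\<Psi>: "smooth_on UNIV \<Psi>" by (rule smooth_on_UNIV_primitive[OF sm\<Phi> \<Psi>])
  have \<Phi>0: "\<Phi> x = 0" if "x \<le> 0" for x using B_left[OF that] by (simp add: \<Phi>_def)
  have \<Phi>1: "\<Phi> x = 1" if "1 \<le> x" for x using B_right[OF that] m by (simp add: \<Phi>_def m_def)
  have \<Phi>_ge: "0 \<le> \<Phi> x" for x
    using mono[of 0 x] \<Phi>0[of x] m by (cases "x \<le> 0") (auto simp: \<Phi>_def)
  have \<Phi>_le: "\<Phi> x \<le> 1" for x
    using mono[of x 1] \<Phi>1[of x] m by (cases "1 \<le> x") (auto simp: \<Phi>_def m_def divide_simps)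
  have \<Psi>0: "\<Psi> x = 0" if "x \<le> 0" for x
  proof (cases "x = 0")
    case False
    have "\<Psi> 0 = \<Psi> x"
    proof (rule DERIV_isconst2[of x 0])
      show "continuous_on {x..0} \<Psi>"
        by (rule DERIV_continuous_on) (rule has_field_derivative_at_within[OF \<Psi>])
      show "(\<Psi> has_real_derivative 0) (at y)" if "y < 0" for y
        using \<Psi>[of y] \<Phi>0[of y] that by simp
    qed (use that False in auto)
    then show ?thesis by (simp add: \<Psi>_def)
  qed (simp add: \<Psi>_def)
  have \<Psi>1: "\<Psi> x = x - (1 - \<Psi> 1)" if "1 \<le> x" for x
  proof (cases "x = 1")
    case False
    have d: "((\<lambda>x. \<Psi> x - x) has_real_derivative \<Phi> x - 1) (at x)" for x
      by (auto intro!: derivative_eq_intros \<Psi>)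
    have "\<Psi> x - x = \<Psi> 1 - 1"
    proof (rule DERIV_isconst2[of 1 x "\<lambda>x. \<Psi> x - x" x])
      show "continuous_on {1..x} (\<lambda>x. \<Psi> x - x)"
        by (rule DERIV_continuous_on) (rule has_field_derivative_at_within[OF d])
      show "((\<lambda>x. \<Psi> x - x) has_real_derivative 0) (at y)" if "1 < y" "y < x" for y
        using d[of y] \<Phi>1[of y] that by simp
    qed (use that False in auto)
    then show ?thesis by simp
  qed simp
  have \<theta>0: "0 \<le> \<theta> x" for x using \<beta>0 m by (simp add: \<theta>_def)
  have \<theta>_cont: "continuous_on UNIV \<theta>" unfolding \<theta>_def[abs_def] using m by (intro continuous_intros \<beta>_cont) auto
  have 1: "\<forall>x. (\<Phi> has_real_derivative \<theta> x) (at x) \<and> (\<Psi> has_real_derivative \<Phi> x) (at x)"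
    by (intro allI conjI \<Phi> \<Psi>)
  have 2: "\<forall>x. 0 \<le> \<theta> x \<and> 0 \<le> \<Phi> x \<and> \<Phi> x \<le> 1" by (intro allI conjI \<theta>0 \<Phi>_ge \<Phi>_le)
  have 3: "\<forall>x\<le>0. \<Phi> x = 0 \<and> \<Psi> x = 0" using \<Phi>0 \<Psi>0 by blast
  have 4: "\<forall>x\<ge>1. \<Phi> x = 1 \<and> \<Psi> x = x - (1 - \<Psi> 1)" using \<Phi>1 \<Psi>1 by blast
  have "smooth_step \<theta> \<Phi> \<Psi> (1 - \<Psi> 1)"
    unfolding smooth_step_def by (intro conjI 1 2 3 4 sm\<Phi> sm\<Psi> \<theta>_cont)
  then show ?thesis by blast
qed

section \<open>Generalized derivatives and primitives\<close>

lemma eventually_one_le_divide: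
  fixes \<delta> :: "nat \<Rightarrow> real"
  assumes "\<And>n. 0 < \<delta> n" "\<delta> \<longlonglongrightarrow> 0" "0 < x"
  shows "\<forall>\<^sub>F n in sequentially. 1 \<le> x / \<delta> n"
proof -
  have "\<forall>\<^sub>F n in sequentially. \<delta> n < x" using order_tendstoD(2)[OF assms(2,3)] .
  then show ?thesis by eventually_elim (use assms(1) in \<open>auto simp: field_simps less_imp_le\<close>)
qed

text \<open>The test function rises from 0 to 1 right after time 0 and descends to 0 linearly between \<open>b\<close> and
  \<open>b + \<eta>\<close>, both smoothed at scale \<open>\<delta>\<close>. As \<open>\<delta>\<close> tends to 0, the rise contributes nothing since \<open>\<phi>\<close> is small
  near 0, and the descent contributes the mean of \<open>\<phi>\<close> between \<open>b\<close> and \<open>b + \<eta>\<close>. The weight of \<open>q\<close> is \<open>\<eta>\<close>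
  times the limiting trapezoid.\<close>
lemma generalized_derivative_trapezoid:
  fixes \<phi> q :: "real \<Rightarrow> real"
  assumes gd: "has_generalized_derivative T \<phi> q"
    and \<phi>: "set_integrable lborel {0<..<T} \<phi>" and q: "set_integrable lborel {0<..<T} q"
    and init: "\<And>e. 0 < e \<Longrightarrow> \<exists>r>0. AE t in lborel. 0 < t \<and> t < r \<longrightarrow> \<bar>\<phi> t\<bar> \<le> e"
    and b: "0 < b" "0 < \<eta>" "b + \<eta> < T"
  shows "(LINT t:{b<..b+\<eta>}|lborel. \<phi> t)
    = (LINT t:{0<..<T}|lborel. q t * (\<eta> - max 0 (t - b) + max 0 (t - (b + \<eta>))))"
proof -
  obtain \<theta> \<Phi> \<Psi> c where step: "smooth_step \<theta> \<Phi> \<Psi> c" using smooth_step_exists by blast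
  have \<Phi>: "(\<Phi> has_real_derivative \<theta> x) (at x)" and \<Psi>: "(\<Psi> has_real_derivative \<Phi> x) (at x)"
    and sm: "smooth_on UNIV \<Phi>" "smooth_on UNIV \<Psi>" and \<theta>_cont: "continuous_on UNIV \<theta>"
    and \<theta>0: "0 \<le> \<theta> x" and \<Phi>_ge: "0 \<le> \<Phi> x" and \<Phi>_le: "\<Phi> x \<le> 1"
    and \<Phi>0: "x \<le> 0 \<Longrightarrow> \<Phi> x = 0" and \<Phi>1: "1 \<le> x \<Longrightarrow> \<Phi> x = 1"
    and \<Psi>0: "x \<le> 0 \<Longrightarrow> \<Psi> x = 0" and \<Psi>1: "1 \<le> x \<Longrightarrow> \<Psi> x = x - c" for x
    using step unfolding smooth_step_def by blast+
  have [measurable]: "\<Phi> \<in> borel_measurable borel" "\<Psi> \<in> borel_measurable borel" "\<theta> \<in> borel_measurable borel"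
    by (rule borel_measurable_continuous_onI, rule DERIV_continuous_on, rule has_field_derivative_at_within, rule \<Phi> \<Psi>)+
      (rule borel_measurable_continuous_onI[OF \<theta>_cont])
  define \<phi>0 where "\<phi>0 t = indicator {0<..<T} t * \<phi> t" for t
  define q0 where "q0 t = indicator {0<..<T} t * q t" for t
  have \<phi>0: "integrable lborel \<phi>0" and q0: "integrable lborel q0"
    using \<phi> q by (simp_all add: \<phi>0_def[abs_def] q0_def[abs_def] set_integrable_def)
  have [measurable]: "\<phi>0 \<in> borel_measurable borel" "q0 \<in> borel_measurable borel" using \<phi>0 q0 by auto
  (* At scale below N the rise is complete before b, and the descent before T. *)
  define N where "N = min (b/2) (T - b - \<eta>)"
  have N: "0 < N" using b by (simp add: N_def)
  define \<delta> where "\<delta> n = (N / 2) * inverse (real (Suc n))" for n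
  have \<delta>_pos: "0 < \<delta> n" for n using N by (simp add: \<delta>_def)
  have \<delta>_lim: "\<delta> \<longlonglongrightarrow> 0"
    unfolding \<delta>_def[abs_def] using tendsto_mult[OF tendsto_const LIMSEQ_inverse_real_of_nat, of "N / 2"] by simp
  have \<delta>_N: "\<delta> n < N" for n using N by (simp add: \<delta>_def field_simps add_pos_nonneg)
  have \<delta>_b: "2 * \<delta> n < b" "b + \<eta> + \<delta> n < T" for n using \<delta>_N[of n] by (auto simp: N_def)
  let ?S = "\<lambda>n x t. \<Phi> ((t - x) / \<delta> n)" and ?R = "\<lambda>n x t. \<Psi> ((t - x) / \<delta> n)"
  let ?r = "\<lambda>n t. \<delta> n * ?R n b t - \<delta> n * ?R n (b + \<eta>) t"
  define \<psi> where "\<psi> n t = \<Phi> (t / \<delta> n - 1) - (\<delta> n / \<eta>) * (?R n b t - ?R n (b + \<eta>) t)" for n t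
  have smooth: "smooth_on UNIV (\<psi> n)" for n
  proof -
    have "smooth_on UNIV (\<lambda>t. 1 * \<Phi> (1 / \<delta> n * t + (- 1)) + (- (\<delta> n / \<eta>) * \<Psi> (1 / \<delta> n * t + (- b / \<delta> n))
        + ((\<delta> n / \<eta>) * \<Psi> (1 / \<delta> n * t + (- (b + \<eta>) / \<delta> n)) + 0)))"
      by (intro smooth_on_UNIV_combination sm smooth_on_UNIV_const)
    moreover have "\<psi> n t = 1 * \<Phi> (1 / \<delta> n * t + (- 1)) + (- (\<delta> n / \<eta>) * \<Psi> (1 / \<delta> n * t + (- b / \<delta> n))
        + ((\<delta> n / \<eta>) * \<Psi> (1 / \<delta> n * t + (- (b + \<eta>) / \<delta> n)) + 0))" for t
      unfolding \<psi>_def by (simp add: diff_divide_distrib add_divide_distrib algebra_simps)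
    then have "\<psi> n = (\<lambda>t. 1 * \<Phi> (1 / \<delta> n * t + (- 1)) + (- (\<delta> n / \<eta>) * \<Psi> (1 / \<delta> n * t + (- b / \<delta> n))
        + ((\<delta> n / \<eta>) * \<Psi> (1 / \<delta> n * t + (- (b + \<eta>) / \<delta> n)) + 0)))" by (rule ext)
    ultimately show ?thesis by (simp only:)
  qed
  define \<psi>' where "\<psi>' n t = (1 / \<delta> n) * \<theta> (t / \<delta> n - 1) - (1 / \<eta>) * (?S n b t - ?S n (b + \<eta>) t)" for n t
  have d\<psi>: "(\<psi> n has_real_derivative \<psi>' n t) (at t)" for n t
  proof -
    have a1: "((\<lambda>t. t / \<delta> n - 1) has_real_derivative 1 / \<delta> n) (at t)"
      and a2: "((\<lambda>t. (t - x) / \<delta> n) has_real_derivative 1 / \<delta> n) (at t)" for x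
      using \<delta>_pos[of n] by (auto intro!: derivative_eq_intros)
    show ?thesis unfolding \<psi>_def[abs_def] \<psi>'_def
      by (rule derivative_eq_intros DERIV_chain2[OF \<Phi> a1] DERIV_chain2[OF \<Psi> a2] refl)+
        (use \<delta>_pos[of n] b in \<open>simp add: field_simps\<close>)
  qed
  have test: "test_function T (\<psi> n)" for n
    unfolding test_function_def
  proof (intro conjI smooth exI allI impI)
    show "0 < \<delta> n" by (rule \<delta>_pos)
    show "\<delta> n \<le> b + \<eta> + \<delta> n" using b by simp
    show "b + \<eta> + \<delta> n < T" by (rule \<delta>_b)
    fix t assume "t \<notin> {\<delta> n..b + \<eta> + \<delta> n}"
    then consider "t < \<delta> n" | "b + \<eta> + \<delta> n < t" by fastforce
    then show "\<psi> n t = 0"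
    proof cases
      case 1
      then show ?thesis using \<delta>_pos[of n] \<delta>_b(1)[of n] b
        by (simp add: \<psi>_def \<Phi>0 \<Psi>0 divide_simps)
    next
      case 2
      then have "\<Phi> (t / \<delta> n - 1) = 1"
        using \<delta>_pos[of n] \<delta>_b(1)[of n] b by (intro \<Phi>1) (simp add: field_simps)
      moreover have "?R n b t = (t - b) / \<delta> n - c" "?R n (b + \<eta>) t = (t - (b + \<eta>)) / \<delta> n - c"
        using 2 \<delta>_pos[of n] b by (intro \<Psi>1; simp add: field_simps)+
      ultimately show ?thesis using \<delta>_pos[of n] b by (simp add: \<psi>_def diff_divide_distrib[symmetric])
    qed
  qed
  have weak: "(LINT t|lborel. \<phi>0 t * \<psi>' n t) = - (LINT t|lborel. q0 t * \<psi> n t)" for n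
  proof -
    have "deriv (\<psi> n) = \<psi>' n" by (intro ext DERIV_imp_deriv d\<psi>)
    then show ?thesis
      using gd test[of n] unfolding has_generalized_derivative_def
      by (auto simp: set_lebesgue_integral_def \<phi>0_def q0_def mult.assoc)
  qed
  define I1 where "I1 n = (LINT t|lborel. \<phi>0 t * ((1 / \<delta> n) * \<theta> (t / \<delta> n - 1)))" for n
  define I2 where "I2 n = (LINT t|lborel. \<phi>0 t * (?S n b t - ?S n (b + \<eta>) t))" for n
  have \<theta>_out: "\<theta> x = 0" if "x < 0 \<or> 1 < x" for x
  proof -
    have "((\<lambda>x. 0) has_real_derivative \<theta> x) (at x)" if "x < 0"
      by (rule has_field_derivative_transform_within_open[OF \<Phi>, of "{..<0}"]) (use that \<Phi>0 in auto)
    moreover have "((\<lambda>x. 1) has_real_derivative \<theta> x) (at x)" if "1 < x"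
      by (rule has_field_derivative_transform_within_open[OF \<Phi>, of "{1<..}"]) (use that \<Phi>1 in auto)
    ultimately show ?thesis using that DERIV_unique[OF _ DERIV_const] by blast
  qed
  obtain B where B: "\<And>x. \<theta> x \<le> B"
  proof -
    have "compact (\<theta> ` {0..1})" by (intro compact_continuous_image continuous_on_subset[OF \<theta>_cont]) auto
    then have "bounded (\<theta> ` {0..1})" by (rule compact_imp_bounded)
    then obtain B where "\<forall>x\<in>{0..1}. \<bar>\<theta> x\<bar> \<le> B" unfolding bounded_iff by auto
    then have B: "\<bar>\<theta> x\<bar> \<le> B" if "x \<in> {0..1}" for x using that by blast
    have "0 \<le> B" using B[of 0] by auto
    have "\<theta> x \<le> B" for x
      using B[of x] \<theta>_out[of x] \<open>0 \<le> B\<close> by (cases "x \<in> {0..1}") auto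
    then show ?thesis by (rule that)
  qed
  have \<theta>_abs: "\<bar>\<theta> x\<bar> \<le> B" for x using B \<theta>0 by simp
  have I1_bound: "\<bar>I1 n\<bar> \<le> B * e" if e: "0 < e" "AE t in lborel. 0 < t \<and> t < r \<longrightarrow> \<bar>\<phi> t\<bar> \<le> e" "2 * \<delta> n < r" for n e r
  proof -
    have "AE t in lborel. \<bar>\<phi>0 t * ((1 / \<delta> n) * \<theta> (t / \<delta> n - 1))\<bar> \<le> (B * e / \<delta> n) * indicator {\<delta> n..2 * \<delta> n} t"
      using e(2)
    proof eventually_elim
      case (elim t)
      show ?case
      proof (cases "t \<in> {\<delta> n..2 * \<delta> n}")
        case True
        then have "\<bar>\<phi>0 t\<bar> \<le> e" using elim e \<delta>_pos[of n] by (auto simp: \<phi>0_def indicator_def)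
        then have "\<bar>\<phi>0 t\<bar> * \<bar>\<theta> (t / \<delta> n - 1)\<bar> \<le> e * B"
          using \<theta>_abs e by (intro mult_mono) auto
        then show ?thesis using True \<delta>_pos[of n] by (simp add: abs_mult divide_right_mono mult.commute)
      next
        case False
        then have "\<theta> (t / \<delta> n - 1) = 0" using \<delta>_pos[of n] by (intro \<theta>_out) (auto simp: field_simps)
        with False show ?thesis by simp
      qed
    qed
    then have "\<bar>I1 n\<bar> \<le> (LINT t|lborel. (B * e / \<delta> n) * indicator {\<delta> n..2 * \<delta> n} t)"
      unfolding I1_def real_norm_def[symmetric]
      by (intro norm_integral_le_AE(2) integrable_mult_right integrable_real_indicator) (auto simp: emeasure_lborel_Icc_eq)
    also have "\<dots> = B * e" using \<delta>_pos[of n] by simp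
    finally show ?thesis .
  qed
  have I1_lim: "I1 \<longlonglongrightarrow> 0"
  proof (rule LIMSEQ_I)
    fix e :: real assume e: "0 < e"
    have B0: "0 \<le> B" using \<theta>0 B order_trans by blast
    define e' where "e' = e / (B + 1)"
    have e': "0 < e'" "B * e' < e" using e B0 by (auto simp: e'_def field_simps)
    obtain r where r: "0 < r" "AE t in lborel. 0 < t \<and> t < r \<longrightarrow> \<bar>\<phi> t\<bar> \<le> e'" using init[OF e'(1)] by blast
    have "\<forall>\<^sub>F n in sequentially. \<delta> n < r / 2" using order_tendstoD(2)[OF \<delta>_lim, of "r/2"] r by simp
    then have "\<forall>\<^sub>F n in sequentially. norm (I1 n - 0) < e"
    proof eventually_elim
      case (elim n)
      then show ?case using I1_bound[OF e'(1) r(2), of n] e'(2) by simp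
    qed
    then show "\<exists>no. \<forall>n\<ge>no. norm (I1 n - 0) < e" by (simp add: eventually_sequentially)
  qed
  have \<Phi>_lim: "(\<lambda>n. ?S n x t) \<longlonglongrightarrow> indicator {x<..} t" for t x
  proof (cases "x < t")
    case True
    have "\<forall>\<^sub>F n in sequentially. 1 \<le> (t - x) / \<delta> n" by (rule eventually_one_le_divide) (use \<delta>_pos \<delta>_lim True in auto)
    then have "\<forall>\<^sub>F n in sequentially. ?S n x t = indicator {x<..} t"
      by eventually_elim (use True \<Phi>1 in auto)
    then show ?thesis by (rule tendsto_eventually)
  next
    case False
    then have "(t - x) / \<delta> n \<le> 0" for n using \<delta>_pos[of n] by (simp add: divide_nonpos_pos)
    then show ?thesis using False by (simp add: \<Phi>0)
  qed
  have \<Psi>_lim: "(\<lambda>n. \<delta> n * ?R n x t) \<longlonglongrightarrow> max 0 (t - x)" for t x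
  proof (cases "x < t")
    case True
    have "\<forall>\<^sub>F n in sequentially. 1 \<le> (t - x) / \<delta> n" by (rule eventually_one_le_divide) (use \<delta>_pos \<delta>_lim True in auto)
    then have "\<forall>\<^sub>F n in sequentially. (t - x) - c * \<delta> n = \<delta> n * ?R n x t"
    proof eventually_elim
      case (elim n)
      then show ?case using \<delta>_pos[of n] by (simp add: \<Psi>1 field_simps)
    qed
    moreover have "(\<lambda>n. (t - x) - c * \<delta> n) \<longlonglongrightarrow> (t - x) - c * 0" by (intro tendsto_intros \<delta>_lim)
    ultimately show ?thesis using True by (auto intro: Lim_transform_eventually)
  next
    case False
    then have "(t - x) / \<delta> n \<le> 0" for n using \<delta>_pos[of n] by (simp add: divide_nonpos_pos)
    then show ?thesis using False by (simp add: \<Psi>0)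
  qed
  have \<Psi>_nonneg: "0 \<le> \<Psi> x \<and> \<Psi> x \<le> \<bar>x\<bar>" for x
  proof (cases "x \<le> 0")
    case False
    have "\<Psi> 0 \<le> \<Psi> x" using False by (intro DERIV_nonneg_imp_nondecreasing[of 0 x \<Psi>]) (use \<Psi> \<Phi>_ge in auto)
    moreover have "(\<lambda>x. x - \<Psi> x) 0 \<le> (\<lambda>x. x - \<Psi> x) x"
    proof (rule DERIV_nonneg_imp_nondecreasing[of 0 x "\<lambda>x. x - \<Psi> x"])
      fix y
      have "((\<lambda>x. x - \<Psi> x) has_real_derivative 1 - \<Phi> y) (at y)" by (rule DERIV_diff[OF DERIV_ident \<Psi>])
      then show "\<exists>z. ((\<lambda>x. x - \<Psi> x) has_real_derivative z) (at y) \<and> 0 \<le> z" using \<Phi>_le[of y] by (intro exI[of _ "1 - \<Phi> y"]) auto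
    qed (use False in auto)
    ultimately show ?thesis using \<Psi>0[of 0] False by simp
  qed (simp add: \<Psi>0)
  have \<delta>\<Psi>: "0 \<le> \<delta> n * ?R n x t" "\<delta> n * ?R n x t \<le> \<bar>t - x\<bar>" for n t x
  proof -
    have "\<delta> n * ?R n x t \<le> \<delta> n * \<bar>(t - x) / \<delta> n\<bar>"
      using \<Psi>_nonneg[of "(t - x) / \<delta> n"] \<delta>_pos[of n] by (intro mult_left_mono) (simp_all only: less_imp_le)
    then show "\<delta> n * ?R n x t \<le> \<bar>t - x\<bar>" using \<delta>_pos[of n] by simp
    show "0 \<le> \<delta> n * ?R n x t" using \<Psi>_nonneg \<delta>_pos[of n] by (simp add: less_imp_le)
  qed
  have I2_lim: "I2 \<longlonglongrightarrow> (LINT t|lborel. \<phi>0 t * (indicator {b<..} t - indicator {b + \<eta><..} t))"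
    unfolding I2_def
  proof (rule integral_dominated_convergence[where w="\<lambda>t. norm (\<phi>0 t)"])
    show "AE t in lborel. (\<lambda>n. \<phi>0 t * (?S n b t - ?S n (b + \<eta>) t))
       \<longlonglongrightarrow> \<phi>0 t * (indicator {b<..} t - indicator {b + \<eta><..} t)"
      by (intro always_eventually allI tendsto_intros \<Phi>_lim)
    have "\<bar>\<Phi> x - \<Phi> y\<bar> \<le> 1" for x y using \<Phi>_ge[of x] \<Phi>_ge[of y] \<Phi>_le[of x] \<Phi>_le[of y] by linarith
    then show "AE t in lborel. norm (\<phi>0 t * (?S n b t - ?S n (b + \<eta>) t)) \<le> norm (\<phi>0 t)" for n
      by (simp add: abs_mult mult_left_le)
  qed (use \<phi>0 in auto)
  define \<omega> where "\<omega> t = 1 - (1 / \<eta>) * (max 0 (t - b) - max 0 (t - (b + \<eta>)))" for t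
  have q_lim: "(\<lambda>n. LINT t|lborel. q0 t * \<psi> n t) \<longlonglongrightarrow> (LINT t|lborel. q0 t * \<omega> t)"
  proof (rule integral_dominated_convergence[where w="\<lambda>t. (1 + (1 / \<eta>) * (4 * T)) * norm (q0 t)"])
    show "AE t in lborel. (\<lambda>n. q0 t * \<psi> n t) \<longlonglongrightarrow> q0 t * \<omega> t"
    proof (intro always_eventually allI)
      fix t
      show "(\<lambda>n. q0 t * \<psi> n t) \<longlonglongrightarrow> q0 t * \<omega> t"
      proof (cases "t \<in> {0<..<T}")
        case True
        have "\<forall>\<^sub>F n in sequentially. \<delta> n < t / 2" using order_tendstoD(2)[OF \<delta>_lim, of "t/2"] True by simp
        then have "\<forall>\<^sub>F n in sequentially. 1 = \<Phi> (t / \<delta> n - 1)"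
        proof eventually_elim
          case (elim n)
          then show ?case using \<delta>_pos[of n] by (intro \<Phi>1[symmetric]) (simp add: field_simps)
        qed
        then have s: "(\<lambda>n. \<Phi> (t / \<delta> n - 1)) \<longlonglongrightarrow> 1" by (rule Lim_transform_eventually[OF tendsto_const])
        have "(\<lambda>n. q0 t * (\<Phi> (t / \<delta> n - 1) - (1 / \<eta>) * (?r n t))) \<longlonglongrightarrow> q0 t * \<omega> t"
          unfolding \<omega>_def by (intro tendsto_intros s \<Psi>_lim)
        then show ?thesis by (simp add: \<psi>_def right_diff_distrib)
      qed (simp add: q0_def)
    qed
    show "AE t in lborel. norm (q0 t * \<psi> n t) \<le> (1 + (1 / \<eta>) * (4 * T)) * norm (q0 t)" for n
    proof (intro always_eventually allI)
      fix t
      show "norm (q0 t * \<psi> n t) \<le> (1 + (1 / \<eta>) * (4 * T)) * norm (q0 t)"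
      proof (cases "t \<in> {0<..<T}")
        case True
        have 1: "\<psi> n t = \<Phi> (t / \<delta> n - 1) - (1 / \<eta>) * (?r n t)"
          by (simp add: \<psi>_def right_diff_distrib)
        have "\<bar>t - x\<bar> \<le> 2 * T" if "0 < x" "x < T" for x using that True by auto
        then have "\<bar>?r n t\<bar> \<le> 4 * T"
          using \<delta>\<Psi>[of n t b] \<delta>\<Psi>[of n t "b + \<eta>"] b by (smt (verit))
        then have "(1 / \<eta>) * \<bar>?r n t\<bar> \<le> (1 / \<eta>) * (4 * T)"
          using b by (intro mult_left_mono) auto
        then have "\<bar>(1 / \<eta>) * (?r n t)\<bar> \<le> (1 / \<eta>) * (4 * T)"
          using b by (simp add: abs_mult)
        then have "\<bar>\<psi> n t\<bar> \<le> 1 + (1 / \<eta>) * (4 * T)"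
          unfolding 1 using \<Phi>_ge[of "t / \<delta> n - 1"] \<Phi>_le[of "t / \<delta> n - 1"] by linarith
        from mult_right_mono[OF this abs_ge_zero[of "q0 t"]] show ?thesis
          by (simp only: real_norm_def abs_mult mult.commute[of "\<bar>q0 t\<bar>"])
      qed (simp add: q0_def)
    qed
  qed (use q0 in \<open>auto simp: \<psi>_def \<omega>_def\<close>)
  have eqn: "I1 n - (1 / \<eta>) * I2 n = - (LINT t|lborel. q0 t * \<psi> n t)" for n
  proof -
    have i1: "integrable lborel (\<lambda>t. \<phi>0 t * ((1 / \<delta> n) * \<theta> (t / \<delta> n - 1)))"
    proof (rule Bochner_Integration.integrable_bound)
      show "integrable lborel (\<lambda>t. (B / \<delta> n) * \<phi>0 t)" using \<phi>0 by simp
      have "\<bar>\<phi>0 t\<bar> * \<bar>\<theta> (t / \<delta> n - 1)\<bar> \<le> \<bar>\<phi>0 t\<bar> * B" for t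
        using \<theta>_abs by (intro mult_left_mono) auto
      moreover have "\<bar>B\<bar> = B" using order_trans[OF \<theta>0 B] by simp
      ultimately have "\<bar>\<phi>0 t\<bar> * \<bar>\<theta> (t / \<delta> n - 1)\<bar> / \<delta> n \<le> \<bar>\<phi>0 t\<bar> * \<bar>B\<bar> / \<delta> n" for t
        using \<delta>_pos[of n] by (intro divide_right_mono) auto
      then show "AE t in lborel. norm (\<phi>0 t * (1 / \<delta> n * \<theta> (t / \<delta> n - 1))) \<le> norm (B / \<delta> n * \<phi>0 t)"
        using \<delta>_pos[of n] by (simp add: abs_mult abs_divide mult.commute)
    qed auto
    have i2: "integrable lborel (\<lambda>t. \<phi>0 t * (?S n b t - ?S n (b + \<eta>) t))"
    proof (rule Bochner_Integration.integrable_bound[OF \<phi>0])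
      have "\<bar>\<Phi> x - \<Phi> y\<bar> \<le> 1" for x y using \<Phi>_ge[of x] \<Phi>_ge[of y] \<Phi>_le[of x] \<Phi>_le[of y] by linarith
      then show "AE t in lborel. norm (\<phi>0 t * (?S n b t - ?S n (b + \<eta>) t)) \<le> norm (\<phi>0 t)"
        by (simp add: abs_mult mult_left_le)
    qed auto
    have "\<phi>0 t * \<psi>' n t = \<phi>0 t * ((1 / \<delta> n) * \<theta> (t / \<delta> n - 1))
        - (1 / \<eta>) * (\<phi>0 t * (?S n b t - ?S n (b + \<eta>) t))" for t
      by (simp add: \<psi>'_def algebra_simps)
    then have "(LINT t|lborel. \<phi>0 t * \<psi>' n t) = I1 n - (1 / \<eta>) * I2 n"
      unfolding I1_def I2_def using i1 i2 by (simp only: Bochner_Integration.integral_diff integrable_mult_right integral_mult_right_zero)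
    then show ?thesis using weak[of n] by simp
  qed
  have "(\<lambda>n. I1 n - (1 / \<eta>) * I2 n) \<longlonglongrightarrow> 0 - (1 / \<eta>) * (LINT t|lborel. \<phi>0 t * (indicator {b<..} t - indicator {b + \<eta><..} t))"
    by (intro tendsto_intros I1_lim I2_lim)
  moreover have "(\<lambda>n. I1 n - (1 / \<eta>) * I2 n) \<longlonglongrightarrow> - (LINT t|lborel. q0 t * \<omega> t)"
    unfolding eqn by (intro tendsto_intros q_lim)
  ultimately have "(1 / \<eta>) * (LINT t|lborel. \<phi>0 t * (indicator {b<..} t - indicator {b + \<eta><..} t)) = (LINT t|lborel. q0 t * \<omega> t)"
    using LIMSEQ_unique by fastforce
  then have "(LINT t|lborel. \<phi>0 t * (indicator {b<..} t - indicator {b + \<eta><..} t)) = \<eta> * (LINT t|lborel. q0 t * \<omega> t)"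
    using b by (simp add: field_simps)
  also have "\<dots> = (LINT t|lborel. q0 t * (\<eta> * \<omega> t))" by (simp add: mult.left_commute flip: integral_mult_right_zero)
  finally have main: "(LINT t|lborel. \<phi>0 t * (indicator {b<..} t - indicator {b + \<eta><..} t)) = (LINT t|lborel. q0 t * (\<eta> * \<omega> t))" .
  have "q0 t * (\<eta> * \<omega> t) = indicator {0<..<T} t *\<^sub>R (q t * (\<eta> - max 0 (t - b) + max 0 (t - (b + \<eta>))))" for t
    using b by (simp add: \<omega>_def q0_def field_simps)
  moreover have "\<phi>0 t * (indicator {b<..} t - indicator {b + \<eta><..} t) = indicator {b<..b+\<eta>} t *\<^sub>R \<phi> t" for t
    using b by (auto simp: \<phi>0_def indicator_def)
  ultimately show ?thesis using main by (simp add: set_lebesgue_integral_def)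
qed

text \<open>A form of du Bois-Reymond's lemma in which the behaviour at 0 fixes the constant. By Fubini's
  theorem the trapezoidal weight of \<open>q\<close> is what remains of the integral of its primitive between \<open>b\<close>
  and \<open>b + \<eta>\<close>, so \<open>\<phi>\<close> and the primitive have the same integrals over all small intervals.\<close>
lemma generalized_derivative_imp_primitive:
  fixes \<phi> q :: "real \<Rightarrow> real"
  assumes T: "0 < T" and gd: "has_generalized_derivative T \<phi> q"
    and \<phi>: "set_integrable lborel {0<..<T} \<phi>" and q: "set_integrable lborel {0<..<T} q"
    and init: "\<And>e. 0 < e \<Longrightarrow> \<exists>r>0. AE t in lborel. 0 < t \<and> t < r \<longrightarrow> \<bar>\<phi> t\<bar> \<le> e"
  shows "AE t in lborel. t \<in> {0<..<T} \<longrightarrow> \<phi> t = (LINT s:{0<..<t}|lborel. q s)"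
proof -
  define q0 where "q0 t = indicator {0<..<T} t * q t" for t
  have q0: "integrable lborel q0"
    using q by (simp add: q0_def[abs_def] set_integrable_def)
  have [measurable]: "q0 \<in> borel_measurable borel" using q0 by auto
  define Q where "Q t = (LINT s|lborel. indicator {0<..<t} s * q0 s)" for t
  have Q_le: "\<bar>Q t\<bar> \<le> (LINT s|lborel. \<bar>q0 s\<bar>)" for t
    unfolding Q_def real_norm_def[symmetric]
    by (rule norm_integral_le_AE(2)) (use q0 in \<open>auto simp: indicator_def\<close>)
  have [measurable]: "Q \<in> borel_measurable borel" unfolding Q_def[abs_def] indicator_def by simp measurable
  have Q_int: "set_integrable lborel {b<..c} Q" for b c
    unfolding set_integrable_def
  proof (rule Bochner_Integration.integrable_bound)
    show "integrable lborel (\<lambda>t. indicator {b<..c} t * (LINT s|lborel. \<bar>q0 s\<bar>))"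
      by (intro integrable_mult_left integrable_indicator_Ioc)
  qed (use Q_le in \<open>auto simp: indicator_def\<close>)
  have "AE t in lborel. t \<in> {0<..<T} \<longrightarrow> \<phi> t - Q t = 0"
  proof (rule AE_zero_if_interval_integrals_zero)
    have "set_integrable lborel {0<..<T} Q" by (rule set_integrable_subset[OF Q_int[of 0 T]]) auto
    then show "set_integrable lborel {0<..<T} (\<lambda>t. \<phi> t - Q t)" using \<phi> by (rule set_integral_diff(1)[rotated])
    fix b c assume bc: "0 < b" "b < c" "c < T"
    define \<eta> where "\<eta> = c - b"
    have \<eta>: "0 < \<eta>" "c = b + \<eta>" using bc by (auto simp: \<eta>_def)
    define m where "m s = \<eta> - max 0 (s - b) + max 0 (s - c)" for s
    have meas: "(LINT t|lborel. indicator {b<..c} t * (indicator {0<..<t} s :: real)) = m s" if "0 < s" for s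
    proof -
      have "(LINT t|lborel. indicator {b<..c} t * (indicator {0<..<t} s :: real)) = (LINT t|lborel. indicator ({b<..c} \<inter> {s<..}) t)"
        using that by (intro Bochner_Integration.integral_cong) (auto simp: indicator_def)
      also have "{b<..c} \<inter> {s<..} = {max b s<..c}" by auto
      also have "(LINT t|lborel. indicator {max b s<..c} t) = max 0 (c - max b s)"
        by (simp add: max_def)
      also have "\<dots> = m s" using bc by (auto simp: m_def \<eta>_def max_def)
      finally show ?thesis .
    qed
    have pr: "integrable (lborel \<Otimes>\<^sub>M lborel) (\<lambda>(s, t). q0 s * (indicator {b<..c} t * indicator {0<..<t} s))"
    proof (rule Bochner_Integration.integrable_bound)
      show "integrable (lborel \<Otimes>\<^sub>M lborel) (\<lambda>(s, t). q0 s * (indicator {b<..c} t :: real))"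
      proof (rule lborel_pair.Fubini_integrable)
        show "integrable lborel (\<lambda>x. LINT y|lborel. norm (case (x, y) of (s, t) \<Rightarrow> q0 s * (indicator {b<..c} t :: real)))"
          using q0 by (simp add: abs_mult)
        show "AE x in lborel. integrable lborel (\<lambda>y. case (x, y) of (s, t) \<Rightarrow> q0 s * (indicator {b<..c} t :: real))"
          by (auto intro!: integrable_mult_right integrable_indicator_Ioc)
      qed measurable
      show "(\<lambda>(s, t). q0 s * (indicator {b<..c} t * indicator {0<..<t} s)) \<in> borel_measurable (lborel \<Otimes>\<^sub>M lborel)"
        unfolding indicator_def greaterThanLessThan_iff by measurable
    qed (auto simp: indicator_def)
    have "(LINT t:{b<..c}|lborel. Q t) = (LINT t|lborel. LINT s|lborel. q0 s * (indicator {b<..c} t * indicator {0<..<t} s))"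
      unfolding set_lebesgue_integral_def Q_def
      by (intro Bochner_Integration.integral_cong refl) (simp add: mult_ac flip: integral_mult_right_zero)
    also have "\<dots> = (LINT s|lborel. LINT t|lborel. q0 s * (indicator {b<..c} t * indicator {0<..<t} s))"
      using lborel_pair.Fubini_integral[OF pr] by simp
    also have "\<dots> = (LINT s|lborel. q0 s * m s)"
    proof (intro Bochner_Integration.integral_cong refl)
      fix s
      show "(LINT t|lborel. q0 s * (indicator {b<..c} t * indicator {0<..<t} s)) = q0 s * m s"
        using meas[of s] by (cases "0 < s") (auto simp: q0_def)
    qed
    also have "\<dots> = (LINT t:{b<..c}|lborel. \<phi> t)"
      using generalized_derivative_trapezoid[OF gd \<phi> q init bc(1) \<eta>(1)] bc(3) \<eta>(2)
      by (simp add: set_lebesgue_integral_def q0_def m_def mult.assoc)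
    finally have "(LINT t:{b<..c}|lborel. Q t) = (LINT t:{b<..c}|lborel. \<phi> t)" .
    moreover have "set_integrable lborel {b<..c} \<phi>" by (rule set_integrable_subset[OF \<phi>]) (use bc in auto)
    ultimately show "(LINT t:{b<..c}|lborel. \<phi> t - Q t) = 0" using Q_int by (simp add: set_integral_diff(2))
  qed
  then show ?thesis
  proof eventually_elim
    case (elim t)
    show ?case
    proof
      assume t: "t \<in> {0<..<T}"
      have "Q t = (LINT s:{0<..<t}|lborel. q s)" unfolding Q_def set_lebesgue_integral_def q0_def
        using t by (intro Bochner_Integration.integral_cong) (auto simp: indicator_def)
      with elim t show "\<phi> t = (LINT s:{0<..<t}|lborel. q s)" by simp
    qed
  qed
qed

lemma generalized_derivative_cong_AE:
  assumes gd: "has_generalized_derivative T \<phi> g'"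
    and q: "set_integrable lborel {0<..<T} q"
    and eq: "AE t in lborel. t \<in> {0<..<T} \<longrightarrow> g' t = q t"
  shows "has_generalized_derivative T \<phi> q"
  unfolding has_generalized_derivative_def
proof (intro conjI allI impI)
  fix a b assume ab: "0 < a \<and> a \<le> b \<and> b < T"
  then show "set_integrable lborel {a..b} \<phi>" using gd unfolding has_generalized_derivative_def by blast
  show "set_integrable lborel {a..b} q" by (rule set_integrable_subset[OF q]) (use ab in auto)
next
  fix \<psi> assume test: "test_function T \<psi>"
  then obtain a b where ab: "0 < a" "a \<le> b" "b < T" and supp: "\<And>t. t \<notin> {a..b} \<Longrightarrow> \<psi> t = 0" and sm: "smooth_on UNIV \<psi>"
    unfolding test_function_def by blast
  have [measurable]: "\<psi> \<in> borel_measurable borel"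
    by (intro borel_measurable_continuous_onI continuous_at_imp_continuous_on ballI DERIV_isCont[OF smooth_on_UNIV_deriv(2)[OF sm]])
  have "set_integrable lborel {a..b} g'" using gd ab unfolding has_generalized_derivative_def by blast
  then have m1: "(\<lambda>t. indicator {a..b} t *\<^sub>R g' t) \<in> borel_measurable borel" unfolding set_integrable_def by auto
  have m2: "(\<lambda>t. indicator {0<..<T} t *\<^sub>R q t) \<in> borel_measurable borel" using q unfolding set_integrable_def by auto
  have "(LINT t:{0<..<T}|lborel. g' t * \<psi> t) = (LINT t|lborel. (indicator {a..b} t *\<^sub>R g' t) * \<psi> t)"
    unfolding set_lebesgue_integral_def using ab supp
    by (intro Bochner_Integration.integral_cong refl) (auto simp: indicator_def)
  also have "\<dots> = (LINT t|lborel. (indicator {0<..<T} t *\<^sub>R q t) * \<psi> t)"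
  proof (rule integral_cong_AE)
    show "AE t in lborel. (indicator {a..b} t *\<^sub>R g' t) * \<psi> t = (indicator {0<..<T} t *\<^sub>R q t) * \<psi> t"
      using eq
    proof eventually_elim
      case (elim t)
      then show ?case using ab supp[of t] by (cases "t \<in> {a..b}") auto
    qed
  qed (use m1 m2 in measurable)
  also have "\<dots> = (LINT t:{0<..<T}|lborel. q t * \<psi> t)"
    unfolding set_lebesgue_integral_def by (simp add: mult.assoc)
  finally have "(LINT t:{0<..<T}|lborel. g' t * \<psi> t) = (LINT t:{0<..<T}|lborel. q t * \<psi> t)" .
  with gd test show "(LINT t:{0<..<T}|lborel. \<phi> t * deriv \<psi> t) = - (LINT t:{0<..<T}|lborel. q t * \<psi> t)"
    unfolding has_generalized_derivative_def by auto
qed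

section \<open>Convolution on the line\<close>

text \<open>For functions extended by zero this yields both convolutions on the time interval, the backward
  one after a reflection, and associativity becomes an instance of Fubini's theorem.\<close>
definition line_conv :: "(real \<Rightarrow> real) \<Rightarrow> (real \<Rightarrow> 'a::{banach, second_countable_topology}) \<Rightarrow> real \<Rightarrow> 'a"
  where "line_conv a g t = (LINT s|lborel. a s *\<^sub>R g (t - s))"

lemma borel_measurable_line_conv [measurable]:
  assumes [measurable]: "a \<in> borel_measurable borel" "g \<in> borel_measurable borel"
  shows "line_conv a g \<in> borel_measurable borel"
  unfolding line_conv_def[abs_def] by measurable

lemma line_conv_integrable:
  fixes g :: "real \<Rightarrow> 'a::{banach, second_countable_topology}"
  assumes a: "integrable lborel a" and g: "integrable lborel g"
  shows "AE t in lborel. integrable lborel (\<lambda>s. a s *\<^sub>R g (t - s))"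
    and "integrable lborel (line_conv a g)"
  using lborel_pair.AE_integrable_fst[OF integrable_shear(1)[OF integrable_lborel_pair_scaleR[OF a g]]]
    lborel_pair.integrable_fst[OF integrable_shear(1)[OF integrable_lborel_pair_scaleR[OF a g]]]
  by (simp_all add: line_conv_def[abs_def])

lemma line_conv_commute:
  fixes a b :: "real \<Rightarrow> real"
  shows "line_conv a b = line_conv b a"
proof
  fix t
  show "line_conv a b t = line_conv b a t"
    unfolding line_conv_def using lborel_translate(4)[of "\<lambda>s. b s *\<^sub>R a (t - s)" t]
    by (simp add: mult.commute)
qed

lemma integrable_abs_line_conv:
  fixes a b :: "real \<Rightarrow> real"
  assumes "integrable lborel a" "integrable lborel b"
  shows "integrable lborel (line_conv (\<lambda>s. \<bar>a s\<bar>) (\<lambda>s. \<bar>b s\<bar>))"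
  by (rule line_conv_integrable(2)[OF integrable_abs[OF assms(1)] integrable_abs[OF assms(2)]])

text \<open>The last hypothesis is the absolute convergence of the double integral at \<open>t\<close>. It holds at almost
  every \<open>t\<close> for integrable \<open>g\<close>, and at every \<open>t\<close> for bounded \<open>g\<close>.\<close>
lemma line_conv_assoc_at:
  fixes g :: "real \<Rightarrow> 'a::{banach, second_countable_topology}"
  assumes a: "integrable lborel a" and b: "integrable lborel b" and [measurable]: "g \<in> borel_measurable borel"
    and fin: "integrable lborel (\<lambda>x. line_conv (\<lambda>s. \<bar>a s\<bar>) (\<lambda>s. \<bar>b s\<bar>) x * norm (g (t - x)))"
  shows "line_conv a (line_conv b g) t = line_conv (line_conv a b) g t"
proof -
  have [measurable]: "a \<in> borel_measurable borel" "b \<in> borel_measurable borel" using a b by auto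
  have ab: "AE x in lborel. integrable lborel (\<lambda>s. a s * b (x - s))"
    using line_conv_integrable(1)[OF a b] by simp
  have P: "integrable (lborel \<Otimes>\<^sub>M lborel) (\<lambda>(x, s). (a s * b (x - s)) *\<^sub>R g (t - x))"
  proof (rule lborel_pair.Fubini_integrable)
    show "(\<lambda>(x, s). (a s * b (x - s)) *\<^sub>R g (t - x)) \<in> borel_measurable (lborel \<Otimes>\<^sub>M lborel)" by measurable
    show "integrable lborel (\<lambda>x. LINT y|lborel. norm (case (x, y) of (x, s) \<Rightarrow> (a s * b (x - s)) *\<^sub>R g (t - x)))"
      using fin by (simp add: line_conv_def abs_mult)
    show "AE x in lborel. integrable lborel (\<lambda>y. case (x, y) of (x, s) \<Rightarrow> (a s * b (x - s)) *\<^sub>R g (t - x))"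
      using ab by eventually_elim simp
  qed
  have "line_conv a (line_conv b g) t = (LINT s|lborel. LINT x|lborel. (a s * b (x - s)) *\<^sub>R g (t - x))"
    unfolding line_conv_def
  proof (intro Bochner_Integration.integral_cong refl)
    fix s
    have "(LINT r|lborel. b r *\<^sub>R g (t - s - r)) = (LINT x|lborel. b (x - s) *\<^sub>R g (t - s - (x - s)))"
      using lborel_translate(2)[of "\<lambda>r. b r *\<^sub>R g (t - s - r)" s] by simp
    then show "a s *\<^sub>R (LINT r|lborel. b r *\<^sub>R g (t - s - r)) = (LINT x|lborel. (a s * b (x - s)) *\<^sub>R g (t - x))"
      by (simp flip: integral_scaleR_right scaleR_scaleR)
  qed
  also have "\<dots> = (LINT x|lborel. LINT s|lborel. (a s * b (x - s)) *\<^sub>R g (t - x))"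
    using lborel_pair.Fubini_integral[OF P] by simp
  also have "\<dots> = line_conv (line_conv a b) g t"
    unfolding line_conv_def
    by (intro integral_cong_AE) (use ab in \<open>auto elim!: eventually_mono\<close>)
  finally show ?thesis .
qed

lemma line_conv_assoc_AE:
  fixes g :: "real \<Rightarrow> 'a::{banach, second_countable_topology}"
  assumes a: "integrable lborel a" and b: "integrable lborel b" and g: "integrable lborel g"
  shows "AE t in lborel. line_conv a (line_conv b g) t = line_conv (line_conv a b) g t"
proof -
  have [measurable]: "g \<in> borel_measurable borel" using g by auto
  have "AE t in lborel. integrable lborel (\<lambda>x. line_conv (\<lambda>s. \<bar>a s\<bar>) (\<lambda>s. \<bar>b s\<bar>) x *\<^sub>R norm (g (t - x)))"
    by (rule line_conv_integrable(1)[OF integrable_abs_line_conv[OF a b] integrable_norm[OF g]])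
  then show ?thesis
    by eventually_elim (rule line_conv_assoc_at[OF a b], auto)
qed

lemma line_conv_assoc_bounded:
  fixes g :: "real \<Rightarrow> 'a::{banach, second_countable_topology}"
  assumes a: "integrable lborel a" and b: "integrable lborel b" and [measurable]: "g \<in> borel_measurable borel"
    and N: "\<And>t. norm (g t) \<le> N"
  shows "line_conv a (line_conv b g) t = line_conv (line_conv a b) g t"
proof (rule line_conv_assoc_at[OF a b])
  show "integrable lborel (\<lambda>x. line_conv (\<lambda>s. \<bar>a s\<bar>) (\<lambda>s. \<bar>b s\<bar>) x * norm (g (t - x)))"
  proof (rule Bochner_Integration.integrable_bound)
    show "integrable lborel (\<lambda>x. line_conv (\<lambda>s. \<bar>a s\<bar>) (\<lambda>s. \<bar>b s\<bar>) x * N)"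
      using integrable_abs_line_conv[OF a b] by simp
    show "AE x in lborel. norm (line_conv (\<lambda>s. \<bar>a s\<bar>) (\<lambda>s. \<bar>b s\<bar>) x * norm (g (t - x)))
        \<le> norm (line_conv (\<lambda>s. \<bar>a s\<bar>) (\<lambda>s. \<bar>b s\<bar>) x * N)"
      by (auto simp: abs_mult intro!: mult_left_mono order_trans[OF N])
  qed (use integrable_abs_line_conv[OF a b] in auto)
qed fact

lemma line_conv_bounded_linear:
  assumes "bounded_linear B" "integrable lborel (\<lambda>s. a s *\<^sub>R g (t - s))"
  shows "B (line_conv a g t) = line_conv a (\<lambda>t. B (g t)) t"
  unfolding line_conv_def using integral_bounded_linear[OF assms, symmetric]
  by (simp add: linear_cmul[OF bounded_linear.linear[OF assms(1)]])

lemma conv_eq_line_conv: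
  assumes "0 < t" "t \<le> T"
  shows "conv k g t = line_conv (\<lambda>s. indicator {0<..<T} s * k s) (\<lambda>s. indicator {0<..<T} s *\<^sub>R g s) t"
proof -
  have "conv k g t = (LINT s|lborel. indicator {0<..<t} (t - s) *\<^sub>R k (t - (t - s)) *\<^sub>R g (t - s))"
    unfolding conv_def set_lebesgue_integral_def
    using lborel_translate(4)[of "\<lambda>s. indicator {0<..<t} s *\<^sub>R k (t - s) *\<^sub>R g s" t] by simp
  also have "\<dots> = line_conv (\<lambda>s. indicator {0<..<T} s * k s) (\<lambda>s. indicator {0<..<T} s *\<^sub>R g s) t"
    unfolding line_conv_def using assms
    by (intro Bochner_Integration.integral_cong) (auto simp: indicator_def)
  finally show ?thesis .
qed

lemma conv_backward_eq:
  assumes "0 \<le> t" "t < T"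
  shows "conv_backward T l g t
    = (LINT s|lborel. (indicator {0<..<T} s * l s) *\<^sub>R (indicator {0<..<T} (t + s) *\<^sub>R g (t + s)))"
proof -
  have "conv_backward T l g t = (LINT s|lborel. indicator {t<..<T} (t + s) *\<^sub>R l (t + s - t) *\<^sub>R g (t + s))"
    unfolding conv_backward_def set_lebesgue_integral_def
    using lborel_translate(6)[of "\<lambda>s. indicator {t<..<T} s *\<^sub>R l (s - t) *\<^sub>R g s" t] by simp
  also have "\<dots> = (LINT s|lborel. (indicator {0<..<T} s * l s) *\<^sub>R (indicator {0<..<T} (t + s) *\<^sub>R g (t + s)))"
    using assms by (intro Bochner_Integration.integral_cong) (auto simp: indicator_def)
  finally show ?thesis .
qed

text \<open>Because of \<open>\<bar>p q\<bar> \<le> p\<^sup>2 + q\<^sup>2\<close> it is enough to convolve integrable functions.\<close>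
lemma integrable_square_imp_kernel_product:
  fixes p q a :: "real \<Rightarrow> real"
  assumes a: "integrable lborel a"
    and p: "p \<in> borel_measurable borel" "integrable lborel (\<lambda>t. (p t)\<^sup>2)"
    and q: "q \<in> borel_measurable borel" "integrable lborel (\<lambda>t. (q t)\<^sup>2)"
  shows "integrable (lborel \<Otimes>\<^sub>M lborel) (\<lambda>(t, s). a s * (p t * q (t - s)))"
proof (rule Bochner_Integration.integrable_bound)
  have [measurable]: "a \<in> borel_measurable borel" "p \<in> borel_measurable borel" "q \<in> borel_measurable borel" using a p q by auto
  have "integrable (lborel \<Otimes>\<^sub>M lborel) (\<lambda>(t, s). a s *\<^sub>R (p t)\<^sup>2)"
    by (rule integrable_lborel_pair_scaleR[OF a p(2)])
  moreover have "integrable (lborel \<Otimes>\<^sub>M lborel) (\<lambda>(t, s). a s *\<^sub>R (q (t - s))\<^sup>2)"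
    by (rule integrable_shear(1)[OF integrable_lborel_pair_scaleR[OF a q(2)]])
  ultimately show "integrable (lborel \<Otimes>\<^sub>M lborel) (\<lambda>x. (case x of (t, s) \<Rightarrow> a s *\<^sub>R (p t)\<^sup>2) + (case x of (t, s) \<Rightarrow> a s *\<^sub>R (q (t - s))\<^sup>2))"
    by (rule Bochner_Integration.integrable_add)
  show "(\<lambda>(t, s). a s * (p t * q (t - s))) \<in> borel_measurable (lborel \<Otimes>\<^sub>M lborel)" by measurable
  have "\<bar>p t * q r\<bar> \<le> (p t)\<^sup>2 + (q r)\<^sup>2" for t r
  proof -
    have "2 * (\<bar>p t\<bar> * \<bar>q r\<bar>) \<le> \<bar>p t\<bar>\<^sup>2 + \<bar>q r\<bar>\<^sup>2" using sum_squares_bound[of "\<bar>p t\<bar>" "\<bar>q r\<bar>"] by simp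
    moreover have "0 \<le> \<bar>p t\<bar> * \<bar>q r\<bar>" by simp
    ultimately show ?thesis unfolding abs_mult power2_abs by linarith
  qed
  then have "\<bar>a s\<bar> * \<bar>p t * q r\<bar> \<le> \<bar>a s\<bar> * ((p t)\<^sup>2 + (q r)\<^sup>2)" for s t r by (intro mult_left_mono) auto
  then have "\<bar>a s * (p t * q (t - s))\<bar> \<le> \<bar>a s * (p t)\<^sup>2 + a s * (q (t - s))\<^sup>2\<bar>" for s t
    by (simp add: abs_mult flip: distrib_left)
  then show "AE x in lborel \<Otimes>\<^sub>M lborel. norm (case x of (t, s) \<Rightarrow> a s * (p t * q (t - s)))
      \<le> norm ((case x of (t, s) \<Rightarrow> a s *\<^sub>R (p t)\<^sup>2) + (case x of (t, s) \<Rightarrow> a s *\<^sub>R (q (t - s))\<^sup>2))"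
    by (intro AE_I2) (simp add: case_prod_beta')
qed

text \<open>The forward and the backward convolution are adjoint to each other: the two double integrals
  differ by a shear.\<close>
lemma line_conv_inner_adjoint:
  fixes g :: "real \<Rightarrow> 'a::{real_inner, banach, second_countable_topology}"
  assumes a: "integrable lborel a" and [measurable]: "g \<in> borel_measurable borel"
    and g1: "integrable lborel g" and g2: "integrable lborel (\<lambda>t. (norm (g t))\<^sup>2)"
  shows "(LINT t|lborel. line_conv a g t \<bullet> g t) = (LINT t|lborel. (LINT s|lborel. a s *\<^sub>R g (t + s)) \<bullet> g t)"
proof -
  have [measurable]: "a \<in> borel_measurable borel" using a by auto
  have "integrable lborel (\<lambda>s. a (- s))" using lborel_translate(3)[of a 0] a by simp
  from integrable_reflect_snd[OF integrable_square_imp_kernel_product[OF this _ g2 _ g2]]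
  have "integrable (lborel \<Otimes>\<^sub>M lborel) (\<lambda>(t, s). a s * (norm (g t) * norm (g (t + s))))" by simp
  then have P: "integrable (lborel \<Otimes>\<^sub>M lborel) (\<lambda>(t, s). a s * (g t \<bullet> g (t + s)))"
  proof (rule Bochner_Integration.integrable_bound)
    show "(\<lambda>(t, s). a s * (g t \<bullet> g (t + s))) \<in> borel_measurable (lborel \<Otimes>\<^sub>M lborel)" by measurable
    show "AE x in lborel \<Otimes>\<^sub>M lborel. norm (case x of (t, s) \<Rightarrow> a s * (g t \<bullet> g (t + s)))
        \<le> norm (case x of (t, s) \<Rightarrow> a s * (norm (g t) * norm (g (t + s))))"
      by (intro AE_I2) (auto simp: abs_mult intro!: mult_left_mono Cauchy_Schwarz_ineq2)
  qed
  have fwd: "AE t in lborel. line_conv a g t \<bullet> g t = (LINT s|lborel. a s * (g (t - s) \<bullet> g (t - s + s)))"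
    using line_conv_integrable(1)[OF a g1]
  proof eventually_elim
    case (elim t)
    then show ?case unfolding line_conv_def by (subst integral_inner_left[symmetric]) auto
  qed
  have m: "integrable lborel (\<lambda>s. a (- s))" "integrable lborel (\<lambda>t. g (- t))"
    using lborel_translate(3)[of a 0] a lborel_translate(3)[of g 0] g1 by simp_all
  have "AE r in lborel. integrable lborel (\<lambda>s. a s *\<^sub>R g (- (r - s)))"
    by (rule line_conv_integrable(1)[OF a m(2)])
  from AE_lborel_affine[OF this, of "-1" 0]
  have "AE t in lborel. integrable lborel (\<lambda>s. a s *\<^sub>R g (t + s))" by (simp add: add.commute)
  then have bwd: "AE t in lborel. (LINT s|lborel. a s *\<^sub>R g (t + s)) \<bullet> g t = (LINT s|lborel. a s * (g t \<bullet> g (t + s)))"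
  proof eventually_elim
    case (elim t)
    then show ?case by (subst integral_inner_left[symmetric]) (auto simp: inner_commute)
  qed
  have "(LINT t|lborel. line_conv a g t \<bullet> g t) = (LINT t|lborel. LINT s|lborel. a s * (g (t - s) \<bullet> g (t - s + s)))"
    by (rule integral_cong_AE[OF _ _ fwd]) measurable
  also have "\<dots> = (LINT t|lborel. LINT s|lborel. a s * (g t \<bullet> g (t + s)))"
    by (rule integrable_shear(2)[OF P])
  also have "\<dots> = (LINT t|lborel. (LINT s|lborel. a s *\<^sub>R g (t + s)) \<bullet> g t)"
    by (rule integral_cong_AE[symmetric, OF _ _ bwd]) measurable
  finally show ?thesis .
qed

lemma integrable_bilinear_line_conv:
  fixes F :: "real \<Rightarrow> 'a::{banach, second_countable_topology}" and G :: "real \<Rightarrow> 'b::{banach, second_countable_topology}"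
    and pr :: "'a \<Rightarrow> 'b \<Rightarrow> real"
  assumes pr: "bounded_bilinear pr" and a: "integrable lborel a"
    and [measurable]: "F \<in> borel_measurable borel" "G \<in> borel_measurable borel"
    and F1: "integrable lborel F" and F2: "integrable lborel (\<lambda>t. (norm (F t))\<^sup>2)" and G2: "integrable lborel (\<lambda>t. (norm (G t))\<^sup>2)"
  shows "integrable lborel (\<lambda>t. pr (line_conv a F t) (G t))"
proof -
  have [measurable]: "a \<in> borel_measurable borel" using a by auto
  obtain K where K: "0 \<le> K" "\<And>x y. norm (pr x y) \<le> norm x * norm y * K"
    using bounded_bilinear.nonneg_bounded[OF pr] by blast
  have aa: "integrable lborel (\<lambda>s. \<bar>a s\<bar>)" using a by simp
  have dom: "integrable lborel (\<lambda>t. LINT s|lborel. \<bar>a s\<bar> * (norm (G t) * norm (F (t - s))))"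
    by (rule lborel_pair.integrable_fst[OF integrable_square_imp_kernel_product[OF aa _ G2 _ F2]]) measurable
  show ?thesis
  proof (rule norm_integral_le_AE(1)[OF integrable_mult_left[OF dom, of K]])
    have "continuous_on UNIV (\<lambda>x. pr (fst x) (snd x))"
      by (intro bounded_bilinear.continuous_on[OF pr] continuous_intros)
    then have "(\<lambda>x. pr (fst x) (snd x)) \<in> borel_measurable (borel :: ('a \<times> 'b) measure)" by (rule borel_measurable_continuous_onI)
    then have [measurable]: "(\<lambda>x. pr (fst x) (snd x)) \<in> borel_measurable (borel \<Otimes>\<^sub>M borel)" by (simp only: borel_prod)
    have "(\<lambda>t. (line_conv a F t, G t)) \<in> borel \<rightarrow>\<^sub>M borel \<Otimes>\<^sub>M borel" by measurable
    from measurable_compose[OF this \<open>(\<lambda>x. pr (fst x) (snd x)) \<in> borel_measurable (borel \<Otimes>\<^sub>M borel)\<close>]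
    show "(\<lambda>t. pr (line_conv a F t) (G t)) \<in> borel_measurable lborel" by simp
    show "AE t in lborel. norm (pr (line_conv a F t) (G t)) \<le> (LINT s|lborel. \<bar>a s\<bar> * (norm (G t) * norm (F (t - s)))) * K"
      using line_conv_integrable(1)[OF a F1]
    proof eventually_elim
      case (elim t)
      have "norm (line_conv a F t) \<le> (LINT s|lborel. norm (a s *\<^sub>R F (t - s)))"
        unfolding line_conv_def by (rule integral_norm_bound)
      then have "norm (line_conv a F t) * norm (G t) \<le> (LINT s|lborel. norm (a s *\<^sub>R F (t - s))) * norm (G t)"
        by (rule mult_right_mono) simp
      also have "\<dots> = (LINT s|lborel. \<bar>a s\<bar> * (norm (G t) * norm (F (t - s))))"
        by (subst integral_mult_left_zero[symmetric]) (simp only: norm_scaleR mult_ac)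
      finally have "norm (line_conv a F t) * norm (G t) * K \<le> (LINT s|lborel. \<bar>a s\<bar> * (norm (G t) * norm (F (t - s)))) * K"
        by (rule mult_right_mono) (rule K)
      then show ?case using K(2)[of "line_conv a F t" "G t"] by (rule order_trans[rotated])
    qed
  qed
qed

text \<open>A kernel that vanishes on the negative half-line only sees the past.\<close>
lemma line_conv_cong_AE:
  fixes X Y :: "real \<Rightarrow> 'a::{banach, second_countable_topology}"
  assumes [measurable]: "a \<in> borel_measurable borel" "X \<in> borel_measurable borel" "Y \<in> borel_measurable borel"
    and a: "\<And>s. s \<le> 0 \<Longrightarrow> a s = 0" and XY: "AE r in lborel. r < T \<longrightarrow> X r = Y r" and t: "t \<le> T"
  shows "line_conv a X t = line_conv a Y t"
  unfolding line_conv_def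
proof (rule integral_cong_AE)
  have "AE s in lborel. t + (-1) * s < T \<longrightarrow> X (t + (-1) * s) = Y (t + (-1) * s)"
    by (rule AE_lborel_affine[OF XY]) simp
  then show "AE s in lborel. a s *\<^sub>R X (t - s) = a s *\<^sub>R Y (t - s)"
  proof eventually_elim
    case (elim s)
    then show ?case using a[of s] t by (cases "s \<le> 0") auto
  qed
qed measurable

lemma line_conv_one:
  fixes q :: "real \<Rightarrow> real"
  assumes "\<And>r. r \<le> 0 \<Longrightarrow> q r = 0" "0 < t" "t \<le> T"
  shows "line_conv (indicator {0<..<T}) q t = (LINT s|lborel. indicator {0<..<t} s * q s)"
proof -
  have "(LINT s|lborel. indicator {0<..<t} s * q s) = (LINT s|lborel. indicator {0<..<t} (t - s) * q (t - s))"
    using lborel_translate(4)[of "\<lambda>s. indicator {0<..<t} s * q s" t] by simp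
  also have "\<dots> = line_conv (indicator {0<..<T}) q t"
    unfolding line_conv_def using assms
    by (intro Bochner_Integration.integral_cong refl) (auto simp: indicator_def)
  finally show ?thesis by simp
qed

lemma line_conv_causal:
  fixes g :: "real \<Rightarrow> 'a::{banach, second_countable_topology}"
  assumes "\<And>s. s \<le> 0 \<Longrightarrow> a s = 0" "\<And>r. r \<le> 0 \<Longrightarrow> g r = 0" "t \<le> 0"
  shows "line_conv a g t = 0"
proof -
  have "a s *\<^sub>R g (t - s) = 0" for s using assms(1)[of s] assms(2)[of "t - s"] assms(3) by (cases "s \<le> 0") auto
  then have "(\<lambda>s. a s *\<^sub>R g (t - s)) = (\<lambda>s. 0)" by (rule ext)
  then show ?thesis by (simp only: line_conv_def integral_zero)
qed

section \<open>The square root of a form operator\<close>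

text \<open>By the parallelogram law a minimizing sequence for the distance from \<open>v\<close> to \<open>S\<close> is a Cauchy
  sequence. Its limit \<open>r\<close> lies in the closure, and \<open>v - r\<close> is orthogonal to \<open>S\<close>.\<close>
lemma dense_if_trivial_orthogonal_complement:
  fixes S :: "'a::{real_inner, banach} set"
  assumes S: "subspace S" and triv: "\<And>v. (\<And>s. s \<in> S \<Longrightarrow> v \<bullet> s = 0) \<Longrightarrow> v = 0"
  shows "closure S = UNIV"
proof -
  have "v \<in> closure S" for v
  proof -
    define m where "m = Inf ((\<lambda>x. (norm (v - x))\<^sup>2) ` S)"
    have bdd: "bdd_below ((\<lambda>x. (norm (v - x))\<^sup>2) ` S)" by (rule bdd_belowI[of _ 0]) auto
    have ne: "(\<lambda>x. (norm (v - x))\<^sup>2) ` S \<noteq> {}" using subspace_0[OF S] by auto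
    have m_le: "m \<le> (norm (v - x))\<^sup>2" if "x \<in> S" for x
      unfolding m_def by (rule cInf_lower) (use bdd that in auto)
    have "\<exists>x\<in>S. (norm (v - x))\<^sup>2 < m + 1 / (real n + 1)" for n
    proof -
      have "Inf ((\<lambda>x. (norm (v - x))\<^sup>2) ` S) < m + 1 / (real n + 1)" unfolding m_def by simp
      from cInf_lessD[OF ne this] show ?thesis by auto
    qed
    then obtain X where XS: "\<And>n. X n \<in> S" and X: "\<And>n. (norm (v - X n))\<^sup>2 < m + 1 / (real n + 1)"
      by metis
    have para: "(norm (x - y))\<^sup>2 = 2 * (norm (v - x))\<^sup>2 + 2 * (norm (v - y))\<^sup>2
        - 4 * (norm (v - (1/2) *\<^sub>R (x + y)))\<^sup>2" for x y
      unfolding power2_norm_eq_inner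
      by (simp add: inner_add_left inner_add_right inner_diff_left inner_diff_right
          inner_commute field_simps)
    have dist2: "(norm (X n - X p))\<^sup>2 \<le> 2 / (real n + 1) + 2 / (real p + 1)" for n p
    proof -
      have "(1/2) *\<^sub>R (X n + X p) \<in> S" using XS S by (simp add: subspace_add subspace_mul)
      from para[of "X n" "X p"] m_le[OF this] X[of n] X[of p] show ?thesis by simp
    qed
    have "Cauchy X"
    proof (rule CauchyI)
      fix e :: real assume "0 < e"
      obtain N where N: "4 / e\<^sup>2 < real N" using reals_Archimedean2 by blast
      show "\<exists>M. \<forall>m\<ge>M. \<forall>n\<ge>M. norm (X m - X n) < e"
      proof (intro exI allI impI)
        fix p n assume pn: "N \<le> p" "N \<le> n"
        have "4 < e\<^sup>2 * (real N + 1)"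
          using N \<open>0 < e\<close> by (simp add: field_simps) (smt (verit) zero_less_power)
        then have small: "2 / (real N + 1) < e\<^sup>2 / 2" by (simp add: field_simps)
        have mono: "2 / (real q + 1) \<le> 2 / (real N + 1)" if "N \<le> q" for q
          using that by (intro divide_left_mono) auto
        have "(norm (X p - X n))\<^sup>2 < e\<^sup>2"
          using dist2[of p n] small mono[OF pn(1)] mono[OF pn(2)] by simp
        then show "norm (X p - X n) < e" using \<open>0 < e\<close> by (simp add: power_less_imp_less_base)
      qed
    qed
    then obtain r where r: "X \<longlonglongrightarrow> r" using Cauchy_convergent convergent_def by blast
    have rS: "r \<in> closure S" using r XS closure_sequential by blast
    have lim: "(\<lambda>n. (norm (v - X n))\<^sup>2) \<longlonglongrightarrow> (norm (v - r))\<^sup>2" by (intro tendsto_intros r)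
    have le: "(norm (v - r))\<^sup>2 \<le> m"
    proof (rule LIMSEQ_le[OF lim])
      show "(\<lambda>n. m + 1 / (real n + 1)) \<longlonglongrightarrow> m"
        using tendsto_add[OF tendsto_const LIMSEQ_inverse_real_of_nat, of m]
        by (simp add: inverse_eq_divide add.commute)
    qed (use X in \<open>auto intro: less_imp_le\<close>)
    have "(v - r) \<bullet> s = 0" if s: "s \<in> S" for s
    proof -
      define c where "c = (v - r) \<bullet> s"
      have ineq: "0 \<le> t\<^sup>2 * (norm s)\<^sup>2 - 2 * t * c" for t
      proof -
        have "(\<lambda>n. (norm (v - (X n + t *\<^sub>R s)))\<^sup>2) \<longlonglongrightarrow> (norm (v - (r + t *\<^sub>R s)))\<^sup>2"
          by (intro tendsto_intros r)
        then have "m \<le> (norm (v - (r + t *\<^sub>R s)))\<^sup>2"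
          by (rule LIMSEQ_le_const) (use XS s S in \<open>auto intro!: exI[of _ 0] m_le subspace_add subspace_mul\<close>)
        also have "\<dots> = (norm (v - r))\<^sup>2 + (t\<^sup>2 * (norm s)\<^sup>2 - 2 * t * c)"
          unfolding c_def power2_norm_eq_inner
          by (simp add: inner_add_left inner_add_right inner_diff_left inner_diff_right
            inner_commute power2_eq_square algebra_simps)
        finally show ?thesis using le by simp
      qed
      show ?thesis
      proof (cases "s = 0")
        case False
        then have "norm s > 0" by simp
        have "0 \<le> (c / (norm s)\<^sup>2)\<^sup>2 * (norm s)\<^sup>2 - 2 * (c / (norm s)\<^sup>2) * c" by (rule ineq)
        also have "\<dots> = - (c\<^sup>2 / (norm s)\<^sup>2)"
          using \<open>norm s > 0\<close> by (simp add: field_simps power2_eq_square)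
        finally have "c\<^sup>2 \<le> 0" using \<open>norm s > 0\<close> by (simp add: field_simps)
        then show ?thesis by (simp add: c_def)
      qed simp
    qed
    then have "v - r = 0" by (rule triv)
    with rS show ?thesis by simp
  qed
  then show ?thesis by blast
qed

text \<open>The operator that represents the form is bounded from below, so its range is closed. By coercivity
  only 0 is orthogonal to the range, so it is dense as well.\<close>
lemma lax_milgram_symmetric:
  fixes b :: "'v::{real_inner, banach} \<Rightarrow> 'v \<Rightarrow> real"
  assumes b: "bounded_bilinear b" and sym: "\<And>v v'. b v v' = b v' v"
    and c: "0 < c" "\<And>v. c * (norm v)\<^sup>2 \<le> b v v"
    and \<phi>: "bounded_linear \<phi>"
  shows "\<exists>w. \<forall>x. b w x = \<phi> x"
proof -
  interpret b: bounded_bilinear b by fact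
  have "\<exists>r. \<forall>x. b w x = r \<bullet> x" for w
    by (rule riesz_representation) (rule b.bounded_linear_right)
  then obtain A where A: "\<And>w x. b w x = A w \<bullet> x" by metis
  have ext: "x = y" if "\<And>z. x \<bullet> z = y \<bullet> z" for x y :: 'v
    using that[of "x - y"] by (metis inner_diff_left inner_eq_zero_iff right_minus_eq)
  obtain K where K: "0 \<le> K" "\<And>v w. norm (b v w) \<le> norm v * norm w * K"
    using b.nonneg_bounded by blast
  have A_lin: "bounded_linear A"
  proof (rule bounded_linear_intro[where K=K])
    show "A (x + y) = A x + A y" for x y
      by (rule ext) (simp add: A[symmetric] inner_add_left b.add_left)
    show "A (r *\<^sub>R x) = r *\<^sub>R A x" for r x
      by (rule ext) (simp add: A[symmetric] b.scaleR_left)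
    show "norm (A x) \<le> norm x * K" for x
    proof (cases "A x = 0")
      case False
      have "norm (A x) * norm (A x) = b x (A x)" by (simp add: A flip: power2_norm_eq_inner power2_eq_square)
      also have "\<dots> \<le> norm x * norm (A x) * K" using K(2)[of x "A x"] by simp
      finally show ?thesis using False by simp
    qed (simp add: K)
  qed
  have low: "c * norm x \<le> norm (A x)" for x
  proof (cases "x = 0")
    case False
    have "c * (norm x * norm x) \<le> A x \<bullet> x" using c(2)[of x] by (simp add: A power2_eq_square)
    also have "\<dots> \<le> norm (A x) * norm x" using Cauchy_Schwarz_ineq2[of "A x" x] by simp
    finally show ?thesis using False by simp
  qed (simp add: linear_0[OF bounded_linear.linear[OF A_lin]])
  have "complete (range A)"
    by (rule complete_isometric_image[OF c(1) subspace_UNIV A_lin]) (use low complete_UNIV in auto)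
  then have cl: "closed (range A)" by (simp add: complete_imp_closed)
  have "closure (range A) = UNIV"
  proof (rule dense_if_trivial_orthogonal_complement)
    show "subspace (range A)"
      using A_lin by (simp add: bounded_linear.linear linear_subspace_image)
    fix v assume v: "\<And>s. s \<in> range A \<Longrightarrow> v \<bullet> s = 0"
    have "b v v = 0" using v[of "A v"] by (simp add: A inner_commute)
    with c(2)[of v] c(1) show "v = 0" by (simp add: mult_le_0_iff)
  qed
  with cl have surj: "range A = UNIV" by simp
  obtain r where r: "\<And>x. \<phi> x = r \<bullet> x" using riesz_representation[OF \<phi>] by blast
  obtain w where "r = A w" using surj by blast
  with r A show ?thesis by auto
qed

text \<open>If \<open>v\<close> is orthogonal to the operator domain, represent \<open>(v, \<cdot>)\<close> as \<open>b v'\<close> and choose \<open>s\<close> in the domain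
  with \<open>b s = (\<iota> v', \<iota> \<cdot>)\<close>. Then \<open>\<bar>\<iota> v'\<bar>\<^sup>2 = b v' s = (v, s) = 0\<close>.\<close>
lemma form_operator_domain_dense:
  fixes b :: "'v::{real_inner, banach} \<Rightarrow> 'v \<Rightarrow> real" and \<iota> :: "'v \<Rightarrow> 'h::real_inner"
  assumes b: "bounded_bilinear b" and sym: "\<And>v v'. b v v' = b v' v"
    and c: "0 < c" "\<And>v. c * (norm v)\<^sup>2 \<le> b v v"
    and \<iota>: "bounded_linear \<iota>" "inj \<iota>"
  shows "closure {w. \<exists>h. \<forall>v. b w v = h \<bullet> \<iota> v} = UNIV"
proof (rule dense_if_trivial_orthogonal_complement)
  interpret b: bounded_bilinear b by fact
  interpret \<iota>: bounded_linear \<iota> by fact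
  show "subspace {w. \<exists>h. \<forall>v. b w v = h \<bullet> \<iota> v}"
  proof (rule subspaceI, goal_cases)
    case 1 then show ?case by (auto intro!: exI[of _ 0] simp: b.zero_left)
  next
    case (2 x y)
    then obtain g h where "\<forall>v. b x v = g \<bullet> \<iota> v" "\<forall>v. b y v = h \<bullet> \<iota> v" by auto
    then show ?case by (auto intro!: exI[of _ "g + h"] simp: b.add_left inner_add_left)
  next
    case (3 r x)
    then obtain g where "\<forall>v. b x v = g \<bullet> \<iota> v" by auto
    then show ?case by (auto intro!: exI[of _ "r *\<^sub>R g"] simp: b.scaleR_left)
  qed
  fix v assume v: "\<And>s. s \<in> {w. \<exists>h. \<forall>v. b w v = h \<bullet> \<iota> v} \<Longrightarrow> v \<bullet> s = 0"
  obtain v' where v': "\<And>x. b v' x = v \<bullet> x"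
    using lax_milgram_symmetric[OF b sym c bounded_linear_inner_right] by blast
  have "bounded_linear (\<lambda>x. \<iota> v' \<bullet> \<iota> x)"
    by (rule bounded_linear_compose[OF bounded_linear_inner_right \<iota>(1)])
  then obtain s where s: "\<And>x. b s x = \<iota> v' \<bullet> \<iota> x"
    using lax_milgram_symmetric[OF b sym c] by blast
  have "\<iota> v' \<bullet> \<iota> v' = b v' s" using s[of v'] sym by simp
  also have "\<dots> = v \<bullet> s" by (rule v')
  also have "\<dots> = 0" using s by (intro v) auto
  finally have "v' = 0" using \<iota>(2) \<iota>.zero by (metis injD inner_eq_zero_iff)
  then have "v \<bullet> v = 0" using v'[of v] by (simp add: b.zero_left)
  then show "v = 0" by simp
qed

text \<open>On the operator domain, symmetry of the root \<open>R\<close> gives \<open>(R w, R w') = (R R w, w') = b w w'\<close>. This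
  domain is dense in the form domain. Along a sequence in it that converges to \<open>v\<close>, the images under
  \<open>R\<close> are therefore a Cauchy sequence, and since \<open>R\<close> is closed, being its own adjoint, \<open>v\<close> belongs to
  the domain of \<open>R\<close> and the identity passes to the limit.\<close>
lemma second_representation_theorem:
  fixes b :: "'v::{real_inner, banach} \<Rightarrow> 'v \<Rightarrow> real" and \<iota> :: "'v \<Rightarrow> 'h::{real_inner, banach}"
  assumes b: "bounded_bilinear b" and sym: "\<And>v v'. b v v' = b v' v"
    and c: "0 < c" "\<And>v. c * (norm v)\<^sup>2 \<le> b v v"
    and \<iota>: "bounded_linear \<iota>" "inj \<iota>"
    and R: "is_operator_sqrt R (form_operator \<iota> b)"
  shows "bounded_linear (\<lambda>v. op_apply R (\<iota> v))"
    and "op_apply R (\<iota> v) \<bullet> op_apply R (\<iota> v') = b v v'"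
proof -
  interpret b: bounded_bilinear b by fact
  interpret \<iota>: bounded_linear \<iota> by fact
  define D where "D = {w. \<exists>h. \<forall>v. b w v = h \<bullet> \<iota> v}"
  have sub: "subspace R" and sv: "single_valued R" and adj: "adjoint_graph R = R"
    and RR: "R O R = form_operator \<iota> b"
    using R unfolding is_operator_sqrt_def nonneg_self_adjoint_def by auto
  have symR: "y \<bullet> x' = x \<bullet> y'" if "(x, y) \<in> R" "(x', y') \<in> R" for x y x' y'
    using that adj unfolding adjoint_graph_def by blast
  have DR: "\<exists>y h. (\<iota> w, y) \<in> R \<and> (y, h) \<in> R \<and> (\<forall>v. b w v = h \<bullet> \<iota> v)" if w: "w \<in> D" for w
  proof -
    obtain h where h: "\<forall>v. b w v = h \<bullet> \<iota> v" using w unfolding D_def by auto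
    then have "(\<iota> w, h) \<in> form_operator \<iota> b" unfolding form_operator_def by auto
    then have "(\<iota> w, h) \<in> R O R" using RR by simp
    with h show ?thesis by auto
  qed
  then obtain y where y: "\<And>w. w \<in> D \<Longrightarrow> (\<iota> w, y w) \<in> R"
    and yh: "\<And>w. w \<in> D \<Longrightarrow> \<exists>h. (y w, h) \<in> R \<and> (\<forall>v. b w v = h \<bullet> \<iota> v)" by metis
  have yy: "y w \<bullet> y w' = b w w'" if w: "w \<in> D" "w' \<in> D" for w w'
  proof -
    obtain h where h: "(y w, h) \<in> R" "\<forall>v. b w v = h \<bullet> \<iota> v" using yh[OF w(1)] by blast
    show ?thesis using symR[OF h(1) y[OF w(2)]] h(2) by simp
  qed
  obtain K where K: "0 \<le> K" "\<And>v w. norm (b v w) \<le> norm v * norm w * K"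
    using b.nonneg_bounded by blast
  have yn: "(norm (y w - y w'))\<^sup>2 \<le> K * (norm (w - w'))\<^sup>2" if "w \<in> D" "w' \<in> D" for w w'
  proof -
    have "(norm (y w - y w'))\<^sup>2 = b (w - w') (w - w')"
      unfolding power2_norm_eq_inner using that
      by (simp add: inner_diff_left inner_diff_right yy b.diff_left b.diff_right)
    also have "\<dots> \<le> K * (norm (w - w'))\<^sup>2"
      using K(2)[of "w - w'" "w - w'"] by (simp add: power2_eq_square mult.commute)
    finally show ?thesis .
  qed
  have key: "\<exists>W z. (\<forall>n. W n \<in> D) \<and> W \<longlonglongrightarrow> v \<and> (\<lambda>n. y (W n)) \<longlonglongrightarrow> z \<and> (\<iota> v, z) \<in> R" for v
  proof -
    have "v \<in> closure D" using form_operator_domain_dense[OF b sym c \<iota>] by (simp add: D_def)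
    then obtain W where W: "\<forall>n. W n \<in> D" "W \<longlonglongrightarrow> v" unfolding closure_sequential by blast
    have "Cauchy (\<lambda>n. y (W n))"
    proof (rule CauchyI)
      fix e :: real assume "0 < e"
      have "Cauchy W" using W(2) LIMSEQ_imp_Cauchy by blast
      moreover have "0 < e / (K + 1)" using \<open>0 < e\<close> K by simp
      ultimately obtain N where N: "\<And>m n. m \<ge> N \<Longrightarrow> n \<ge> N \<Longrightarrow> norm (W m - W n) < e / (K + 1)"
        using CauchyD by blast
      show "\<exists>N. \<forall>m\<ge>N. \<forall>n\<ge>N. norm (y (W m) - y (W n)) < e"
      proof (intro exI allI impI)
        fix m n assume "N \<le> m" "N \<le> n"
        then have lt: "norm (W m - W n) < e / (K + 1)" by (rule N)
        have "(norm (y (W m) - y (W n)))\<^sup>2 \<le> K * (norm (W m - W n))\<^sup>2" using yn W(1) by blast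
        also have "\<dots> \<le> (K + 1)\<^sup>2 * (norm (W m - W n))\<^sup>2"
          using K(1) by (intro mult_right_mono) (auto simp: power2_eq_square algebra_simps)
        also have "\<dots> = ((K + 1) * norm (W m - W n))\<^sup>2" by (simp add: power_mult_distrib)
        finally have "norm (y (W m) - y (W n)) \<le> (K + 1) * norm (W m - W n)"
          by (rule power2_le_imp_le) (use K(1) in simp)
        also have "\<dots> < e" using lt K(1) by (simp add: field_simps)
        finally show "norm (y (W m) - y (W n)) < e" .
      qed
    qed
    then obtain z where z: "(\<lambda>n. y (W n)) \<longlonglongrightarrow> z" using Cauchy_convergent convergent_def by blast
    have "(\<iota> v, z) \<in> adjoint_graph R" unfolding adjoint_graph_def
    proof (clarify)
      fix x Rx assume xR: "(x, Rx) \<in> R"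
      have 1: "(\<lambda>n. Rx \<bullet> \<iota> (W n)) \<longlonglongrightarrow> Rx \<bullet> \<iota> v" by (intro tendsto_intros \<iota>.tendsto W(2))
      have 2: "(\<lambda>n. Rx \<bullet> \<iota> (W n)) \<longlonglongrightarrow> x \<bullet> z"
        using tendsto_inner[OF tendsto_const z, of x] symR[OF xR y] W(1) by simp
      from LIMSEQ_unique[OF 1 2] show "Rx \<bullet> \<iota> v = x \<bullet> z" .
    qed
    with W z adj show ?thesis by auto
  qed
  have op: "op_apply R x = z" if "(x, z) \<in> R" for x z
    unfolding op_apply_def using that sv by (auto simp: single_valued_def)
  have opR: "(\<iota> v, op_apply R (\<iota> v)) \<in> R" for v using key[of v] op by auto
  show ip: "op_apply R (\<iota> v) \<bullet> op_apply R (\<iota> v') = b v v'" for v v'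
  proof -
    obtain W z where W: "\<forall>n. W n \<in> D" "W \<longlonglongrightarrow> v" "(\<lambda>n. y (W n)) \<longlonglongrightarrow> z" "(\<iota> v, z) \<in> R" using key by blast
    obtain W' z' where W': "\<forall>n. W' n \<in> D" "W' \<longlonglongrightarrow> v'" "(\<lambda>n. y (W' n)) \<longlonglongrightarrow> z'" "(\<iota> v', z') \<in> R" using key by blast
    have "(\<lambda>n. y (W n) \<bullet> y (W' n)) \<longlonglongrightarrow> z \<bullet> z'" by (intro tendsto_intros W W')
    moreover have "(\<lambda>n. y (W n) \<bullet> y (W' n)) \<longlonglongrightarrow> b v v'"
      using b.tendsto[OF W(2) W'(2)] W(1) W'(1) by (simp add: yy)
    ultimately have "z \<bullet> z' = b v v'" by (rule LIMSEQ_unique)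
    with op W(4) W'(4) show ?thesis by simp
  qed
  show "bounded_linear (\<lambda>v. op_apply R (\<iota> v))"
  proof (rule bounded_linear_intro[where K="sqrt K"])
    fix x x' :: 'v and r :: real
    show "op_apply R (\<iota> (x + x')) = op_apply R (\<iota> x) + op_apply R (\<iota> x')"
      using subspace_add[OF sub opR[of x] opR[of x']] by (intro op) (simp add: \<iota>.add)
    show "op_apply R (\<iota> (r *\<^sub>R x)) = r *\<^sub>R op_apply R (\<iota> x)"
      using subspace_mul[OF sub opR[of x], of r] by (intro op) (simp add: \<iota>.scaleR)
    have "(norm (op_apply R (\<iota> x)))\<^sup>2 = b x x" unfolding power2_norm_eq_inner by (rule ip)
    also have "\<dots> \<le> norm x * norm x * K" using K(2)[of x x] by simp
    also have "\<dots> = (norm x * sqrt K)\<^sup>2" unfolding power_mult_distrib real_sqrt_pow2[OF K(1)] by (simp add: power2_eq_square)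
    finally have "(norm (op_apply R (\<iota> x)))\<^sup>2 \<le> (norm x * sqrt K)\<^sup>2" .
    then show "norm (op_apply R (\<iota> x)) \<le> norm x * sqrt K"
      by (rule power2_le_imp_le) (use K in simp)
  qed
qed

section \<open>Approximation by Lipschitz functions\<close>

definition radial_truncation :: "real \<Rightarrow> 'a::real_normed_vector \<Rightarrow> 'a"
  where "radial_truncation N x = (if norm x \<le> N then x else (N / norm x) *\<^sub>R x)"

lemma norm_radial_truncation:
  assumes "0 \<le> N"
  shows "norm (radial_truncation N x) \<le> N" "norm (radial_truncation N x) \<le> norm x"
  using assms by (auto simp: radial_truncation_def)

lemma radial_truncation_Lipschitz:
  assumes N: "0 \<le> N"
  shows "norm (radial_truncation N x - radial_truncation N y) \<le> 2 * norm (x - y)"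
proof -
  have mixed: "norm (x - (N / norm y) *\<^sub>R y) \<le> 2 * norm (x - y)" if "norm x \<le> N" "N < norm y" for x y :: 'a
  proof -
    have "x - (N / norm y) *\<^sub>R y = (x - y) + (1 - N / norm y) *\<^sub>R y" by (simp add: algebra_simps)
    also have "norm \<dots> \<le> norm (x - y) + norm ((1 - N / norm y) *\<^sub>R y)" by (rule norm_triangle_ineq)
    also have "norm ((1 - N / norm y) *\<^sub>R y) = norm y - N"
    proof -
      have "0 < norm y" "0 \<le> 1 - N / norm y" using that N by (auto simp: divide_simps)
      then show ?thesis unfolding norm_scaleR by (simp add: field_simps)
    qed
    also have "norm y - N \<le> norm (x - y)" using that norm_triangle_ineq3[of y x] by (simp add: norm_minus_commute)
    finally show ?thesis by simp
  qed
  consider "norm x \<le> N" "norm y \<le> N" | "norm x \<le> N" "N < norm y" | "N < norm x" "norm y \<le> N" | "N < norm x" "N < norm y" by linarith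
  then show ?thesis
  proof cases
    case 1 then show ?thesis by (simp add: radial_truncation_def)
  next
    case 2 then show ?thesis using mixed[OF 2] by (simp add: radial_truncation_def)
  next
    case 3 then show ?thesis using mixed[OF 3(2,1)] by (simp add: radial_truncation_def norm_minus_commute)
  next
    case 4
    have x: "0 < norm x" and y: "0 < norm y" using 4 N by linarith+
    have "(N / norm x) *\<^sub>R x - (N / norm y) *\<^sub>R y = (N / norm x) *\<^sub>R (x - y) + (N / norm x - N / norm y) *\<^sub>R y"
      by (simp add: algebra_simps)
    also have "norm \<dots> \<le> norm ((N / norm x) *\<^sub>R (x - y)) + norm ((N / norm x - N / norm y) *\<^sub>R y)" by (rule norm_triangle_ineq)
    also have "norm ((N / norm x) *\<^sub>R (x - y)) = (N / norm x) * norm (x - y)" using N by simp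
    also have "norm ((N / norm x - N / norm y) *\<^sub>R y) = (N / norm x) * \<bar>norm y - norm x\<bar>"
    proof -
      have "(N / norm x - N / norm y) * norm y = (N / norm x) * (norm y - norm x)" using x y by (simp add: field_simps)
      then have "\<bar>N / norm x - N / norm y\<bar> * norm y = \<bar>(N / norm x) * (norm y - norm x)\<bar>" by (metis abs_mult abs_norm_cancel)
      also have "\<dots> = (N / norm x) * \<bar>norm y - norm x\<bar>" using x N by (simp add: abs_mult)
      finally show ?thesis by simp
    qed
    also have "(N / norm x) * norm (x - y) + (N / norm x) * \<bar>norm y - norm x\<bar> \<le> 1 * norm (x - y) + 1 * norm (x - y)"
      using 4 x N norm_triangle_ineq3[of x y]
      by (intro add_mono mult_mono) (auto simp: abs_minus_commute)
    finally show ?thesis using 4 by (simp add: radial_truncation_def)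
  qed
qed

lemma radial_truncation_continuous: "0 \<le> N \<Longrightarrow> continuous_on UNIV (radial_truncation N)"
  by (rule lipschitz_on_continuous_on[of 2])
    (auto intro!: lipschitz_onI radial_truncation_Lipschitz simp: dist_norm)

lemma radial_truncation_eventually:
  "\<forall>\<^sub>F n in sequentially. radial_truncation (real n) x = x"
  using eventually_ge_at_top[of "nat \<lceil>norm x\<rceil>"]
  by eventually_elim (auto simp: radial_truncation_def nat_ceiling_le_eq)

lemma continuous_on_if_Lipschitz_bound:
  fixes g :: "real \<Rightarrow> 'a::real_normed_vector"
  assumes "\<And>s t. norm (g s - g t) \<le> \<Lambda> * \<bar>s - t\<bar>"
  shows "continuous_on UNIV g"
proof (rule lipschitz_on_continuous_on)
  show "(max 0 \<Lambda>)-lipschitz_on UNIV g"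
  proof (rule lipschitz_onI)
    fix s t
    show "dist (g s) (g t) \<le> max 0 \<Lambda> * dist s t"
      using order_trans[OF assms[of s t] mult_right_mono[of \<Lambda> "max 0 \<Lambda>" "\<bar>s - t\<bar>"]]
      by (simp add: dist_norm)
  qed simp
qed

text \<open>Only the indicator of a set of finite measure needs an idea: shrink the set to a closed set \<open>K\<close>, and
  approximate the indicator of \<open>K\<close> from above by \<open>max 0 (1 - n dist(\<cdot>, K))\<close>, which is Lipschitz with
  constant \<open>n\<close>.\<close>
lemma Lipschitz_dense_in_L1:
  fixes g :: "real \<Rightarrow> 'a::{banach, second_countable_topology}"
  assumes "integrable lborel g" "0 < e"
  shows "\<exists>\<phi> \<Lambda>. (\<forall>s t. norm (\<phi> s - \<phi> t) \<le> \<Lambda> * \<bar>s - t\<bar>) \<and>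
    integrable lborel (\<lambda>t. indicator {0<..<T} t *\<^sub>R (g t - \<phi> t)) \<and>
    (LINT t|lborel. norm (indicator {0<..<T} t *\<^sub>R (g t - \<phi> t))) < e"
  using assms
proof (induction g arbitrary: e rule: integrable_induct)
  case (base A c)
  have [measurable]: "A \<in> sets borel" using base by simp
  define e' where "e' = e / (2 * (norm c + 1))"
  have e': "0 < e'" "e' * norm c < e / 2"
    using base by (auto simp: e'_def field_simps add_pos_nonneg)
  obtain K where K: "closed K" "K \<subseteq> A" "emeasure lebesgue (A - K) < ennreal e'"
    using sets_lebesgue_inner_closed[of A e'] e' by (metis \<open>A \<in> sets borel\<close> sets_completionI_sets sets_lborel)
  have [measurable]: "K \<in> sets borel" using K by (simp add: borel_closed)
  have AK: "emeasure lborel (A - K) < ennreal e'" using K(3) by (simp add: emeasure_completion)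
  (* The empty set is treated apart because the distance to it is 0 by convention. *)
  define \<phi>0 where "\<phi>0 n t = (if K = {} then 0 else max 0 (1 - real n * infdist t K))" for n t
  have \<phi>0_Lip: "\<bar>\<phi>0 n s - \<phi>0 n t\<bar> \<le> real n * \<bar>s - t\<bar>" for n s t
  proof -
    have "\<bar>infdist s K - infdist t K\<bar> \<le> \<bar>s - t\<bar>"
      using infdist_triangle_abs[of s K t] by (simp add: dist_real_def)
    then have "\<bar>real n * infdist s K - real n * infdist t K\<bar> \<le> real n * \<bar>s - t\<bar>"
      by (simp add: abs_mult mult_left_mono flip: right_diff_distrib)
    then show ?thesis by (auto simp: \<phi>0_def)
  qed
  have \<phi>0_01: "0 \<le> \<phi>0 n t" "\<phi>0 n t \<le> 1" for n t by (auto simp: \<phi>0_def infdist_nonneg)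
  have [measurable]: "\<phi>0 n \<in> borel_measurable borel" for n
    by (rule borel_measurable_continuous_onI, rule continuous_on_if_Lipschitz_bound[of _ "real n"]) (use \<phi>0_Lip in simp)
  have \<phi>0_lim: "(\<lambda>n. \<phi>0 n t) \<longlonglongrightarrow> indicator K t" for t
  proof (cases "K = {} \<or> t \<in> K")
    case True
    then show ?thesis
    proof (cases "K = {}")
      case ne: False
      then have "infdist t K = 0" using True by (simp add: infdist_zero)
      with ne True show ?thesis by (simp add: \<phi>0_def)
    qed (simp add: \<phi>0_def)
  next
    case False
    then have "0 < infdist t K" using K(1) in_closed_iff_infdist_zero[of K t] infdist_nonneg[of t K] by fastforce
    then obtain m where m: "1 < real m * infdist t K" using ex_less_of_nat_mult by blast
    have "\<forall>\<^sub>F n in sequentially. \<phi>0 n t = indicator K t"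
      using eventually_ge_at_top[of m]
    proof eventually_elim
      case (elim n)
      then have "real m * infdist t K \<le> real n * infdist t K" by (intro mult_right_mono) (auto simp: infdist_nonneg)
      with m False show ?case by (simp add: \<phi>0_def)
    qed
    then show ?thesis by (rule tendsto_eventually)
  qed
  have iT: "integrable lborel (\<lambda>t. indicator {0<..<T} t * (c::real))" for c
    by (intro integrable_mult_left) (cases "0 \<le> T"; auto intro!: integrable_real_indicator)
  have "(\<lambda>n. LINT t|lborel. indicator {0<..<T} t * (\<bar>indicator A t - \<phi>0 n t\<bar> * norm c)) \<longlonglongrightarrow> (LINT t|lborel. indicator {0<..<T} t * (\<bar>indicator A t - indicator K t\<bar> * norm c))"
  proof (rule integral_dominated_convergence[OF _ _ iT[of "norm c"]])
    show "AE t in lborel. (\<lambda>n. indicator {0<..<T} t * (\<bar>indicator A t - \<phi>0 n t\<bar> * norm c)) \<longlonglongrightarrow> indicator {0<..<T} t * (\<bar>indicator A t - indicator K t\<bar> * norm c)"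
      by (intro AE_I2 tendsto_intros \<phi>0_lim)
    have "\<bar>indicator A t - \<phi>0 n t\<bar> \<le> 1" for n t using \<phi>0_01[of n t] by (auto simp: indicator_def)
    then have "\<bar>indicator A t - \<phi>0 n t\<bar> * norm c \<le> norm c" for n t by (intro mult_left_le_one_le) auto
    then show "AE t in lborel. norm (indicator {0<..<T} t * (\<bar>indicator A t - \<phi>0 n t\<bar> * norm c)) \<le> indicator {0<..<T} t * norm c" for n
      by (auto simp: indicator_def)
  qed measurable
  moreover have "(LINT t|lborel. indicator {0<..<T} t * (\<bar>indicator A t - indicator K t\<bar> * norm c)) < e"
  proof -
    have fin: "emeasure lborel (A - K) < \<infinity>" using AK by (metis ennreal_less_top less_trans infinity_ennreal_def)
    have "(LINT t|lborel. indicator {0<..<T} t * (\<bar>indicator A t - indicator K t\<bar> * norm c)) \<le> (LINT t|lborel. indicator (A - K) t * norm c)"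
    proof (rule integral_mono')
      show "integrable lborel (\<lambda>t. indicator (A - K) t * norm c)" using fin by (intro integrable_mult_left integrable_real_indicator) auto
    qed (use K(2) in \<open>auto simp: indicator_def\<close>)
    also have "\<dots> = measure lborel (A - K) * norm c" by simp
    also have "\<dots> \<le> e' * norm c"
    proof (rule mult_right_mono)
      show "measure lborel (A - K) \<le> e'" using AK e' by (simp add: measure_def enn2real_leI less_imp_le)
    qed simp
    also have "\<dots> < e" using e' base by simp
    finally show ?thesis .
  qed
  ultimately have "\<forall>\<^sub>F n in sequentially. (LINT t|lborel. indicator {0<..<T} t * (\<bar>indicator A t - \<phi>0 n t\<bar> * norm c)) < e"
    by (rule order_tendstoD)
  then obtain n where n: "(LINT t|lborel. indicator {0<..<T} t * (\<bar>indicator A t - \<phi>0 n t\<bar> * norm c)) < e"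
    by (auto simp: eventually_sequentially)
  show ?case
  proof (intro exI conjI allI)
    show "norm (\<phi>0 n s *\<^sub>R c - \<phi>0 n t *\<^sub>R c) \<le> (real n * norm c) * \<bar>s - t\<bar>" for s t
      using mult_right_mono[OF \<phi>0_Lip[of n s t] norm_ge_zero[of c]] by (simp add: mult_ac flip: scaleR_diff_left)
    show "integrable lborel (\<lambda>t. indicator {0<..<T} t *\<^sub>R (indicator A t *\<^sub>R c - \<phi>0 n t *\<^sub>R c))"
    proof (rule norm_integral_le_AE(1)[OF iT[of "norm c"]])
      have "\<bar>indicator A t - \<phi>0 n t\<bar> \<le> 1" for n t using \<phi>0_01[of n t] by (auto simp: indicator_def)
      then have "\<bar>indicator A t - \<phi>0 n t\<bar> * norm c \<le> norm c" for n t by (intro mult_left_le_one_le) auto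
      then show "AE t in lborel. norm (indicator {0<..<T} t *\<^sub>R (indicator A t *\<^sub>R c - \<phi>0 n t *\<^sub>R c)) \<le> indicator {0<..<T} t * norm c"
        by (simp add: indicator_def[of "{0<..<T}"] flip: scaleR_diff_left)
    qed measurable
    show "(LINT t|lborel. norm (indicator {0<..<T} t *\<^sub>R (indicator A t *\<^sub>R c - \<phi>0 n t *\<^sub>R c))) < e"
    proof -
      have "norm (indicator {0<..<T} t *\<^sub>R (indicator A t *\<^sub>R c - \<phi>0 n t *\<^sub>R c)) = indicator {0<..<T} t * (\<bar>indicator A t - \<phi>0 n t\<bar> * norm c)" for t
        unfolding scaleR_diff_left[symmetric] norm_scaleR by simp
      then show ?thesis using n by (simp only:)
    qed
  qed
next
  case (add f g)
  have e2: "0 < e / 2" using add by simp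
  obtain \<phi> \<Lambda> where \<phi>: "\<And>s t. norm (\<phi> s - \<phi> t) \<le> \<Lambda> * \<bar>s - t\<bar>"
    "integrable lborel (\<lambda>t. indicator {0<..<T} t *\<^sub>R (f t - \<phi> t))"
    "(LINT t|lborel. norm (indicator {0<..<T} t *\<^sub>R (f t - \<phi> t))) < e / 2" using add(3)[OF e2] by blast
  obtain \<psi> M where \<psi>: "\<And>s t. norm (\<psi> s - \<psi> t) \<le> M * \<bar>s - t\<bar>"
    "integrable lborel (\<lambda>t. indicator {0<..<T} t *\<^sub>R (g t - \<psi> t))"
    "(LINT t|lborel. norm (indicator {0<..<T} t *\<^sub>R (g t - \<psi> t))) < e / 2" using add(4)[OF e2] by blast
  have eq: "indicator {0<..<T} t *\<^sub>R (f t + g t - (\<phi> t + \<psi> t)) = indicator {0<..<T} t *\<^sub>R (f t - \<phi> t) + indicator {0<..<T} t *\<^sub>R (g t - \<psi> t)" for t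
    by (simp add: algebra_simps)
  show ?case
  proof (intro exI conjI allI)
    show "norm (\<phi> s + \<psi> s - (\<phi> t + \<psi> t)) \<le> (\<Lambda> + M) * \<bar>s - t\<bar>" for s t
      using norm_triangle_mono[OF \<phi>(1)[of s t] \<psi>(1)[of s t]] by (simp add: algebra_simps)
    show "integrable lborel (\<lambda>t. indicator {0<..<T} t *\<^sub>R (f t + g t - (\<phi> t + \<psi> t)))"
      unfolding eq using \<phi>(2) \<psi>(2) by (rule Bochner_Integration.integrable_add)
    have "(LINT t|lborel. norm (indicator {0<..<T} t *\<^sub>R (f t + g t - (\<phi> t + \<psi> t))))
      \<le> (LINT t|lborel. norm (indicator {0<..<T} t *\<^sub>R (f t - \<phi> t)) + norm (indicator {0<..<T} t *\<^sub>R (g t - \<psi> t)))"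
      unfolding eq using \<phi>(2) \<psi>(2)
      by (intro integral_mono integrable_norm Bochner_Integration.integrable_add norm_triangle_ineq)
    also have "\<dots> < e" using \<phi>(3) \<psi>(3) integrable_norm[OF \<phi>(2)] integrable_norm[OF \<psi>(2)]
      by (simp only: Bochner_Integration.integral_add)
    finally show "(LINT t|lborel. norm (indicator {0<..<T} t *\<^sub>R (f t + g t - (\<phi> t + \<psi> t)))) < e" .
  qed
next
  case (lim f s)
  have e2: "0 < e / 2" using lim by simp
  have "(\<lambda>n. LINT t|lborel. norm (s n t - f t)) \<longlonglongrightarrow> integral\<^sup>L lborel (\<lambda>t::real. 0::real)"
  proof (rule integral_dominated_convergence[where w="\<lambda>t. 3 * norm (f t)"])
    show "AE t in lborel. (\<lambda>n. norm (s n t - f t)) \<longlonglongrightarrow> 0"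
      using lim.hyps(2) by (auto intro!: tendsto_norm_zero LIM_zero)
    show "AE t in lborel. norm (norm (s n t - f t)) \<le> 3 * norm (f t)" for n
    proof (rule AE_I2)
      fix t
      show "norm (norm (s n t - f t)) \<le> 3 * norm (f t)"
        using lim.hyps(3)[of t n] norm_triangle_ineq4[of "s n t" "f t"] by simp
    qed
  qed (use lim.hyps in auto)
  then have "\<forall>\<^sub>F n in sequentially. (LINT t|lborel. norm (s n t - f t)) < e / 2"
    using e2 order_tendstoD(2) by fastforce
  then obtain n where n: "(LINT t|lborel. norm (s n t - f t)) < e / 2" by (auto simp: eventually_sequentially)
  obtain \<phi> \<Lambda> where \<phi>: "\<And>s t. norm (\<phi> s - \<phi> t) \<le> \<Lambda> * \<bar>s - t\<bar>"
    "integrable lborel (\<lambda>t. indicator {0<..<T} t *\<^sub>R (s n t - \<phi> t))"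
    "(LINT t|lborel. norm (indicator {0<..<T} t *\<^sub>R (s n t - \<phi> t))) < e / 2" using lim.IH[OF e2] by blast
  have i: "integrable lborel (\<lambda>t. indicator {0<..<T} t *\<^sub>R (f t - s n t))"
    by (rule Bochner_Integration.integrable_bound[OF Bochner_Integration.integrable_diff[OF lim.hyps(4) lim.hyps(1)[of n]]])
      (use lim.hyps(4) lim.hyps(1)[of n] in \<open>auto simp: indicator_def\<close>)
  have eq: "indicator {0<..<T} t *\<^sub>R (f t - \<phi> t) = indicator {0<..<T} t *\<^sub>R (s n t - \<phi> t) + indicator {0<..<T} t *\<^sub>R (f t - s n t)" for t
    by (simp add: algebra_simps)
  show ?case
  proof (intro exI conjI allI)
    show "norm (\<phi> s - \<phi> t) \<le> \<Lambda> * \<bar>s - t\<bar>" for s t by (rule \<phi>(1))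
    show "integrable lborel (\<lambda>t. indicator {0<..<T} t *\<^sub>R (f t - \<phi> t))"
      unfolding eq using \<phi>(2) i by (rule Bochner_Integration.integrable_add)
    have "(LINT t|lborel. norm (indicator {0<..<T} t *\<^sub>R (f t - \<phi> t)))
      \<le> (LINT t|lborel. norm (indicator {0<..<T} t *\<^sub>R (s n t - \<phi> t)) + norm (s n t - f t))"
    proof (rule integral_mono)
      show "norm (indicator {0<..<T} t *\<^sub>R (f t - \<phi> t)) \<le> norm (indicator {0<..<T} t *\<^sub>R (s n t - \<phi> t)) + norm (s n t - f t)" for t
        unfolding eq by (rule norm_triangle_le) (simp add: indicator_def norm_minus_commute)
      show "integrable lborel (\<lambda>t. norm (indicator {0<..<T} t *\<^sub>R (f t - \<phi> t)))"
        unfolding eq by (intro integrable_norm Bochner_Integration.integrable_add \<phi>(2) i)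
      show "integrable lborel (\<lambda>t. norm (indicator {0<..<T} t *\<^sub>R (s n t - \<phi> t)) + norm (s n t - f t))"
        by (intro integrable_norm Bochner_Integration.integrable_add Bochner_Integration.integrable_diff \<phi>(2) lim.hyps(4) lim.hyps(1))
    qed
    also have "\<dots> < e" using \<phi>(3) n integrable_norm[OF \<phi>(2)] integrable_norm[OF Bochner_Integration.integrable_diff[OF lim.hyps(1)[of n] lim.hyps(4)]]
      by (simp only: Bochner_Integration.integral_add)
    finally show "(LINT t|lborel. norm (indicator {0<..<T} t *\<^sub>R (f t - \<phi> t))) < e" .
  qed
qed

section \<open>The energy inequality for convex kernels\<close>

text \<open>The kernels of the energy inequality. Convolutions use the truncation \<open>kT\<close>, which is integrable on
  the line. The energy also evaluates \<open>k\<close> itself, at lags \<open>2 s\<close> that may exceed \<open>T\<close>.\<close>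
locale convex_kernel_pair =
  fixes T :: real and k l :: "real \<Rightarrow> real"
  assumes T_pos: "0 < T"
    and k_meas [measurable]: "k \<in> borel_measurable borel"
    and k_nonneg: "\<And>t. 0 \<le> k t"
    and k_antimono: "\<And>s t. 0 < s \<Longrightarrow> s \<le> t \<Longrightarrow> k t \<le> k s"
    and k_convex: "convex_on {0<..} k"
    and k_int: "integrable lborel (\<lambda>s. indicator {0<..<T} s * k s)"
    and l_int: "integrable lborel l"
    and l_causal: "\<And>s. s \<le> 0 \<Longrightarrow> l s = 0"
    and inverse_kernels: "AE x in lborel. x \<in> {0<..<T} \<longrightarrow> line_conv (\<lambda>s. indicator {0<..<T} s * k s) l x = 1"
begin

abbreviation kT :: "real \<Rightarrow> real" where "kT \<equiv> \<lambda>s. indicator {0<..<T} s * k s"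

lemma l_meas [measurable]: "l \<in> borel_measurable borel" using l_int by auto

text \<open>For \<open>h = 0\<close> this is twice the sum of the two quadratic terms on the left-hand side of the inequality
  to be proved. A difference quotient of step \<open>h\<close> does not control the lags below \<open>h\<close>, so these are
  left out.\<close>
definition energy :: "real \<Rightarrow> (real \<Rightarrow> 'a::real_normed_vector) \<Rightarrow> ennreal" where
  "energy h z =
     (\<integral>\<^sup>+ t\<in>{0<..<T}. ennreal ((of_bool (h < T - t) * k (T - t) + of_bool (h < t) * k t) * (norm (z t))\<^sup>2) \<partial>lborel)
   + (\<integral>\<^sup>+ t\<in>{0<..<T}. (\<integral>\<^sup>+ s\<in>{0<..<t}.
        ennreal (of_bool (h < s) * (1/s * (k s - k (2 * s))) * (norm (z t - z (t - s)))\<^sup>2) \<partial>lborel) \<partial>lborel)"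

text \<open>Fatou's lemma, for the double integral once in each variable. For fixed \<open>t\<close> the exceptional lags
  \<open>s\<close> are the reflection of a null set.\<close>
lemma energy_lower_semicontinuous:
  fixes z :: "real \<Rightarrow> 'a::{banach, second_countable_topology}"
  assumes h: "h \<longlonglongrightarrow> 0"
    and [measurable]: "\<And>n. Z n \<in> borel_measurable borel"
    and lim: "AE t in lborel. t \<in> {0<..<T} \<longrightarrow> (\<lambda>n. Z n t) \<longlonglongrightarrow> z t"
  shows "energy 0 z \<le> liminf (\<lambda>n. energy (h n) (Z n))"
proof -
  let ?A = "\<lambda>n t. ennreal ((of_bool (h n < T - t) * k (T - t) + of_bool (h n < t) * k t) * (norm (Z n t))\<^sup>2) * indicator {0<..<T} t"
  let ?B = "\<lambda>n t s. ennreal (of_bool (h n < s) * (1/s * (k s - k (2 * s))) * (norm (Z n t - Z n (t - s)))\<^sup>2) * indicator {0<..<t} s"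
  have "(\<integral>\<^sup>+ t\<in>{0<..<T}. ennreal ((of_bool (0 < T - t) * k (T - t) + of_bool (0 < t) * k t) * (norm (z t))\<^sup>2) \<partial>lborel)
      \<le> liminf (\<lambda>n. \<integral>\<^sup>+ t. ?A n t \<partial>lborel)"
  proof (rule nn_integral_le_liminf_AE)
    show "?A n \<in> borel_measurable lborel" for n by measurable
    show "AE t in lborel. ennreal ((of_bool (0 < T - t) * k (T - t) + of_bool (0 < t) * k t) * (norm (z t))\<^sup>2) * indicator {0<..<T} t
      \<le> liminf (\<lambda>n. ?A n t)"
      using lim
    proof eventually_elim
      case (elim t)
      show ?case
      proof (cases "t \<in> {0<..<T}")
        case True
        then have "(\<lambda>n. (of_bool (h n < T - t) * k (T - t) + of_bool (h n < t) * k t) * (norm (Z n t))\<^sup>2)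
            \<longlonglongrightarrow> (1 * k (T - t) + 1 * k t) * (norm (z t))\<^sup>2"
          using elim by (intro tendsto_intros tendsto_indicator_less h) auto
        from le_liminf_tendsto[OF this] True show ?thesis by simp
      qed simp
    qed
  qed
  moreover have "(\<integral>\<^sup>+ t\<in>{0<..<T}. (\<integral>\<^sup>+ s\<in>{0<..<t}.
        ennreal (of_bool (0 < s) * (1/s * (k s - k (2 * s))) * (norm (z t - z (t - s)))\<^sup>2) \<partial>lborel) \<partial>lborel)
      \<le> liminf (\<lambda>n. \<integral>\<^sup>+ t\<in>{0<..<T}. (\<integral>\<^sup>+ s. ?B n t s \<partial>lborel) \<partial>lborel)"
  proof (rule nn_integral_le_liminf_AE)
    show "(\<lambda>t. (\<integral>\<^sup>+ s. ?B n t s \<partial>lborel) * indicator {0<..<T} t) \<in> borel_measurable lborel" for n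
      unfolding indicator_def greaterThanLessThan_iff by measurable
    show "AE t in lborel. (\<integral>\<^sup>+ s\<in>{0<..<t}.
        ennreal (of_bool (0 < s) * (1/s * (k s - k (2 * s))) * (norm (z t - z (t - s)))\<^sup>2) \<partial>lborel) * indicator {0<..<T} t
      \<le> liminf (\<lambda>n. (\<integral>\<^sup>+ s. ?B n t s \<partial>lborel) * indicator {0<..<T} t)"
      using lim
    proof eventually_elim
      case (elim t)
      show ?case
      proof (cases "t \<in> {0<..<T}")
        case True
        have "(\<integral>\<^sup>+ s\<in>{0<..<t}.
        ennreal (of_bool (0 < s) * (1/s * (k s - k (2 * s))) * (norm (z t - z (t - s)))\<^sup>2) \<partial>lborel) \<le> liminf (\<lambda>n. \<integral>\<^sup>+ s. ?B n t s \<partial>lborel)"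
        proof (rule nn_integral_le_liminf_AE)
          show "?B n t \<in> borel_measurable lborel" for n by measurable
          have "AE s in lborel. t + (-1) * s \<in> {0<..<T} \<longrightarrow> (\<lambda>n. Z n (t + (-1) * s)) \<longlonglongrightarrow> z (t + (-1) * s)"
            by (rule AE_lborel_affine[OF lim]) simp
          then show "AE s in lborel. ennreal (of_bool (0 < s) * (1/s * (k s - k (2 * s))) * (norm (z t - z (t - s)))\<^sup>2) * indicator {0<..<t} s
             \<le> liminf (\<lambda>n. ?B n t s)"
          proof eventually_elim
            case (elim s)
            show ?case
            proof (cases "s \<in> {0<..<t}")
              case s: True
              have "(\<lambda>n. Z n t) \<longlonglongrightarrow> z t" using True \<open>t \<in> {0<..<T} \<longrightarrow> _\<close> by blast
              moreover have "(\<lambda>n. Z n (t - s)) \<longlonglongrightarrow> z (t - s)" using s True elim by simp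
              ultimately have "(\<lambda>n. of_bool (h n < s) * (1/s * (k s - k (2 * s))) * (norm (Z n t - Z n (t - s)))\<^sup>2)
                \<longlonglongrightarrow> 1 * (1/s * (k s - k (2 * s))) * (norm (z t - z (t - s)))\<^sup>2"
                using s by (intro tendsto_mult tendsto_const tendsto_power tendsto_norm tendsto_diff tendsto_indicator_less h) auto
              from le_liminf_tendsto[OF this] s show ?thesis by simp
            qed simp
          qed
        qed
        with True show ?thesis by simp
      qed simp
    qed
  qed
  ultimately show ?thesis
    unfolding energy_def by (intro order_trans[OF add_mono liminf_add_le])
qed

text \<open>Compares the slopes of \<open>k\<close> between \<open>s - h\<close> and \<open>s\<close> and between \<open>s\<close> and \<open>2 s\<close>. This is the discrete form
  of \<open>(k s - k (2 s)) / s \<le> - k' s\<close>.\<close>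
lemma convex_difference_quotient:
  assumes "0 < h" "h < s"
  shows "h * (1/s * (k s - k (2 * s))) \<le> k (s - h) - k s"
proof -
  have "(k (s - h) - k s) / ((s - h) - s) \<le> (k (s - h) - k (2 * s)) / ((s - h) - 2 * s)"
    "(k (s - h) - k (2 * s)) / ((s - h) - 2 * s) \<le> (k s - k (2 * s)) / (s - 2 * s)"
    using assms by (intro convex_on_slope_le[OF k_convex]; simp)+
  then have "(k (s - h) - k s) / ((s - h) - s) \<le> (k s - k (2 * s)) / (s - 2 * s)" by (rule order_trans)
  then show ?thesis using assms by (simp add: divide_simps) (simp add: algebra_simps split: if_splits)?
qed

text \<open>The integral telescopes to that of \<open>k\<close> between \<open>max 0 (x - h)\<close> and \<open>x\<close>, where \<open>k\<close> is at least \<open>k x\<close>.\<close>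
lemma kernel_increment_integral:
  assumes h: "0 < h" and x: "0 < x" "x < T"
  shows "of_bool (h < x) * (h * k x) \<le> (LINT s|lborel. of_bool (0 < s \<and> s < x) * (kT s - kT (s - h)))"
proof -
  have sh: "integrable lborel (\<lambda>s. kT (s - h))"
    using lborel_translate(1)[of kT h] k_int by simp
  have i: "integrable lborel (\<lambda>s. of_bool (P s) * kT s)" if [measurable]: "Measurable.pred borel P" for P
    by (rule Bochner_Integration.integrable_bound[OF k_int]) auto
  have ih: "integrable lborel (\<lambda>s. of_bool (0 < s \<and> s < x) * kT (s - h))"
    by (rule Bochner_Integration.integrable_bound[OF sh]) auto
  have "(LINT s|lborel. of_bool (0 < s \<and> s < x) * (kT s - kT (s - h)))
    = (LINT s|lborel. of_bool (0 < s \<and> s < x) * kT s) - (LINT s|lborel. of_bool (0 < s \<and> s < x) * kT (s - h))"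
    using i ih by (simp add: right_diff_distrib)
  also have "(LINT s|lborel. of_bool (0 < s \<and> s < x) * kT (s - h)) = (LINT s|lborel. of_bool (0 < s + h \<and> s + h < x) * kT s)"
    using lborel_translate(2)[of "\<lambda>s. of_bool (0 < s + h \<and> s + h < x) * kT s" h] by simp
  also have "(LINT s|lborel. of_bool (0 < s \<and> s < x) * kT s) - \<dots>
      = (LINT s|lborel. of_bool (0 < s \<and> s < x) * kT s - of_bool (0 < s + h \<and> s + h < x) * kT s)"
    by (intro Bochner_Integration.integral_diff[symmetric] i) measurable
  also have "\<dots> = (LINT s|lborel. of_bool (x - h \<le> s \<and> 0 < s \<and> s < x) * kT s)"
    using h x by (intro Bochner_Integration.integral_cong) (auto simp: indicator_def of_bool_def)
  finally have eq: "(LINT s|lborel. of_bool (0 < s \<and> s < x) * (kT s - kT (s - h)))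
      = (LINT s|lborel. of_bool (x - h \<le> s \<and> 0 < s \<and> s < x) * kT s)" .
  show "of_bool (h < x) * (h * k x) \<le> (LINT s|lborel. of_bool (0 < s \<and> s < x) * (kT s - kT (s - h)))"
  proof (cases "h < x")
    case True
    have "h * k x = (LINT s|lborel. indicator {x - h..<x} s * k x)" using h by simp
    also have "\<dots> \<le> (LINT s|lborel. of_bool (x - h \<le> s \<and> 0 < s \<and> s < x) * kT s)"
    proof (rule integral_mono)
      show "integrable lborel (\<lambda>s. indicator {x - h..<x} s * k x)"
        using h by (intro integrable_mult_left integrable_real_indicator) auto
      show "integrable lborel (\<lambda>s. of_bool (x - h \<le> s \<and> 0 < s \<and> s < x) * kT s)" by (intro i) measurable
      show "indicator {x - h..<x} s * k x \<le> of_bool (x - h \<le> s \<and> 0 < s \<and> s < x) * kT s" for s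
        using True x k_antimono[of s x] by (auto simp: indicator_def)
    qed
    finally show ?thesis unfolding eq using True by simp
  next
    case False
    then show ?thesis unfolding eq using k_nonneg by simp
  qed
qed

text \<open>The difference \<open>W t - W (t + h)\<close> correlates \<open>z\<close> with the increment \<open>\<mu>\<close> of the kernel. By
  \<open>2 (x, y) = \<bar>x\<bar>\<^sup>2 + \<bar>y\<bar>\<^sup>2 - \<bar>x - y\<bar>\<^sup>2\<close>, twice \<open>J\<close> is \<open>A1 + A2 - A3\<close>. In \<open>A1\<close> and \<open>A2\<close> the values
  \<open>\<bar>z t\<bar>\<^sup>2\<close> are weighted with integrals of \<open>\<mu>\<close>, which dominate \<open>h k (T - t)\<close> and \<open>h k t\<close>. In \<open>A3\<close> the
  squared differences are weighted with \<open>\<mu>\<close>, which is negative for lags above \<open>h\<close>, where convexity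
  applies. For lags up to \<open>h\<close> it is positive, but there the squared differences are at most \<open>(L h)\<^sup>2\<close>.\<close>
lemma energy_step:
  fixes z :: "real \<Rightarrow> 'a::{real_inner, banach, second_countable_topology}"
  assumes h: "0 < h" and [measurable]: "z \<in> borel_measurable borel"
    and C: "\<And>t. norm (z t) \<le> C" and L: "\<And>s t. norm (z s - z t) \<le> L * \<bar>s - t\<bar>"
    and z0: "\<And>t. T \<le> t \<Longrightarrow> z t = 0"
  defines "W \<equiv> \<lambda>t. LINT s|lborel. kT s *\<^sub>R z (t + s)"
  defines "J \<equiv> LINT t|lborel. indicator {0<..<T} t * (z t \<bullet> (W t - W (t + h)))"
  shows "energy h z \<le> ennreal (2 * J / h + T * L\<^sup>2 * h * integral\<^sup>L lborel kT)"
    and "0 \<le> 2 * J / h + T * L\<^sup>2 * h * integral\<^sup>L lborel kT"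
proof -
  let ?sq = "\<lambda>t. (norm (z t))\<^sup>2" and ?D = "\<lambda>t s. (norm (z t - z (t - s)))\<^sup>2" and ?D' = "\<lambda>t s. (norm (z t - z (t + s)))\<^sup>2"
  let ?head = "\<lambda>t. (of_bool (h < T - t) * k (T - t) + of_bool (h < t) * k t) * ?sq t"
  let ?tail = "\<lambda>t s. of_bool (h < s) * (1/s * (k s - k (2 * s))) * ?D t s"
  define \<mu> where "\<mu> s = kT s - kT (s - h)" for s
  have \<mu>: "integrable lborel \<mu>"
    unfolding \<mu>_def[abs_def] using k_int lborel_translate(1)[of kT h] by simp
  have [measurable]: "\<mu> \<in> borel_measurable borel" using \<mu> by auto
  have C0: "0 \<le> C" using C[of 0] norm_ge_zero order_trans by blast
  have kz: "integrable lborel (\<lambda>s. a s *\<^sub>R z (t + s))" if a: "integrable lborel a" for a t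
  proof (rule Bochner_Integration.integrable_bound)
    show "integrable lborel (\<lambda>s. a s * C)" using a by simp
    show "AE s in lborel. norm (a s *\<^sub>R z (t + s)) \<le> norm (a s * C)"
      using C C0 by (auto simp: abs_mult intro!: mult_left_mono)
    show "(\<lambda>s. a s *\<^sub>R z (t + s)) \<in> borel_measurable lborel" using a by measurable
  qed
  have sh: "integrable lborel (\<lambda>s. kT (s - h))"
    using lborel_translate(1)[of kT h] k_int by simp
  have W_diff: "W t - W (t + h) = (LINT s|lborel. \<mu> s *\<^sub>R z (t + s))" for t
  proof -
    have "W (t + h) = (LINT s|lborel. kT (s - h) *\<^sub>R z (t + s))"
      unfolding W_def using lborel_translate(2)[of "\<lambda>s. kT s *\<^sub>R z (t + h + s)" h] by simp
    then have "W t - W (t + h) = (LINT s|lborel. kT s *\<^sub>R z (t + s) - kT (s - h) *\<^sub>R z (t + s))"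
      unfolding W_def by (simp only: Bochner_Integration.integral_diff[OF kz[OF k_int] kz[OF sh]])
    then show ?thesis by (simp add: \<mu>_def scaleR_diff_left)
  qed
  (* The shear carries the pairs (t, t + s) to (t - s, t), and thus the domain d to d'. *)
  define d :: "real \<Rightarrow> real \<Rightarrow> real" where "d t s = of_bool (0 < t \<and> 0 < s \<and> t + s < T)" for t s
  define d' :: "real \<Rightarrow> real \<Rightarrow> real" where "d' t s = of_bool (0 < s \<and> s < t \<and> t < T)" for t s
  have dd': "d (t - s) s = d' t s" for t s by (simp add: d_def d'_def)
  have [measurable]: "(\<lambda>(t, s). d t s) \<in> borel_measurable (borel \<Otimes>\<^sub>M borel)"
    "(\<lambda>(t, s). d' t s) \<in> borel_measurable (borel \<Otimes>\<^sub>M borel)"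
    unfolding d_def d'_def by measurable
  have bounded_pair: "integrable (lborel \<Otimes>\<^sub>M lborel) (\<lambda>(t, s). a s * F t s)"
    if a: "integrable lborel a" and [measurable]: "(\<lambda>(t, s). F t s) \<in> borel_measurable (borel \<Otimes>\<^sub>M borel)"
      and F: "\<And>t s. \<bar>F t s\<bar> \<le> indicator {0<..<T} t * c" for a c and F :: "real \<Rightarrow> real \<Rightarrow> real"
  proof (rule Bochner_Integration.integrable_bound)
    have [measurable]: "a \<in> borel_measurable borel" using a by auto
    have "integrable lborel (\<lambda>t. indicator {0<..<T} t * c)"
      by (intro integrable_mult_left integrable_real_indicator) (auto simp: T_pos less_imp_le)
    then show "integrable (lborel \<Otimes>\<^sub>M lborel) (\<lambda>(t, s). a s *\<^sub>R (indicator {0<..<T} t * c))"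
      by (rule integrable_lborel_pair_scaleR[OF a])
    show "(\<lambda>(t, s). a s * F t s) \<in> borel_measurable (lborel \<Otimes>\<^sub>M lborel)" by measurable
    have "\<bar>a s\<bar> * \<bar>F t s\<bar> \<le> \<bar>a s\<bar> * \<bar>indicator {0<..<T} t * c\<bar>" for t s
      using F[of t s] by (intro mult_left_mono) auto
    then show "AE x in lborel \<Otimes>\<^sub>M lborel. norm (case x of (t, s) \<Rightarrow> a s * F t s)
        \<le> norm (case x of (t, s) \<Rightarrow> a s *\<^sub>R (indicator {0<..<T} t * c))"
      by (intro AE_I2) (simp add: case_prod_beta' abs_mult)
  qed
  have d_le: "0 \<le> d t s" "d t s \<le> indicator {0<..<T} t" "d' t s \<le> indicator {0<..<T} t" "0 \<le> d' t s" for t s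
    by (auto simp: d_def d'_def indicator_def)
  have nz: "?sq t \<le> C\<^sup>2" for t using C by (intro power_mono) auto
  have nzd: "(norm (z t - z s))\<^sup>2 \<le> (2 * C)\<^sup>2" for t s
  proof (intro power_mono)
    show "norm (z t - z s) \<le> 2 * C" using norm_triangle_ineq4[of "z t" "z s"] C[of t] C[of s] by simp
  qed simp
  have dF: "\<bar>d t s * x\<bar> \<le> indicator {0<..<T} t * c" "\<bar>d' t s * x\<bar> \<le> indicator {0<..<T} t * c"
    if "0 \<le> x" "x \<le> c" for t s x c
    using that d_le[of t s] by (auto simp: abs_mult intro!: mult_mono)
  let ?F1 = "\<lambda>t s. \<mu> s * (d t s * ?sq t)" and ?F2 = "\<lambda>t s. \<mu> s * (d t s * ?sq (t + s))"
    and ?F3 = "\<lambda>t s. \<mu> s * (d t s * ?D' t s)"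
  have I1: "integrable (lborel \<Otimes>\<^sub>M lborel) (\<lambda>(t, s). ?F1 t s)"
    by (rule bounded_pair[OF \<mu>]) (measurable, rule dF(1)[OF zero_le_power2 nz])
  have I2: "integrable (lborel \<Otimes>\<^sub>M lborel) (\<lambda>(t, s). ?F2 t s)"
    by (rule bounded_pair[OF \<mu>]) (measurable, rule dF(1)[OF zero_le_power2 nz])
  have I3: "integrable (lborel \<Otimes>\<^sub>M lborel) (\<lambda>(t, s). ?F3 t s)"
    by (rule bounded_pair[OF \<mu>]) (measurable, rule dF(1)[OF zero_le_power2 nzd])
  define A1 where "A1 = (LINT t|lborel. LINT s|lborel. ?F1 t s)"
  define A2 where "A2 = (LINT t|lborel. LINT s|lborel. \<mu> s * (d' t s * ?sq t))"
  define A3 where "A3 = (LINT t|lborel. LINT s|lborel. \<mu> s * (d' t s * ?D t s))"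
  have A2: "A2 = (LINT t|lborel. LINT s|lborel. ?F2 t s)"
    and J2: "integrable (lborel \<Otimes>\<^sub>M lborel) (\<lambda>(t, s). \<mu> s * (d' t s * ?sq t))"
    using integrable_shear[OF I2] by (simp_all add: dd' A2_def)
  have A3: "A3 = (LINT t|lborel. LINT s|lborel. ?F3 t s)"
    and J3: "integrable (lborel \<Otimes>\<^sub>M lborel) (\<lambda>(t, s). \<mu> s * (d' t s * ?D t s))"
    using integrable_shear[OF I3] by (simp_all add: dd' A3_def norm_minus_commute)
  have polar: "2 * J = A1 + A2 - A3"
  proof -
    have "2 * (indicator {0<..<T} t * (z t \<bullet> (W t - W (t + h))))
        = (LINT s|lborel. ?F1 t s + ?F2 t s
            - ?F3 t s)" for t
    proof -
      have "2 * (indicator {0<..<T} t * (z t \<bullet> (W t - W (t + h))))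
          = (LINT s|lborel. 2 * (indicator {0<..<T} t * (z t \<bullet> (\<mu> s *\<^sub>R z (t + s)))))"
      proof -
        have "(LINT s|lborel. z t \<bullet> (\<mu> s *\<^sub>R z (t + s))) = z t \<bullet> (LINT s|lborel. \<mu> s *\<^sub>R z (t + s))"
          by (rule integral_inner_right) (rule kz[OF \<mu>])
        then show ?thesis unfolding W_diff by (simp only: integral_mult_right_zero)
      qed
      also have "\<dots> = (LINT s|lborel. ?F1 t s + ?F2 t s
            - ?F3 t s)"
      proof (intro Bochner_Integration.integral_cong refl)
        fix s
        have e: "2 * (z t \<bullet> z (t + s)) = ?sq t + ?sq (t + s) - ?D' t s"
          by (simp add: power2_norm_eq_inner inner_diff_left inner_diff_right inner_commute)
        have s: "s \<le> 0 \<Longrightarrow> \<mu> s = 0" using h by (auto simp: \<mu>_def indicator_def)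
        have "2 * (indicator {0<..<T} t * (z t \<bullet> (\<mu> s *\<^sub>R z (t + s)))) = \<mu> s * d t s * (2 * (z t \<bullet> z (t + s)))"
          using s z0[of "t + s"] z0[of t] by (auto simp: d_def indicator_def of_bool_def not_less)
        also have "\<dots> = ?F1 t s + ?F2 t s
            - ?F3 t s"
          unfolding e by (simp add: algebra_simps)
        finally show "2 * (indicator {0<..<T} t * (z t \<bullet> (\<mu> s *\<^sub>R z (t + s)))) = ?F1 t s + ?F2 t s
            - ?F3 t s" .
      qed
      finally show ?thesis .
    qed
    then have "2 * J = (LINT t|lborel. LINT s|lborel. ?F1 t s + ?F2 t s
            - ?F3 t s)"
      unfolding J_def by (simp flip: integral_mult_right_zero)
    also have "\<dots> = (LINT t|lborel. (LINT s|lborel. ?F1 t s) + (LINT s|lborel. ?F2 t s)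
            - (LINT s|lborel. ?F3 t s))"
    proof (rule integral_cong_AE)
      show "AE t in lborel. (LINT s|lborel. ?F1 t s + ?F2 t s
            - ?F3 t s)
          = (LINT s|lborel. ?F1 t s) + (LINT s|lborel. ?F2 t s)
            - (LINT s|lborel. ?F3 t s)"
        using lborel_pair.AE_integrable_fst[OF I1] lborel_pair.AE_integrable_fst[OF I2] lborel_pair.AE_integrable_fst[OF I3]
        by eventually_elim (simp only: Bochner_Integration.integral_add Bochner_Integration.integral_diff Bochner_Integration.integrable_add)
    qed (unfold d_def, measurable)
    also have "\<dots> = A1 + A2 - A3"
      unfolding A1_def A2 A3
      using lborel_pair.integrable_fst[OF I1] lborel_pair.integrable_fst[OF I2] lborel_pair.integrable_fst[OF I3]
      by (simp only: Bochner_Integration.integral_add Bochner_Integration.integral_diff Bochner_Integration.integrable_add)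
    finally show ?thesis .
  qed
  define M where "M x = (LINT s|lborel. of_bool (0 < s \<and> s < x) * \<mu> s)" for x
  have M: "of_bool (h < x) * (h * k x) \<le> M x" if "0 < x" "x < T" for x
    unfolding M_def \<mu>_def by (rule kernel_increment_integral[OF h that])
  have inner1: "(LINT s|lborel. ?F1 t s) = indicator {0<..<T} t * (M (T - t) * ?sq t)" for t
  proof -
    have "(LINT s|lborel. ?F1 t s) = (LINT s|lborel. indicator {0<..<T} t * (of_bool (0 < s \<and> s < T - t) * \<mu> s * ?sq t))"
      by (intro Bochner_Integration.integral_cong refl) (auto simp: d_def indicator_def)
    then show ?thesis by (simp add: M_def)
  qed
  have inner2: "(LINT s|lborel. \<mu> s * (d' t s * ?sq t)) = indicator {0<..<T} t * (M t * ?sq t)" for t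
  proof -
    have "(LINT s|lborel. \<mu> s * (d' t s * ?sq t)) = (LINT s|lborel. indicator {0<..<T} t * (of_bool (0 < s \<and> s < t) * \<mu> s * ?sq t))"
      by (intro Bochner_Integration.integral_cong refl) (auto simp: d'_def indicator_def)
    then show ?thesis by (simp add: M_def)
  qed
  have iA1: "integrable lborel (\<lambda>t. indicator {0<..<T} t * (M (T - t) * ?sq t))" and A1': "A1 = (LINT t|lborel. indicator {0<..<T} t * (M (T - t) * ?sq t))"
    using lborel_pair.integrable_fst[OF I1] unfolding inner1 A1_def by simp_all
  have iA2: "integrable lborel (\<lambda>t. indicator {0<..<T} t * (M t * ?sq t))" and A2': "A2 = (LINT t|lborel. indicator {0<..<T} t * (M t * ?sq t))"
    using lborel_pair.integrable_fst[OF J2] unfolding inner2 A2_def by simp_all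
  (* The lags above h, with the favourable sign, and the lags up to h, where the shifted
     kernel vanishes. *)
  define \<gamma> where "\<gamma> t s = \<mu> s * (d' t s * (- of_bool (h < s) * ?D t s))" for t s
  define \<epsilon> where "\<epsilon> t s = kT s * (d' t s * (of_bool (s \<le> h) * ?D t s))" for t s
  have iG: "integrable (lborel \<Otimes>\<^sub>M lborel) (\<lambda>(t, s). \<gamma> t s)"
  proof -
    have "integrable (lborel \<Otimes>\<^sub>M lborel) (\<lambda>(t, s). \<mu> s * (d' t s * (of_bool (h < s) * ?D t s)))"
      by (rule bounded_pair[OF \<mu>]) (measurable, rule dF(2)[of _ "(2 * C)\<^sup>2"], use nzd in \<open>auto simp: of_bool_def\<close>)
    from Bochner_Integration.integrable_minus[OF this] show ?thesis by (simp add: \<gamma>_def case_prod_beta')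
  qed
  have iE: "integrable (lborel \<Otimes>\<^sub>M lborel) (\<lambda>(t, s). \<epsilon> t s)"
    unfolding \<epsilon>_def
    by (rule bounded_pair[OF k_int]) (measurable, rule dF(2)[of _ "(2 * C)\<^sup>2"], use nzd in \<open>auto simp: of_bool_def\<close>)
  define G where "G = (LINT t|lborel. LINT s|lborel. \<gamma> t s)"
  define E where "E = (LINT t|lborel. LINT s|lborel. \<epsilon> t s)"
  have ptw: "\<mu> s * (d' t s * ?D t s) = \<epsilon> t s - \<gamma> t s" for t s
    using h by (auto simp: \<epsilon>_def \<gamma>_def \<mu>_def d'_def indicator_def of_bool_def algebra_simps)
  have A3': "A3 = E - G"
  proof -
    have "A3 = (LINT t|lborel. (LINT s|lborel. \<epsilon> t s) - (LINT s|lborel. \<gamma> t s))"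
      unfolding A3_def ptw
    proof (rule integral_cong_AE)
      show "AE t in lborel. (LINT s|lborel. \<epsilon> t s - \<gamma> t s) = (LINT s|lborel. \<epsilon> t s) - (LINT s|lborel. \<gamma> t s)"
        using lborel_pair.AE_integrable_fst[OF iE] lborel_pair.AE_integrable_fst[OF iG]
        by eventually_elim simp
    qed (unfold \<epsilon>_def \<gamma>_def d'_def, measurable)
    also have "\<dots> = E - G"
      using lborel_pair.integrable_fst[OF iE] lborel_pair.integrable_fst[OF iG] by (simp add: E_def G_def)
    finally show ?thesis .
  qed
  have L0: "0 \<le> L" using order_trans[OF norm_ge_zero L[of 1 0]] by simp
  have E_le: "E \<le> T * L\<^sup>2 * h\<^sup>2 * integral\<^sup>L lborel kT"
  proof -
    have P: "integrable (lborel \<Otimes>\<^sub>M lborel) (\<lambda>(t, s). kT s *\<^sub>R (indicator {0<..<T} t * (L * h)\<^sup>2))"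
      by (intro integrable_lborel_pair_scaleR k_int integrable_mult_left integrable_real_indicator) (auto simp: T_pos less_imp_le)
    have le: "\<epsilon> t s \<le> kT s *\<^sub>R (indicator {0<..<T} t * (L * h)\<^sup>2)" for t s
    proof (cases "0 < s \<and> s \<le> h \<and> s < t \<and> t < T")
      case True
      have "norm (z t - z (t - s)) \<le> L * s" using L[of t "t - s"] True by simp
      also have "\<dots> \<le> L * h" using True L0 by (intro mult_left_mono) auto
      finally have "?D t s \<le> (L * h)\<^sup>2" by (intro power_mono) auto
      with True k_nonneg[of s] show ?thesis by (auto simp: \<epsilon>_def d'_def indicator_def intro!: mult_left_mono)
    next
      case False
      then have "\<epsilon> t s = 0" by (auto simp: \<epsilon>_def d'_def of_bool_def)
      then show ?thesis using k_nonneg[of s] by simp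
    qed
    have "E = integral\<^sup>L (lborel \<Otimes>\<^sub>M lborel) (\<lambda>(t, s). \<epsilon> t s)"
      unfolding E_def by (rule lborel_pair.integral_fst[OF iE])
    also have "\<dots> \<le> integral\<^sup>L (lborel \<Otimes>\<^sub>M lborel) (\<lambda>(t, s). kT s *\<^sub>R (indicator {0<..<T} t * (L * h)\<^sup>2))"
      by (rule integral_mono[OF iE P]) (use le in auto)
    also have "\<dots> = (LINT t|lborel. LINT s|lborel. kT s *\<^sub>R (indicator {0<..<T} t * (L * h)\<^sup>2))"
      by (rule lborel_pair.integral_fst[OF P, symmetric])
    also have "\<dots> = (LINT t|lborel. indicator {0<..<T} t * ((L * h)\<^sup>2 * integral\<^sup>L lborel kT))"
    proof (intro Bochner_Integration.integral_cong refl)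
      fix t
      have "(LINT s|lborel. kT s * (indicator {0<..<T} t * (L * h)\<^sup>2)) = integral\<^sup>L lborel kT * (indicator {0<..<T} t * (L * h)\<^sup>2)"
        by (rule integral_mult_left_zero)
      then show "(LINT s|lborel. kT s *\<^sub>R (indicator {0<..<T} t * (L * h)\<^sup>2)) = indicator {0<..<T} t * ((L * h)\<^sup>2 * integral\<^sup>L lborel kT)"
        by (simp only: real_scaleR_def) (simp only: mult_ac)
    qed
    also have "\<dots> = T * L\<^sup>2 * h\<^sup>2 * integral\<^sup>L lborel kT" using T_pos by (simp add: power_mult_distrib)
    finally show ?thesis .
  qed
  have quad: "?tail t s * indicator {0<..<t} s * indicator {0<..<T} t \<le> \<gamma> t s / h"
    and quad0: "0 \<le> \<gamma> t s" for t s
  proof -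
    have *: "?tail t s * indicator {0<..<t} s * indicator {0<..<T} t \<le> \<gamma> t s / h \<and> 0 \<le> \<gamma> t s"
    proof (cases "h < s \<and> s < t \<and> t < T")
      case True
      then have g: "\<gamma> t s = (k (s - h) - k s) * ?D t s"
        using h by (simp add: \<gamma>_def \<mu>_def d'_def flip: mult_minus_left)
      have "0 \<le> k (s - h) - k s" using True h k_antimono[of "s - h" s] by simp
      moreover have "(1/s * (k s - k (2 * s))) * ?D t s \<le> (k (s - h) - k s) / h * ?D t s"
      proof (rule mult_right_mono)
        show "1/s * (k s - k (2 * s)) \<le> (k (s - h) - k s) / h"
          using convex_difference_quotient[OF h, of s] True h by (simp add: pos_le_divide_eq mult.commute)
      qed simp
      ultimately show ?thesis using True h by (simp add: g)
    next
      case False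
      then show ?thesis using h by (auto simp: \<gamma>_def d'_def of_bool_def indicator_def)
    qed
    show "?tail t s * indicator {0<..<t} s * indicator {0<..<T} t \<le> \<gamma> t s / h"
      "0 \<le> \<gamma> t s" using * by blast+
  qed
  let ?N1 = "(\<integral>\<^sup>+ t\<in>{0<..<T}. ennreal (?head t) \<partial>lborel)"
  let ?N2 = "(\<integral>\<^sup>+ t\<in>{0<..<T}. (\<integral>\<^sup>+ s\<in>{0<..<t}.
        ennreal (?tail t s) \<partial>lborel) \<partial>lborel)"
  have first: "?N1
      \<le> ennreal ((A1 + A2) / h)" and A12: "0 \<le> (A1 + A2) / h"
  proof -
    define f where "f t = (indicator {0<..<T} t * (M (T - t) * ?sq t) + indicator {0<..<T} t * (M t * ?sq t)) / h" for t
    have le: "?head t * indicator {0<..<T} t \<le> f t" for t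
    proof (cases "t \<in> {0<..<T}")
      case True
      have "h * (of_bool (h < T - t) * k (T - t) + of_bool (h < t) * k t) \<le> M (T - t) + M t"
        using M[of "T - t"] M[of t] True by (simp add: algebra_simps)
      then have "of_bool (h < T - t) * k (T - t) + of_bool (h < t) * k t \<le> (M (T - t) + M t) / h"
        using h by (simp add: pos_le_divide_eq mult.commute)
      from mult_right_mono[OF this, of "?sq t"] True show ?thesis by (simp add: f_def distrib_right)
    qed (simp add: f_def)
    have f0: "0 \<le> f t" for t
    proof (rule order_trans[OF _ le])
      show "0 \<le> ?head t * indicator {0<..<T} t"
        using k_nonneg by (intro mult_nonneg_nonneg add_nonneg_nonneg) auto
    qed
    have fi: "integrable lborel f" "integral\<^sup>L lborel f = (A1 + A2) / h"
      unfolding f_def using iA1 iA2 by (simp_all add: A1' A2')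
    have "?N1
        \<le> (\<integral>\<^sup>+ t. ennreal (f t) \<partial>lborel)"
    proof (rule nn_integral_mono)
      fix t
      show "ennreal (?head t) * indicator {0<..<T} t \<le> ennreal (f t)"
        using le[of t] by (cases "t \<in> {0<..<T}") (simp_all add: ennreal_leI)
    qed
    also have "\<dots> = ennreal ((A1 + A2) / h)" using nn_integral_eq_integral[OF fi(1)] f0 fi(2) by simp
    finally show "?N1
      \<le> ennreal ((A1 + A2) / h)" .
    show "0 \<le> (A1 + A2) / h" unfolding fi(2)[symmetric] using f0 by (intro integral_nonneg_AE) auto
  qed
  have second: "?N2 \<le> ennreal (G / h)" and G0: "0 \<le> G / h"
  proof -
    have iGh: "integrable (lborel \<Otimes>\<^sub>M lborel) (\<lambda>x. case x of (t, s) \<Rightarrow> \<gamma> t s / h)"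
      using integrable_divide_zero[OF iG, of h] by (simp add: case_prod_beta')
    have "?N2
        \<le> (\<integral>\<^sup>+ t. (\<integral>\<^sup>+ s. ennreal (\<gamma> t s / h) \<partial>lborel) \<partial>lborel)"
    proof (rule nn_integral_mono)
      fix t
      show "(\<integral>\<^sup>+ s\<in>{0<..<t}. ennreal (?tail t s) \<partial>lborel) * indicator {0<..<T} t
          \<le> (\<integral>\<^sup>+ s. ennreal (\<gamma> t s / h) \<partial>lborel)"
      proof (cases "t \<in> {0<..<T}")
        case True
        have "(\<integral>\<^sup>+ s\<in>{0<..<t}. ennreal (?tail t s) \<partial>lborel)
          \<le> (\<integral>\<^sup>+ s. ennreal (\<gamma> t s / h) \<partial>lborel)"
        proof (rule nn_integral_mono)
          fix s
          show "ennreal (?tail t s) * indicator {0<..<t} s \<le> ennreal (\<gamma> t s / h)"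
            using quad[of s t] True by (cases "s \<in> {0<..<t}") (simp_all add: ennreal_leI)
        qed
        with True show ?thesis by simp
      qed simp
    qed
    also have "\<dots> = (\<integral>\<^sup>+ x. ennreal (case x of (t, s) \<Rightarrow> \<gamma> t s / h) \<partial>(lborel \<Otimes>\<^sub>M lborel))"
      using lborel.nn_integral_fst[of "\<lambda>x. ennreal (case x of (t, s) \<Rightarrow> \<gamma> t s / h)" lborel] iGh by simp
    also have "\<dots> = ennreal (integral\<^sup>L (lborel \<Otimes>\<^sub>M lborel) (\<lambda>x. case x of (t, s) \<Rightarrow> \<gamma> t s / h))"
      by (rule nn_integral_eq_integral[OF iGh]) (use quad0 h in \<open>auto intro!: AE_I2\<close>)
    also have "integral\<^sup>L (lborel \<Otimes>\<^sub>M lborel) (\<lambda>x. case x of (t, s) \<Rightarrow> \<gamma> t s / h) = G / h"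
      using lborel_pair.integral_fst[OF iGh] by (simp add: G_def)
    finally show "?N2 \<le> ennreal (G / h)" .
    show "0 \<le> G / h" unfolding G_def using quad0 h by (intro divide_nonneg_pos integral_nonneg_AE AE_I2) auto
  qed
  have "(A1 + A2) / h + G / h = (2 * J + E) / h" using polar A3' by (simp add: add_divide_distrib[symmetric])
  also have "\<dots> \<le> (2 * J + T * L\<^sup>2 * h\<^sup>2 * integral\<^sup>L lborel kT) / h"
    using E_le h by (intro divide_right_mono) auto
  also have "\<dots> = 2 * J / h + T * L\<^sup>2 * h * integral\<^sup>L lborel kT"
    using h by (simp add: add_divide_distrib power2_eq_square)
  finally have fin: "(A1 + A2) / h + G / h \<le> 2 * J / h + T * L\<^sup>2 * h * integral\<^sup>L lborel kT" .
  then show "0 \<le> 2 * J / h + T * L\<^sup>2 * h * integral\<^sup>L lborel kT" using A12 G0 by linarith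
  have "energy h z \<le> ennreal ((A1 + A2) / h) + ennreal (G / h)"
    unfolding energy_def by (intro add_mono first second)
  also have "\<dots> = ennreal ((A1 + A2) / h + G / h)" using A12 G0 by simp
  also have "\<dots> \<le> ennreal (2 * J / h + T * L\<^sup>2 * h * integral\<^sup>L lborel kT)" using fin by (rule ennreal_leI)
  finally show "energy h z \<le> ennreal (2 * J / h + T * L\<^sup>2 * h * integral\<^sup>L lborel kT)" .
qed

text \<open>The backward convolution of \<open>l\<close> with a function that vanishes after time \<open>T\<close>.\<close>
definition memory :: "(real \<Rightarrow> 'a::{banach, second_countable_topology}) \<Rightarrow> real \<Rightarrow> 'a"
  where "memory g t = (LINT s|lborel. l s *\<^sub>R g (t + s))"

abbreviation pairing :: "(real \<Rightarrow> 'a::{real_inner, banach, second_countable_topology}) \<Rightarrow> real"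
  where "pairing g \<equiv> LINT t|lborel. indicator {0<..<T} t * (memory g t \<bullet> g t)"

lemma borel_measurable_memory [measurable]:
  assumes [measurable]: "g \<in> borel_measurable borel"
  shows "memory g \<in> borel_measurable borel"
  unfolding memory_def[abs_def] by measurable

lemma memory_cutoff:
  assumes "\<And>t. T \<le> t \<Longrightarrow> g t = 0" "T \<le> t"
  shows "memory g t = 0"
proof -
  have "l s *\<^sub>R g (t + s) = 0" for s
    using l_causal[of s] assms by (cases "s \<le> 0") auto
  then have "(\<lambda>s. l s *\<^sub>R g (t + s)) = (\<lambda>s. 0)" by (rule ext)
  then show ?thesis by (simp only: memory_def integral_zero)
qed

text \<open>The identity \<open>k * (l * g) = 1 * g\<close>, backward in time.\<close>
lemma kernel_memory:
  fixes g :: "real \<Rightarrow> 'a::{banach, second_countable_topology}"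
  assumes [measurable]: "g \<in> borel_measurable borel" and N: "\<And>t. norm (g t) \<le> N"
    and g0: "\<And>t. T \<le> t \<Longrightarrow> g t = 0" and t: "0 \<le> t"
  shows "(LINT s|lborel. kT s *\<^sub>R memory g (t + s)) = (LINT x|lborel. of_bool (0 < x) *\<^sub>R g (t + x))"
proof -
  define h where "h x = g (- x)" for x
  have [measurable]: "h \<in> borel_measurable borel" unfolding h_def by measurable
  have "(LINT s|lborel. kT s *\<^sub>R memory g (t + s)) = line_conv kT (line_conv l h) (- t)"
    by (simp add: line_conv_def memory_def h_def algebra_simps)
  also have "\<dots> = line_conv (line_conv kT l) h (- t)"
    by (rule line_conv_assoc_bounded[OF k_int l_int]) (use N in \<open>auto simp: h_def\<close>)
  also have "\<dots> = (LINT x|lborel. line_conv kT l x *\<^sub>R g (t + x))"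
    by (simp add: line_conv_def h_def add.commute)
  also have "\<dots> = (LINT x|lborel. of_bool (0 < x) *\<^sub>R g (t + x))"
  proof (rule integral_cong_AE)
    show "AE x in lborel. line_conv kT l x *\<^sub>R g (t + x) = of_bool (0 < x) *\<^sub>R g (t + x)"
      using inverse_kernels
    proof eventually_elim
      case (elim x)
      consider "x \<le> 0" | "x \<in> {0<..<T}" | "T \<le> x" by fastforce
      then show ?case
      proof cases
        case 1
        then have "kT s *\<^sub>R l (x - s) = 0" for s
          using l_causal[of "x - s"] by (cases "s \<le> 0") auto
        then have "(\<lambda>s. kT s *\<^sub>R l (x - s)) = (\<lambda>s. 0)" by (rule ext)
        then have "line_conv kT l x = 0" by (simp only: line_conv_def integral_zero)
        with 1 show ?thesis by simp
      next
        case 2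
        with elim show ?thesis by simp
      next
        case 3
        with t show ?thesis by (simp add: g0)
      qed
    qed
  qed measurable
  finally show ?thesis .
qed

lemma norm_memory_le:
  fixes g :: "real \<Rightarrow> 'a::{banach, second_countable_topology}"
  assumes [measurable]: "g \<in> borel_measurable borel" and N: "\<And>t. norm (g t) \<le> N"
  shows "norm (memory g t) \<le> (LINT s|lborel. \<bar>l s\<bar>) * N" "integrable lborel (\<lambda>s. l s *\<^sub>R g (t + s))"
proof -
  have i: "integrable lborel (\<lambda>s. \<bar>l s\<bar> * N)" using l_int by simp
  have "AE s in lborel. norm (l s *\<^sub>R g (t + s)) \<le> \<bar>l s\<bar> * N"
    using N by (auto intro!: mult_left_mono)
  from norm_integral_le_AE[OF i _ this]
  show "norm (memory g t) \<le> (LINT s|lborel. \<bar>l s\<bar>) * N" "integrable lborel (\<lambda>s. l s *\<^sub>R g (t + s))"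
    by (simp_all add: memory_def)
qed

lemma memory_diff:
  fixes g :: "real \<Rightarrow> 'a::{banach, second_countable_topology}"
  assumes [measurable]: "g \<in> borel_measurable borel" and N: "\<And>t. norm (g t) \<le> N"
  shows "memory g s - memory g t = memory (\<lambda>x. g (s + x) - g (t + x)) 0"
  unfolding memory_def using norm_memory_le(2)[OF assms, of s] norm_memory_le(2)[OF assms, of t]
  by (simp add: scaleR_diff_right)

text \<open>The function \<open>memory g\<close> is Lipschitz because \<open>g\<close> is. By \<open>kernel_memory\<close>, \<open>W\<close> in \<open>energy_step\<close> is the
  integral of \<open>g\<close> over the future, so its difference quotients tend to \<open>- g\<close> uniformly. Let \<open>h\<close> tend to 0.\<close>
lemma energy_inequality_Lipschitz:
  fixes g :: "real \<Rightarrow> 'a::{real_inner, banach, second_countable_topology}"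
  assumes meas [measurable]: "g \<in> borel_measurable borel" and N: "\<And>t. norm (g t) \<le> N"
    and Lip: "\<And>s t. norm (g s - g t) \<le> \<Lambda> * \<bar>s - t\<bar>"
    and g0: "\<And>t. T \<le> t \<Longrightarrow> g t = 0"
  shows "energy 0 (memory g) \<le> ennreal (2 * pairing g)"
    and "0 \<le> pairing g"
proof -
  define z where "z = memory g"
  have [measurable]: "z \<in> borel_measurable borel" unfolding z_def by measurable
  define I where "I = (LINT t|lborel. indicator {0<..<T} t * (z t \<bullet> g t))"
  define l1 where "l1 = (LINT s|lborel. \<bar>l s\<bar>)"
  define C where "C = l1 * N"
  define L where "L = l1 * \<Lambda>"
  have l1: "0 \<le> l1" by (simp add: l1_def)
  have \<Lambda>0: "0 \<le> \<Lambda>" using order_trans[OF norm_ge_zero Lip[of 1 0]] by simp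
  have N0: "0 \<le> N" using order_trans[OF norm_ge_zero N[of 0]] .
  have zC: "norm (z t) \<le> C" for t unfolding z_def C_def l1_def by (rule norm_memory_le[OF meas N])
  have C0: "0 \<le> C" using l1 N0 by (simp add: C_def)
  have zL: "norm (z s - z t) \<le> L * \<bar>s - t\<bar>" for s t
  proof -
    have "norm (memory (\<lambda>x. g (s + x) - g (t + x)) 0) \<le> l1 * (\<Lambda> * \<bar>s - t\<bar>)"
      unfolding l1_def by (rule norm_memory_le) (use Lip[of "s + x" "t + x" for x] in auto)
    then show ?thesis unfolding z_def memory_diff[OF meas N] by (simp add: L_def mult.assoc)
  qed
  have z0: "z t = 0" if "T \<le> t" for t unfolding z_def by (rule memory_cutoff[OF g0 that])
  define W where "W = (\<lambda>t. LINT s|lborel. kT s *\<^sub>R z (t + s))"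
  define J where "J h = (LINT t|lborel. indicator {0<..<T} t * (z t \<bullet> (W t - W (t + h))))" for h
  have gi: "integrable lborel (\<lambda>x. of_bool (0 < x) *\<^sub>R g (t + x))" if "0 \<le> t" for t
  proof (rule Bochner_Integration.integrable_bound)
    show "integrable lborel (\<lambda>x. indicator {0<..T} x * N)" by (intro integrable_mult_left integrable_indicator_Ioc)
    show "AE x in lborel. norm (of_bool (0 < x) *\<^sub>R g (t + x)) \<le> norm (indicator {0<..T} x * N)"
      using N g0 that N0 by (auto simp: indicator_def of_bool_def)
  qed measurable
  have W_diff: "norm (W t - W (t + h) - h *\<^sub>R g t) \<le> \<Lambda> * h\<^sup>2" if t: "0 \<le> t" and h: "0 < h" for t h
  proof -
    have W: "W t = (LINT x|lborel. of_bool (0 < x) *\<^sub>R g (t + x))" if "0 \<le> t" for t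
      unfolding W_def z_def by (rule kernel_memory[OF meas N g0 that])
    have "W (t + h) = (LINT x|lborel. of_bool (h < x) *\<^sub>R g (t + x))"
      using W[of "t + h"] t h lborel_translate(6)[of "\<lambda>x. of_bool (h < x) *\<^sub>R g (t + x)" h]
      by (simp add: add.assoc)
    moreover have "integrable lborel (\<lambda>x. of_bool (h < x) *\<^sub>R g (t + x))"
      by (rule Bochner_Integration.integrable_bound[OF gi[OF t]]) (use h in auto)
    ultimately have "W t - W (t + h) = (LINT x|lborel. of_bool (0 < x) *\<^sub>R g (t + x) - of_bool (h < x) *\<^sub>R g (t + x))"
      unfolding W[OF t] using gi[OF t] by simp
    also have "\<dots> = (LINT x|lborel. indicator {0<..h} x *\<^sub>R g (t + x))"
      using h by (intro Bochner_Integration.integral_cong refl) (auto simp: indicator_def)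
    finally have 1: "W t - W (t + h) = (LINT x|lborel. indicator {0<..h} x *\<^sub>R g (t + x))" .
    have 2: "h *\<^sub>R g t = (LINT x|lborel. indicator {0<..h} x *\<^sub>R g t)"
      using h by simp
    have i: "integrable lborel (\<lambda>x. indicator {0<..h} x *\<^sub>R g t)" by (intro integrable_scaleR_left integrable_indicator_Ioc)
    have i': "integrable lborel (\<lambda>x. indicator {0<..h} x *\<^sub>R g (t + x))"
    proof (rule Bochner_Integration.integrable_bound)
      show "integrable lborel (\<lambda>x. indicator {0<..h} x * N)" by (intro integrable_mult_left integrable_indicator_Ioc)
      show "AE x in lborel. norm (indicator {0<..h} x *\<^sub>R g (t + x)) \<le> norm (indicator {0<..h} x * N)"
        using N N0 by (auto simp: indicator_def)
    qed measurable
    have "W t - W (t + h) - h *\<^sub>R g t = (LINT x|lborel. indicator {0<..h} x *\<^sub>R (g (t + x) - g t))"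
      unfolding 1 2 using i i' by (simp add: scaleR_diff_right)
    also have "norm \<dots> \<le> (LINT x|lborel. indicator {0<..h} x * (\<Lambda> * h))"
    proof (rule norm_integral_le_AE(2))
      show "integrable lborel (\<lambda>x. indicator {0<..h} x * (\<Lambda> * h))" by (intro integrable_mult_left integrable_indicator_Ioc)
      show "AE x in lborel. norm (indicator {0<..h} x *\<^sub>R (g (t + x) - g t)) \<le> indicator {0<..h} x * (\<Lambda> * h)"
      proof (rule AE_I2)
        fix x
        have "norm (g (t + x) - g t) \<le> \<Lambda> * h" if "0 < x" "x \<le> h"
          using Lip[of "t + x" t] mult_left_mono[of "\<bar>x\<bar>" h \<Lambda>] that \<Lambda>0 by simp
        then show "norm (indicator {0<..h} x *\<^sub>R (g (t + x) - g t)) \<le> indicator {0<..h} x * (\<Lambda> * h)"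
          by (auto simp: indicator_def)
      qed
    qed measurable
    also have "\<dots> = \<Lambda> * h\<^sup>2" using h by (simp add: power2_eq_square)
    finally show ?thesis .
  qed
  have [measurable]: "W \<in> borel_measurable borel" unfolding W_def by measurable
  have iT: "integrable lborel (\<lambda>t. indicator {0<..<T} t * (c::real))" for c
    by (intro integrable_mult_left integrable_real_indicator) (use T_pos in auto)
  have int_I: "integrable lborel (\<lambda>t. indicator {0<..<T} t * (z t \<bullet> g t))"
  proof (rule norm_integral_le_AE(1)[OF iT[of "C * N"]])
    have "\<bar>z t \<bullet> g t\<bar> \<le> C * N" for t
      using order_trans[OF Cauchy_Schwarz_ineq2 mult_mono[OF zC[of t] N[of t] C0 norm_ge_zero]] .
    then show "AE t in lborel. norm (indicator {0<..<T} t * (z t \<bullet> g t)) \<le> indicator {0<..<T} t * (C * N)"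
      by (auto simp: indicator_def)
  qed measurable
  have J_I: "\<bar>J h - h * I\<bar> \<le> T * (C * \<Lambda>) * h\<^sup>2" if h: "0 < h" for h
  proof -
    have ptw: "\<bar>indicator {0<..<T} t * (z t \<bullet> (W t - W (t + h) - h *\<^sub>R g t))\<bar> \<le> indicator {0<..<T} t * (C * (\<Lambda> * h\<^sup>2))" for t
    proof (cases "t \<in> {0<..<T}")
      case True
      have "\<bar>z t \<bullet> (W t - W (t + h) - h *\<^sub>R g t)\<bar> \<le> C * (\<Lambda> * h\<^sup>2)"
        using True h by (intro order_trans[OF Cauchy_Schwarz_ineq2] mult_mono zC W_diff C0) auto
      with True show ?thesis by simp
    qed simp
    have meas1: "(\<lambda>t. indicator {0<..<T} t * (z t \<bullet> (W t - W (t + h) - h *\<^sub>R g t))) \<in> borel_measurable lborel" by measurable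
    have i1: "integrable lborel (\<lambda>t. indicator {0<..<T} t * (z t \<bullet> (W t - W (t + h) - h *\<^sub>R g t)))"
      and b1: "\<bar>LINT t|lborel. indicator {0<..<T} t * (z t \<bullet> (W t - W (t + h) - h *\<^sub>R g t))\<bar> \<le> (LINT t|lborel. indicator {0<..<T} t * (C * (\<Lambda> * h\<^sup>2)))"
      using norm_integral_le_AE[OF iT[of "C * (\<Lambda> * h\<^sup>2)"] meas1] ptw by simp_all
    have "J h = (LINT t|lborel. indicator {0<..<T} t * (z t \<bullet> (W t - W (t + h) - h *\<^sub>R g t)) + h * (indicator {0<..<T} t * (z t \<bullet> g t)))"
      unfolding J_def by (intro Bochner_Integration.integral_cong refl) (simp add: inner_diff_right algebra_simps)
    also have "\<dots> = (LINT t|lborel. indicator {0<..<T} t * (z t \<bullet> (W t - W (t + h) - h *\<^sub>R g t))) + h * I"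
      unfolding I_def by (simp only: Bochner_Integration.integral_add[OF i1 integrable_mult_right[OF int_I]] integral_mult_right_zero)
    finally have "J h - h * I = (LINT t|lborel. indicator {0<..<T} t * (z t \<bullet> (W t - W (t + h) - h *\<^sub>R g t)))" by simp
    with b1 T_pos show ?thesis by (simp add: mult_ac)
  qed
  define h where "h n = inverse (real (Suc n))" for n
  have h: "0 < h n" for n by (simp add: h_def)
  have h_lim: "h \<longlonglongrightarrow> 0" unfolding h_def by (rule LIMSEQ_inverse_real_of_nat)
  define B where "B = 2 * (T * (C * \<Lambda>)) + T * L\<^sup>2 * integral\<^sup>L lborel kT"
  have step: "energy (h n) z \<le> ennreal (2 * I + B * h n)" "0 \<le> 2 * I + B * h n" for n
  proof -
    have "J (h n) \<le> h n * I + T * (C * \<Lambda>) * (h n)\<^sup>2" using J_I[OF h[of n]] by linarith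
    then have "2 * J (h n) / h n \<le> 2 * (h n * I + T * (C * \<Lambda>) * (h n)\<^sup>2) / h n"
      using h[of n] by (intro divide_right_mono) auto
    also have "\<dots> = 2 * I + 2 * (T * (C * \<Lambda>)) * h n" using h[of n] by (simp add: field_simps power2_eq_square)
    finally have le: "2 * J (h n) / h n + T * L\<^sup>2 * h n * integral\<^sup>L lborel kT \<le> 2 * I + B * h n"
      by (simp add: B_def algebra_simps)
    have es: "energy (h n) z \<le> ennreal (2 * J (h n) / h n + T * L\<^sup>2 * h n * integral\<^sup>L lborel kT)"
      "0 \<le> 2 * J (h n) / h n + T * L\<^sup>2 * h n * integral\<^sup>L lborel kT"
      unfolding J_def W_def using energy_step[OF h[of n] _ zC zL z0] by simp_all
    show "energy (h n) z \<le> ennreal (2 * I + B * h n)"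
      by (rule order_trans[OF es(1) ennreal_leI[OF le]])
    show "0 \<le> 2 * I + B * h n"
      by (rule order_trans[OF es(2) le])
  qed
  have lim: "(\<lambda>n. 2 * I + B * h n) \<longlonglongrightarrow> 2 * I"
    using tendsto_add[OF tendsto_const tendsto_mult[OF tendsto_const h_lim], of "2 * I" B] by simp
  have "0 \<le> 2 * I" by (rule LIMSEQ_le_const[OF lim]) (use step(2) in auto)
  then show "0 \<le> pairing g"
    by (simp add: I_def z_def)
  have "energy 0 z \<le> liminf (\<lambda>n. energy (h n) z)"
    by (rule energy_lower_semicontinuous[OF h_lim]) auto
  also have "\<dots> \<le> liminf (\<lambda>n. ennreal (2 * I + B * h n))"
    by (intro Liminf_mono always_eventually allI step)
  also have "\<dots> = ennreal (2 * I)"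
    by (intro lim_imp_Liminf tendsto_ennrealI lim) simp
  finally show "energy 0 (memory g) \<le> ennreal (2 * pairing g)"
    by (simp add: I_def z_def)
qed

text \<open>The energy is lower semicontinuous, and the integrands of \<open>pairing (G n)\<close> are dominated by
  \<open>\<Gamma> t\<close> times the correlation of \<open>\<bar>l\<bar>\<close> with \<open>\<Gamma>\<close>, which is integrable for square integrable \<open>\<Gamma>\<close>.\<close>
lemma energy_inequality_closed:
  fixes g :: "real \<Rightarrow> 'a::{real_inner, banach, second_countable_topology}"
  assumes [measurable]: "g \<in> borel_measurable borel" "\<And>n. G n \<in> borel_measurable borel" "\<Gamma> \<in> borel_measurable borel"
    and \<Gamma>: "integrable lborel \<Gamma>" "integrable lborel (\<lambda>t. (\<Gamma> t)\<^sup>2)"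
    and bd: "\<And>n t. 0 < t \<Longrightarrow> norm (G n t) \<le> \<Gamma> t" "\<And>t. 0 \<le> \<Gamma> t"
    and cut: "\<And>t. T \<le> t \<Longrightarrow> g t = 0" "\<And>n t. T \<le> t \<Longrightarrow> G n t = 0"
    and lim: "AE t in lborel. t \<in> {0<..<T} \<longrightarrow> (\<lambda>n. G n t) \<longlonglongrightarrow> g t"
    and ineq: "\<And>n. energy 0 (memory (G n)) \<le> ennreal (2 * pairing (G n))"
      "\<And>n. 0 \<le> pairing (G n)"
  shows "energy 0 (memory g) \<le> ennreal (2 * pairing g)"
    and "0 \<le> pairing g"
proof -
  have \<Gamma>': "integrable lborel (\<lambda>t. \<Gamma> (- t))" using lborel_translate(3)[of \<Gamma> 0] \<Gamma>(1) by simp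
  have "AE r in lborel. integrable lborel (\<lambda>s. \<bar>l s\<bar> *\<^sub>R \<Gamma> (- (r - s)))"
    by (rule line_conv_integrable(1)[OF integrable_abs[OF l_int] \<Gamma>'])
  from AE_lborel_affine[OF this, of "-1" 0]
  have l\<Gamma>: "AE t in lborel. integrable lborel (\<lambda>s. \<bar>l s\<bar> * \<Gamma> (t + s))" by (simp add: add.commute)
  have mem_lim: "AE t in lborel. t \<in> {0<..<T} \<longrightarrow> (\<lambda>n. memory (G n) t) \<longlonglongrightarrow> memory g t"
    using l\<Gamma>
  proof eventually_elim
    case (elim t)
    show ?case
    proof
      assume t: "t \<in> {0<..<T}"
      show "(\<lambda>n. memory (G n) t) \<longlonglongrightarrow> memory g t" unfolding memory_def
      proof (rule integral_dominated_convergence[OF _ _ elim])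
        have "AE s in lborel. t + 1 * s \<in> {0<..<T} \<longrightarrow> (\<lambda>n. G n (t + 1 * s)) \<longlonglongrightarrow> g (t + 1 * s)"
          by (rule AE_lborel_affine[OF lim]) simp
        then show "AE s in lborel. (\<lambda>n. l s *\<^sub>R G n (t + s)) \<longlonglongrightarrow> l s *\<^sub>R g (t + s)"
        proof eventually_elim
          case (elim s)
          consider "s \<le> 0" | "T \<le> t + s" | "0 < s" "t + s < T" by linarith
          then show ?case
            by cases (use elim t l_causal cut in \<open>auto intro!: tendsto_scaleR\<close>)
        qed
        show "AE s in lborel. norm (l s *\<^sub>R G n (t + s)) \<le> \<bar>l s\<bar> * \<Gamma> (t + s)" for n
        proof (rule AE_I2)
          fix s
          show "norm (l s *\<^sub>R G n (t + s)) \<le> \<bar>l s\<bar> * \<Gamma> (t + s)"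
            using bd(1)[of "t + s" n] l_causal[of s] t by (cases "s \<le> 0") (auto intro!: mult_left_mono)
        qed
      qed measurable
    qed
  qed
  have mem_bd: "AE t in lborel. t \<in> {0<..<T} \<longrightarrow> norm (memory (G n) t) \<le> (LINT s|lborel. \<bar>l s\<bar> * \<Gamma> (t + s))" for n
    using l\<Gamma>
  proof eventually_elim
    case (elim t)
    show ?case
    proof
      assume t: "t \<in> {0<..<T}"
      show "norm (memory (G n) t) \<le> (LINT s|lborel. \<bar>l s\<bar> * \<Gamma> (t + s))" unfolding memory_def
      proof (rule norm_integral_le_AE(2)[OF elim])
        show "AE s in lborel. norm (l s *\<^sub>R G n (t + s)) \<le> \<bar>l s\<bar> * \<Gamma> (t + s)"
        proof (rule AE_I2)
          fix s
          show "norm (l s *\<^sub>R G n (t + s)) \<le> \<bar>l s\<bar> * \<Gamma> (t + s)"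
            using bd(1)[of "t + s" n] l_causal[of s] t by (cases "s \<le> 0") (auto intro!: mult_left_mono)
        qed
      qed measurable
    qed
  qed
  have dom: "integrable lborel (\<lambda>t. (LINT s|lborel. \<bar>l s\<bar> * \<Gamma> (t + s)) * \<Gamma> t)"
  proof -
    have "integrable lborel (\<lambda>s. \<bar>l (0 - s)\<bar>)" using lborel_translate(3)[of "\<lambda>s. \<bar>l s\<bar>" 0] l_int by simp
    from lborel_pair.integrable_fst[OF integrable_square_imp_kernel_product[OF this _ \<Gamma>(2) _ \<Gamma>(2)]]
    have "integrable lborel (\<lambda>t. LINT s|lborel. \<bar>l (0 - s)\<bar> * (\<Gamma> t * \<Gamma> (t - s)))" by simp
    moreover have "(LINT s|lborel. \<bar>l (0 - s)\<bar> * (\<Gamma> t * \<Gamma> (t - s))) = (LINT s|lborel. \<bar>l s\<bar> * \<Gamma> (t + s)) * \<Gamma> t" for t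
      using lborel_translate(4)[of "\<lambda>s. \<bar>l s\<bar> * (\<Gamma> t * \<Gamma> (t + s))" 0]
      by (simp add: mult_ac flip: integral_mult_right_zero)
    ultimately show ?thesis by simp
  qed
  define I where "I n = pairing (G n)" for n
  define J where "J = pairing g"
  have IJ: "I \<longlonglongrightarrow> J" unfolding I_def[abs_def] J_def
  proof (rule integral_dominated_convergence[OF _ _ dom])
    show "AE t in lborel. (\<lambda>n. indicator {0<..<T} t * (memory (G n) t \<bullet> G n t)) \<longlonglongrightarrow> indicator {0<..<T} t * (memory g t \<bullet> g t)"
      using mem_lim lim
    proof eventually_elim
      case (elim t)
      then show ?case by (cases "t \<in> {0<..<T}") (auto intro!: tendsto_mult tendsto_inner)
    qed
    show "AE t in lborel. norm (indicator {0<..<T} t * (memory (G n) t \<bullet> G n t)) \<le> (LINT s|lborel. \<bar>l s\<bar> * \<Gamma> (t + s)) * \<Gamma> t" for n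
      using mem_bd[of n]
    proof eventually_elim
      case (elim t)
      have nn: "0 \<le> (LINT s|lborel. \<bar>l s\<bar> * \<Gamma> (t + s))" using bd(2) by (intro integral_nonneg_AE AE_I2) auto
      show ?case
      proof (cases "t \<in> {0<..<T}")
        case True
        have "\<bar>memory (G n) t \<bullet> G n t\<bar> \<le> norm (memory (G n) t) * norm (G n t)" by (rule Cauchy_Schwarz_ineq2)
        also have "\<dots> \<le> (LINT s|lborel. \<bar>l s\<bar> * \<Gamma> (t + s)) * \<Gamma> t" using elim True bd nn by (intro mult_mono) auto
        finally show ?thesis using True by simp
      qed (use nn bd(2) in simp)
    qed
  qed measurable
  have "0 \<le> J" by (rule LIMSEQ_le_const[OF IJ]) (use ineq(2) in \<open>auto simp: I_def\<close>)
  then show "0 \<le> pairing g" by (simp add: J_def)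
  have "energy 0 (memory g) \<le> liminf (\<lambda>n. energy 0 (memory (G n)))"
    by (rule energy_lower_semicontinuous[OF tendsto_const _ mem_lim]) measurable
  also have "\<dots> \<le> liminf (\<lambda>n. ennreal (2 * I n))"
    unfolding I_def by (intro Liminf_mono always_eventually allI ineq)
  also have "\<dots> = ennreal (2 * J)"
    by (intro lim_imp_Liminf tendsto_ennrealI tendsto_intros IJ) simp
  finally show "energy 0 (memory g) \<le> ennreal (2 * pairing g)"
    by (simp add: J_def)
qed

text \<open>A subsequence of Lipschitz approximations converges almost everywhere. Truncating their values at
  norm \<open>N\<close> and cutting them off at \<open>T\<close> keeps them Lipschitz and makes them dominated.\<close>
lemma energy_inequality_bounded:
  fixes g :: "real \<Rightarrow> 'a::{real_inner, banach, second_countable_topology}"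
  assumes [measurable]: "g \<in> borel_measurable borel" and N: "\<And>t. norm (g t) \<le> N"
    and g0: "\<And>t. t \<notin> {0<..<T} \<Longrightarrow> g t = 0"
  shows "energy 0 (memory g) \<le> ennreal (2 * pairing g)"
    and "0 \<le> pairing g"
proof -
  have N0: "0 \<le> N" using order_trans[OF norm_ge_zero N[of 0]] .
  have iT: "integrable lborel (\<lambda>t. indicator {0<..T} t * (c::real))" for c
    by (intro integrable_mult_left integrable_indicator_Ioc)
  have "integrable lborel g"
    by (rule norm_integral_le_AE(1)[OF iT[of N]]) (use N g0 N0 in \<open>auto simp: indicator_def\<close>)
  from Lipschitz_dense_in_L1[OF this, of "inverse (real (Suc n))" T for n]
  have "\<forall>n. \<exists>\<phi>. (\<exists>\<Lambda>. \<forall>s t. norm (\<phi> s - \<phi> t) \<le> \<Lambda> * \<bar>s - t\<bar>) \<and>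
    integrable lborel (\<lambda>t. indicator {0<..<T} t *\<^sub>R (g t - \<phi> t)) \<and>
    (LINT t|lborel. norm (indicator {0<..<T} t *\<^sub>R (g t - \<phi> t))) < inverse (real (Suc n))" by fastforce
  from choice[OF this] obtain \<phi> where \<phi>': "\<And>n. \<exists>\<Lambda>. \<forall>s t. norm (\<phi> n s - \<phi> n t) \<le> \<Lambda> * \<bar>s - t\<bar>"
    and \<phi>int: "\<And>n. integrable lborel (\<lambda>t. indicator {0<..<T} t *\<^sub>R (g t - \<phi> n t))"
    and \<phi>lt: "\<And>n. (LINT t|lborel. norm (indicator {0<..<T} t *\<^sub>R (g t - \<phi> n t))) < inverse (real (Suc n))" by blast
  from \<phi>' have "\<forall>n. \<exists>\<Lambda>. \<forall>s t. norm (\<phi> n s - \<phi> n t) \<le> \<Lambda> * \<bar>s - t\<bar>" by blast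
  from choice[OF this] obtain \<Lambda> where \<phi>: "\<And>n s t. norm (\<phi> n s - \<phi> n t) \<le> \<Lambda> n * \<bar>s - t\<bar>" by blast
  have "(\<lambda>n. LINT t|lborel. norm (indicator {0<..<T} t *\<^sub>R (g t - \<phi> n t))) \<longlonglongrightarrow> 0"
    by (rule tendsto_sandwich[OF _ _ tendsto_const LIMSEQ_inverse_real_of_nat])
      (use \<phi>lt in \<open>auto intro!: always_eventually less_imp_le simp del: of_nat_Suc\<close>)
  from tendsto_L1_AE_subseq[OF \<phi>int this] obtain r where r: "strict_mono r"
    "AE t in lborel. (\<lambda>n. indicator {0<..<T} t *\<^sub>R (g t - \<phi> (r n) t)) \<longlonglongrightarrow> 0" by auto
  (* Lipschitz with constant n, equal to 0 after T and eventually equal to 1 before T. *)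
  define cut where "cut n t = max 0 (min 1 (real n * (T - t)))" for n t
  have cut01: "0 \<le> cut n t" "cut n t \<le> 1" for n t by (auto simp: cut_def)
  have cutL: "\<bar>cut n s - cut n t\<bar> \<le> real n * \<bar>s - t\<bar>" for n s t
  proof -
    have "\<bar>real n * (T - s) - real n * (T - t)\<bar> = real n * \<bar>s - t\<bar>"
      by (simp add: abs_mult abs_minus_commute flip: right_diff_distrib)
    then show ?thesis unfolding cut_def by linarith
  qed
  define G where "G n t = cut n t *\<^sub>R radial_truncation N (\<phi> (r n) t)" for n t
  have GL: "norm (G n s - G n t) \<le> (2 * \<Lambda> (r n) + real n * N) * \<bar>s - t\<bar>" for n s t
  proof -
    have "G n s - G n t = cut n s *\<^sub>R (radial_truncation N (\<phi> (r n) s) - radial_truncation N (\<phi> (r n) t))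
        + (cut n s - cut n t) *\<^sub>R radial_truncation N (\<phi> (r n) t)"
      by (simp add: G_def algebra_simps)
    also have "norm \<dots> \<le> 1 * (2 * (\<Lambda> (r n) * \<bar>s - t\<bar>)) + (real n * \<bar>s - t\<bar>) * N"
    proof (intro norm_triangle_le add_mono)
      have "norm (radial_truncation N (\<phi> (r n) s) - radial_truncation N (\<phi> (r n) t)) \<le> 2 * (\<Lambda> (r n) * \<bar>s - t\<bar>)"
        using radial_truncation_Lipschitz[OF N0, of "\<phi> (r n) s" "\<phi> (r n) t"] \<phi>[of "r n" s t] by linarith
      then show "norm (cut n s *\<^sub>R (radial_truncation N (\<phi> (r n) s) - radial_truncation N (\<phi> (r n) t))) \<le> 1 * (2 * (\<Lambda> (r n) * \<bar>s - t\<bar>))"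
        unfolding norm_scaleR using cut01[of n s] by (intro mult_mono) auto
      show "norm ((cut n s - cut n t) *\<^sub>R radial_truncation N (\<phi> (r n) t)) \<le> (real n * \<bar>s - t\<bar>) * N"
        unfolding norm_scaleR using cutL norm_radial_truncation(1)[OF N0] by (intro mult_mono) auto
    qed
    finally show ?thesis by (simp add: algebra_simps)
  qed
  have GN: "norm (G n t) \<le> N" for n t
    using mult_mono[OF cut01(2)[of n t] norm_radial_truncation(1)[OF N0, of "\<phi> (r n) t"]] cut01[of n t] by (simp add: G_def)
  have G0: "G n t = 0" if "T \<le> t" for n t
  proof -
    have "real n * (T - t) \<le> 0" using that by (simp add: mult_nonneg_nonpos)
    then have "cut n t = 0" by (simp add: cut_def)
    then show ?thesis by (simp add: G_def)
  qed
  have Gm [measurable]: "G n \<in> borel_measurable borel" for n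
    by (rule borel_measurable_continuous_onI, rule continuous_on_if_Lipschitz_bound, rule GL)
  have Glim: "AE t in lborel. t \<in> {0<..<T} \<longrightarrow> (\<lambda>n. G n t) \<longlonglongrightarrow> g t"
    using r(2)
  proof eventually_elim
    case (elim t)
    show ?case
    proof
      assume t: "t \<in> {0<..<T}"
      then have "(\<lambda>n. g t - \<phi> (r n) t) \<longlonglongrightarrow> 0" using elim by simp
      from tendsto_diff[OF tendsto_const[of "g t"] this] have "(\<lambda>n. \<phi> (r n) t) \<longlonglongrightarrow> g t" by simp
      then have "(\<lambda>n. radial_truncation N (\<phi> (r n) t)) \<longlonglongrightarrow> radial_truncation N (g t)"
        using radial_truncation_continuous[OF N0] by (metis UNIV_I continuous_on_eq_continuous_at isCont_tendsto_compose open_UNIV)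
      moreover have "radial_truncation N (g t) = g t" using N by (simp add: radial_truncation_def)
      moreover have "(\<lambda>n. cut n t) \<longlonglongrightarrow> 1"
      proof (rule tendsto_eventually)
        obtain m where m: "1 < real m * (T - t)" using t ex_less_of_nat_mult[of "T - t" 1] by auto
        show "\<forall>\<^sub>F n in sequentially. cut n t = 1"
          using eventually_ge_at_top[of m]
        proof eventually_elim
          case (elim n)
          then have "real m * (T - t) \<le> real n * (T - t)" using t by (intro mult_right_mono) auto
          with m show ?case by (simp add: cut_def)
        qed
      qed
      ultimately show "(\<lambda>n. G n t) \<longlonglongrightarrow> g t" unfolding G_def using tendsto_scaleR by fastforce
    qed
  qed
  have \<Gamma>2: "integrable lborel (\<lambda>t. (indicator {0<..T} t * N)\<^sup>2)"
  proof -
    have "(indicator {0<..T} t * N)\<^sup>2 = indicator {0<..T} t * N\<^sup>2" for t by (simp add: indicator_def)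
    then show ?thesis using iT[of "N\<^sup>2"] by simp
  qed
  have bd: "norm (G n t) \<le> indicator {0<..T} t * N" if "0 < t" for n t
    using GN[of n t] G0[of t n] that N0 by (auto simp: indicator_def)
  have g0': "g t = 0" if "T \<le> t" for t using g0 that by simp
  show "energy 0 (memory g) \<le> ennreal (2 * pairing g)"
    "0 \<le> pairing g"
    by (rule energy_inequality_closed[OF _ Gm _ iT \<Gamma>2 bd _ g0' G0 Glim energy_inequality_Lipschitz[OF Gm GN GL G0]];
        use N0 in simp)+
qed

lemma energy_inequality:
  fixes g :: "real \<Rightarrow> 'a::{real_inner, banach, second_countable_topology}"
  assumes [measurable]: "g \<in> borel_measurable borel" and g2: "integrable lborel (\<lambda>t. (norm (g t))\<^sup>2)"
    and g0: "\<And>t. t \<notin> {0<..<T} \<Longrightarrow> g t = 0"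
  shows "energy 0 (memory g) \<le> ennreal (2 * pairing g)"
    and "0 \<le> pairing g"
proof -
  have g1: "integrable lborel (\<lambda>t. norm (g t))"
    by (rule integrable_norm[OF square_integrable_imp_integrable[OF _ g2 g0]]) measurable
  define G where "G n t = radial_truncation (real n) (g t)" for n t
  have [measurable]: "radial_truncation (real n) \<in> borel_measurable (borel :: 'a measure)" for n
    by (intro borel_measurable_continuous_onI radial_truncation_continuous) simp
  have Gm [measurable]: "G n \<in> borel_measurable borel" for n unfolding G_def by measurable
  have GN: "norm (G n t) \<le> real n" for n t by (simp add: G_def norm_radial_truncation)
  have G0: "G n t = 0" if "t \<notin> {0<..<T}" for n t using g0[OF that] by (simp add: G_def radial_truncation_def)
  have bd: "norm (G n t) \<le> norm (g t)" for n t by (simp add: G_def norm_radial_truncation)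
  have lim: "AE t in lborel. t \<in> {0<..<T} \<longrightarrow> (\<lambda>n. G n t) \<longlonglongrightarrow> g t"
    unfolding G_def by (intro AE_I2 impI tendsto_eventually radial_truncation_eventually)
  show "energy 0 (memory g) \<le> ennreal (2 * pairing g)"
    "0 \<le> pairing g"
    by (rule energy_inequality_closed[OF _ Gm _ g1 g2 bd _ _ _ lim energy_inequality_bounded[OF Gm GN G0]];
        use g0 G0 in simp)+
qed

end

section \<open>Solving the weak equation\<close>

text \<open>Convolving \<open>k * p = 1 * q\<close> with \<open>l\<close> gives \<open>1 * p = l * k * p = l * 1 * q = 1 * (l * q)\<close>, and equal
  primitives have equal integrands.\<close>
lemma invert_memory_equation:
  fixes p q :: "real \<Rightarrow> real"
  assumes k: "integrable lborel k" "\<And>s. s \<le> 0 \<Longrightarrow> k s = 0"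
    and l: "integrable lborel l" "\<And>s. s \<le> 0 \<Longrightarrow> l s = 0"
    and kl: "AE x in lborel. x \<in> {0<..<T} \<longrightarrow> line_conv k l x = 1"
    and p: "integrable lborel p" "\<And>r. r \<notin> {0<..<T} \<Longrightarrow> p r = 0"
    and q: "integrable lborel q" "\<And>r. r \<notin> {0<..<T} \<Longrightarrow> q r = 0"
    and eq: "AE t in lborel. t \<in> {0<..<T} \<longrightarrow> line_conv k p t = (LINT s|lborel. indicator {0<..<t} s * q s)"
  shows "AE t in lborel. t \<in> {0<..<T} \<longrightarrow> p t = line_conv l q t"
proof -
  have [measurable]: "k \<in> borel_measurable borel" "l \<in> borel_measurable borel" "p \<in> borel_measurable borel" "q \<in> borel_measurable borel"
    using k l p q by auto
  define one :: "real \<Rightarrow> real" where "one = indicator {0<..<T}"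
  have one: "integrable lborel one" unfolding one_def by (cases "0 \<le> T") (auto intro!: integrable_real_indicator)
  have [measurable]: "one \<in> borel_measurable borel" unfolding one_def by measurable
  have one0: "one s = 0" if "s \<le> 0" for s using that by (simp add: one_def)
  have p0: "p r = 0" and q0: "q r = 0" if "r \<le> 0" for r using p(2) q(2) that by auto
  have kp: "AE r in lborel. r < T \<longrightarrow> line_conv k p r = line_conv one q r"
    using eq
  proof eventually_elim
    case (elim r)
    show ?case
    proof
      assume r: "r < T"
      show "line_conv k p r = line_conv one q r"
      proof (cases "r \<le> 0")
        case True
        then show ?thesis by (simp add: line_conv_causal k(2) p0 one0 q0)
      next
        case False
        then show ?thesis using elim r line_conv_one[of q r T] q0 by (simp add: one_def)
      qed
    qed
  qed
  have L: "line_conv l (line_conv k p) t = line_conv l (line_conv one q) t" if "t \<le> T" for t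
    by (rule line_conv_cong_AE[OF _ _ _ l(2) kp that]) measurable
  have lk: "AE x in lborel. x < T \<longrightarrow> line_conv l k x = one x"
    using kl
  proof eventually_elim
    case (elim x)
    show ?case
    proof
      assume "x < T"
      show "line_conv l k x = one x"
      proof (cases "x \<le> 0")
        case True
        then show ?thesis by (simp add: line_conv_causal k(2) l(2) one0)
      next
        case False
        with elim \<open>x < T\<close> show ?thesis by (simp add: one_def line_conv_commute[of l k])
      qed
    qed
  qed
  have lkp: "line_conv (line_conv l k) p t = line_conv one p t" if "t \<le> T" for t
    using line_conv_cong_AE[OF _ _ _ p0 lk that] by (simp add: line_conv_commute[of _ p])
  have "AE t in lborel. t \<in> {0<..<T} \<longrightarrow> line_conv one p t = line_conv one (line_conv l q) t"
    using line_conv_assoc_AE[OF l(1) k(1) p(1)] line_conv_assoc_AE[OF l(1) one q(1)] line_conv_assoc_AE[OF one l(1) q(1)]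
  proof eventually_elim
    case (elim t)
    then show ?case using L[of t] lkp[of t] by (auto simp: line_conv_commute[of one l])
  qed
  then have F: "AE t in lborel. t \<in> {0<..<T} \<longrightarrow> (LINT s|lborel. indicator {0<..<t} s * (p s - line_conv l q s)) = 0"
  proof eventually_elim
    case (elim t)
    show ?case
    proof
      assume t: "t \<in> {0<..<T}"
      have i: "integrable lborel (\<lambda>s. indicator {0<..<t} s * x s)" if "integrable lborel x" for x :: "real \<Rightarrow> real"
        by (rule Bochner_Integration.integrable_bound[OF that]) (use that in \<open>auto simp: indicator_def\<close>)
      have "line_conv one p t = (LINT s|lborel. indicator {0<..<t} s * p s)"
        unfolding one_def using t p0 by (intro line_conv_one) auto
      moreover have "line_conv one (line_conv l q) t = (LINT s|lborel. indicator {0<..<t} s * line_conv l q s)"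
        unfolding one_def using t by (intro line_conv_one line_conv_causal) (auto simp: l(2) q0)
      ultimately show "(LINT s|lborel. indicator {0<..<t} s * (p s - line_conv l q s)) = 0"
        using elim t i[OF p(1)] i[OF line_conv_integrable(2)[OF l(1) q(1)]] by (simp add: right_diff_distrib)
    qed
  qed
  have "AE t in lborel. t \<in> {0<..<T} \<longrightarrow> p t - line_conv l q t = 0"
    by (rule AE_zero_if_primitive_zero_AE[OF _ F]) (intro Bochner_Integration.integrable_diff p line_conv_integrable l q)
  then show ?thesis by eventually_elim auto
qed

text \<open>The integral of \<open>\<bar>k\<bar>\<close> bounds the convolution of \<open>k\<close> with a constant. It vanishes at 0 by dominated
  convergence.\<close>
lemma small_near_zero:
  fixes \<phi> g :: "real \<Rightarrow> real"
  assumes T: "0 < T" and k: "integrable lborel k"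
    and g: "(g \<longlongrightarrow> 0) (at_right 0)"
    and le: "AE t in lborel. t \<in> {0<..<T} \<longrightarrow> \<bar>\<phi> t\<bar> \<le> g t + c * (LINT s|lborel. indicator {0<..t} s * \<bar>k s\<bar>)"
    and c: "0 \<le> c" and e: "0 < e"
  shows "\<exists>r>0. AE t in lborel. 0 < t \<and> t < r \<longrightarrow> \<bar>\<phi> t\<bar> \<le> e"
proof -
  have [measurable]: "k \<in> borel_measurable borel" using k by auto
  have i: "integrable lborel (\<lambda>s. indicator {0<..t} s * \<bar>k s\<bar>)" for t
    by (rule Bochner_Integration.integrable_bound[OF k]) (auto simp: indicator_def)
  have "(\<lambda>n. LINT s|lborel. indicator {0<..inverse (real (Suc n))} s * \<bar>k s\<bar>) \<longlonglongrightarrow> integral\<^sup>L lborel (\<lambda>s::real. 0::real)"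
  proof (rule integral_dominated_convergence[where w="\<lambda>s. \<bar>k s\<bar>"])
    show "AE s in lborel. (\<lambda>n. indicator {0<..inverse (real (Suc n))} s * \<bar>k s\<bar>) \<longlonglongrightarrow> 0"
    proof (intro AE_I2 tendsto_eventually)
      fix s :: real
      show "\<forall>\<^sub>F n in sequentially. indicator {0<..inverse (real (Suc n))} s * \<bar>k s\<bar> = 0"
      proof (cases "0 < s")
        case True
        have "\<forall>\<^sub>F n in sequentially. inverse (real (Suc n)) < s" using order_tendstoD(2)[OF LIMSEQ_inverse_real_of_nat True] .
        then show ?thesis by eventually_elim auto
      qed simp
    qed
  qed (use k in \<open>auto simp: indicator_def\<close>)
  then have lim: "(\<lambda>n. c * (LINT s|lborel. indicator {0<..inverse (real (Suc n))} s * \<bar>k s\<bar>)) \<longlonglongrightarrow> c * 0"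
    by (intro tendsto_mult tendsto_const) simp
  have "\<forall>\<^sub>F n in sequentially. c * (LINT s|lborel. indicator {0<..inverse (real (Suc n))} s * \<bar>k s\<bar>) < e / 2"
    using order_tendstoD(2)[OF lim, of "e / 2"] e by simp
  then obtain n where n: "c * (LINT s|lborel. indicator {0<..inverse (real (Suc n))} s * \<bar>k s\<bar>) < e / 2"
    by (auto simp: eventually_sequentially)
  have "\<forall>\<^sub>F t in at_right 0. g t < e / 2" using order_tendstoD(2)[OF g, of "e / 2"] e by simp
  then obtain r where r: "0 < r" "\<And>t. 0 < t \<Longrightarrow> t < r \<Longrightarrow> g t < e / 2" by (auto simp: eventually_at_right_field)
  show ?thesis
  proof (intro exI conjI)
    show "0 < min T (min r (inverse (real (Suc n))))" using T r by simp
    show "AE t in lborel. 0 < t \<and> t < min T (min r (inverse (real (Suc n)))) \<longrightarrow> \<bar>\<phi> t\<bar> \<le> e"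
      using le
    proof eventually_elim
      case (elim t)
      show ?case
      proof
        assume t: "0 < t \<and> t < min T (min r (inverse (real (Suc n))))"
        have "c * (LINT s|lborel. indicator {0<..t} s * \<bar>k s\<bar>) \<le> c * (LINT s|lborel. indicator {0<..inverse (real (Suc n))} s * \<bar>k s\<bar>)"
          using t by (intro mult_left_mono integral_mono i c) (auto simp: indicator_def)
        then show "\<bar>\<phi> t\<bar> \<le> e" using elim t r(2)[of t] n by auto
      qed
    qed
  qed
qed

text \<open>Complete monotonicity of order two is convexity.\<close>
lemma PC_convex_kernel_pair:
  assumes T: "0 < T" and kl: "(k, l) \<in> PC" and cm: "completely_monotone k"
  shows "convex_kernel_pair T (\<lambda>s. indicator {0<..} s * k s) (\<lambda>s. indicator {0<..<T} s * l s)"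
proof
  have sm: "smooth_on {0<..} k" and sign: "\<And>n t. 0 < t \<Longrightarrow> 0 \<le> (-1) ^ n * (deriv ^^ n) k t"
    using cm by (auto simp: completely_monotone_def)
  have d0: "(k has_real_derivative deriv k t) (at t)" if "0 < t" for t
  proof -
    have "(deriv ^^ 0) k field_differentiable at t" using sm that unfolding smooth_on_def by blast
    then show ?thesis by (simp add: DERIV_deriv_iff_field_differentiable)
  qed
  have d1: "(deriv k has_real_derivative deriv (deriv k) t) (at t)" if "0 < t" for t
  proof -
    have "(deriv ^^ 1) k field_differentiable at t" using sm that unfolding smooth_on_def by blast
    then show ?thesis by (simp add: DERIV_deriv_iff_field_differentiable)
  qed
  show "0 < T" by fact
  have "continuous_on {0<..} k"
    by (rule DERIV_continuous_on, rule has_field_derivative_at_within, rule d0) simp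
  then show "(\<lambda>s. indicator {0<..} s * k s) \<in> borel_measurable borel"
    using borel_measurable_continuous_on_indicator[of "{0<..}" k] by simp
  show "0 \<le> indicator {0<..} t * k t" for t
    using kl by (auto simp: PC_def indicator_def)
  show "indicator {0<..} t * k t \<le> indicator {0<..} s * k s" if "0 < s" "s \<le> t" for s t
    using kl that by (auto simp: PC_def monotone_on_def)
  show "convex_on {0<..} (\<lambda>s. indicator {0<..} s * k s)"
  proof (rule f''_ge0_imp_convex)
    fix x :: real assume x: "x \<in> {0<..}"
    show "((\<lambda>s. indicator {0<..} s * k s) has_real_derivative deriv k x) (at x)"
      by (rule has_field_derivative_transform_within_open[OF d0, of _ "{0<..}"]) (use x in auto)
    show "(deriv k has_real_derivative deriv (deriv k) x) (at x)" using d1 x by simp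
    show "0 \<le> deriv (deriv k) x" using sign[of x 2] x by (simp add: numeral_2_eq_2)
  qed auto
  have si: "integrable lborel (\<lambda>s. indicator {0<..<T} s * m s)" if "L1_loc m" for m
  proof -
    have "set_integrable lborel {0..T} m" using that T by (simp add: L1_loc_def)
    then have "set_integrable lborel {0<..<T} m" by (rule set_integrable_subset) auto
    then show ?thesis by (simp add: set_integrable_def)
  qed
  have eqk: "(\<lambda>s. indicator {0<..<T} s * (indicator {0<..} s * k s)) = (\<lambda>s. indicator {0<..<T} s * k s)"
    by (auto simp: indicator_def)
  show "integrable lborel (\<lambda>s. indicator {0<..<T} s * (indicator {0<..} s * k s))"
    unfolding eqk using kl by (intro si) (simp add: PC_def)
  show "integrable lborel (\<lambda>s. indicator {0<..<T} s * l s)"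
    using kl by (intro si) (simp add: PC_def)
  show "indicator {0<..<T} s * l s = 0" if "s \<le> 0" for s using that by simp
  have "AE t in lborel. 0 < t \<longrightarrow> conv k l t = 1" using kl by (simp add: PC_def)
  then show "AE x in lborel. x \<in> {0<..<T} \<longrightarrow> line_conv (\<lambda>s. indicator {0<..<T} s * (indicator {0<..} s * k s)) (\<lambda>s. indicator {0<..<T} s * l s) x = 1"
  proof eventually_elim
    case (elim x)
    then show ?case unfolding eqk using conv_eq_line_conv[of x T k l] by auto
  qed
qed

text \<open>The scalar equation for \<open>p = (u - u0, h)\<close>. Since \<open>k * u\<close> and \<open>k * u0\<close> vanish at 0, its left-hand side
  \<open>k * p\<close> is the primitive of \<open>q\<close>, and the memory can be inverted.\<close>
lemma memory_equation_solved:
  fixes u :: "real \<Rightarrow> 'h::{real_inner, banach, second_countable_topology}" and q :: "real \<Rightarrow> real"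
  assumes T: "0 < T" and kl: "(k, l) \<in> PC" and cm: "completely_monotone k"
    and u: "u \<in> L2 T"
    and q: "integrable lborel q" "\<And>t. t \<notin> {0<..<T} \<Longrightarrow> q t = 0"
    and initial: "\<exists>g. continuous_on {0..T} g \<and> (AE t in lborel. t \<in> {0<..<T} \<longrightarrow> conv k u t = g t) \<and> g 0 = 0"
    and gd: "has_generalized_derivative T (\<lambda>t. conv k (\<lambda>\<tau>. u \<tau> - u0) t \<bullet> h) g'"
    and g': "AE t in lborel. t \<in> {0<..<T} \<longrightarrow> g' t = q t"
  shows "AE t in lborel. t \<in> {0<..<T} \<longrightarrow> (u t - u0) \<bullet> h = line_conv (\<lambda>s. indicator {0<..<T} s * l s) q t"
proof -
  interpret convex_kernel_pair T "\<lambda>s. indicator {0<..} s * k s" "\<lambda>s. indicator {0<..<T} s * l s"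
    by (rule PC_convex_kernel_pair[OF T kl cm])
  define \<kappa> where "\<kappa> s = indicator {0<..<T} s * k s" for s
  have \<kappa>eq: "(\<lambda>s. indicator {0<..<T} s * (indicator {0<..} s * k s)) = \<kappa>"
    by (auto simp: \<kappa>_def indicator_def)
  have \<kappa>: "integrable lborel \<kappa>" using k_int unfolding \<kappa>eq .
  have [measurable]: "\<kappa> \<in> borel_measurable borel" using \<kappa> by auto
  define U where "U t = indicator {0<..<T} t *\<^sub>R u t" for t
  define U0 where "U0 t = indicator {0<..<T} t *\<^sub>R u0" for t :: real
  have U: "integrable lborel U" unfolding U_def by (rule L2_zero_extension(3)[OF u])
  have U0: "integrable lborel U0"
    unfolding U0_def by (intro integrable_scaleR_left integrable_real_indicator) (use T in auto)
  define V where "V t = U t - U0 t" for t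
  have V: "integrable lborel V" unfolding V_def using U U0 by (rule Bochner_Integration.integrable_diff)
  have [measurable]: "U \<in> borel_measurable borel" "U0 \<in> borel_measurable borel" "V \<in> borel_measurable borel"
    using U U0 V by auto
  define p where "p t = V t \<bullet> h" for t
  have p: "integrable lborel p" unfolding p_def using V by simp
  define \<phi> where "\<phi> t = conv k (\<lambda>\<tau>. u \<tau> - u0) t \<bullet> h" for t
  have conv_V: "conv k (\<lambda>\<tau>. u \<tau> - u0) t = line_conv \<kappa> V t" and conv_U: "conv k u t = line_conv \<kappa> U t" if "t \<in> {0<..<T}" for t
    using conv_eq_line_conv[of t T k "\<lambda>\<tau>. u \<tau> - u0"] conv_eq_line_conv[of t T k u] that
    by (auto simp: \<kappa>_def[abs_def] V_def[abs_def] U_def[abs_def] U0_def[abs_def] scaleR_diff_right)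
  have \<phi>p: "AE t in lborel. t \<in> {0<..<T} \<longrightarrow> \<phi> t = line_conv \<kappa> p t"
    using line_conv_integrable(1)[OF \<kappa> V]
  proof eventually_elim
    case (elim t)
    then show ?case
      using line_conv_bounded_linear[OF bounded_linear_inner_left elim, of h] by (simp add: \<phi>_def conv_V p_def[abs_def])
  qed
  have \<phi>_int: "set_integrable lborel {0<..<T} \<phi>"
  proof -
    have i: "integrable lborel (\<lambda>t. line_conv \<kappa> V t \<bullet> h)"
      using line_conv_integrable(2)[OF \<kappa> V] by simp
    have "indicator {0<..<T} t *\<^sub>R \<phi> t = indicator {0<..<T} t *\<^sub>R (line_conv \<kappa> V t \<bullet> h)" for t
      by (cases "t \<in> {0<..<T}") (auto simp: \<phi>_def conv_V)
    moreover have "integrable lborel (\<lambda>t. indicator {0<..<T} t *\<^sub>R (line_conv \<kappa> V t \<bullet> h))"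
      by (rule Bochner_Integration.integrable_bound[OF i]) (auto simp: indicator_def)
    ultimately show ?thesis unfolding set_integrable_def by (simp only:)
  qed
  have q_int: "set_integrable lborel {0<..<T} q"
    unfolding set_integrable_def by (rule Bochner_Integration.integrable_bound[OF q(1)]) (use q(1) in \<open>auto simp: indicator_def\<close>)
  obtain g where g: "continuous_on {0..T} g" "AE t in lborel. t \<in> {0<..<T} \<longrightarrow> conv k u t = g t" "g 0 = 0"
    using initial by blast
  have init: "\<exists>r>0. AE t in lborel. 0 < t \<and> t < r \<longrightarrow> \<bar>\<phi> t\<bar> \<le> e" if e: "0 < e" for e
  proof (rule small_near_zero[OF T \<kappa> _ _ _ e])
    have "(g \<longlongrightarrow> g 0) (at 0 within {0..T})" using g(1) T by (simp add: continuous_on_def)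
    then have "(g \<longlongrightarrow> 0) (at_right 0)" using T g(3) by (simp add: at_within_Icc_at_right)
    then have "((\<lambda>t. norm (g t) * norm h) \<longlongrightarrow> norm (0::'h) * norm h) (at_right 0)" by (intro tendsto_intros)
    then show "((\<lambda>t. norm (g t) * norm h) \<longlongrightarrow> 0) (at_right 0)" by simp
    show "AE t in lborel. t \<in> {0<..<T} \<longrightarrow> \<bar>\<phi> t\<bar> \<le> norm (g t) * norm h + (norm u0 * norm h) * (LINT s|lborel. indicator {0<..t} s * \<bar>\<kappa> s\<bar>)"
      using g(2) line_conv_integrable(1)[OF \<kappa> U] line_conv_integrable(1)[OF \<kappa> U0]
    proof eventually_elim
      case (elim t)
      show ?case
      proof
        assume t: "t \<in> {0<..<T}"
        have i: "integrable lborel (\<lambda>s. indicator {0<..t} s * \<bar>\<kappa> s\<bar>)"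
          by (rule Bochner_Integration.integrable_bound[OF \<kappa>]) (auto simp: indicator_def)
        have "line_conv \<kappa> V t = line_conv \<kappa> U t - line_conv \<kappa> U0 t"
          unfolding line_conv_def V_def using elim(2,3) by (simp add: scaleR_diff_right)
        then have \<phi>: "\<phi> t = g t \<bullet> h - line_conv \<kappa> U0 t \<bullet> h"
          using elim(1) t by (simp add: \<phi>_def conv_V conv_U inner_diff_left)
        have "norm (line_conv \<kappa> U0 t) \<le> (LINT s|lborel. (indicator {0<..t} s * \<bar>\<kappa> s\<bar>) * norm u0)"
          unfolding line_conv_def
        proof (rule norm_integral_le_AE(2)[OF integrable_mult_left[OF i]])
          show "AE s in lborel. norm (\<kappa> s *\<^sub>R U0 (t - s)) \<le> (indicator {0<..t} s * \<bar>\<kappa> s\<bar>) * norm u0"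
            by (auto simp: U0_def \<kappa>_def indicator_def)
        qed measurable
        then have "norm (line_conv \<kappa> U0 t) \<le> norm u0 * (LINT s|lborel. indicator {0<..t} s * \<bar>\<kappa> s\<bar>)"
          unfolding integral_mult_left_zero by (simp only: mult.commute[of "norm u0"])
        from order_trans[OF Cauchy_Schwarz_ineq2 mult_right_mono[OF this norm_ge_zero[of h]]]
        have "\<bar>line_conv \<kappa> U0 t \<bullet> h\<bar> \<le> (norm u0 * norm h) * (LINT s|lborel. indicator {0<..t} s * \<bar>\<kappa> s\<bar>)"
          by (simp only: mult_ac)
        then show "\<bar>\<phi> t\<bar> \<le> norm (g t) * norm h + (norm u0 * norm h) * (LINT s|lborel. indicator {0<..t} s * \<bar>\<kappa> s\<bar>)"
          unfolding \<phi> using Cauchy_Schwarz_ineq2[of "g t" h] by linarith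
      qed
    qed
  qed simp
  have gdq: "has_generalized_derivative T \<phi> q"
    unfolding \<phi>_def by (rule generalized_derivative_cong_AE[OF gd q_int g'])
  have "AE t in lborel. t \<in> {0<..<T} \<longrightarrow> \<phi> t = (LINT s:{0<..<t}|lborel. q s)"
    by (rule generalized_derivative_imp_primitive[OF T gdq \<phi>_int q_int]) (rule init)
  with \<phi>p have eq: "AE t in lborel. t \<in> {0<..<T} \<longrightarrow> line_conv \<kappa> p t = (LINT s|lborel. indicator {0<..<t} s * q s)"
    by eventually_elim (auto simp: set_lebesgue_integral_def)
  have "AE t in lborel. t \<in> {0<..<T} \<longrightarrow> p t = line_conv (\<lambda>s. indicator {0<..<T} s * l s) q t"
  proof (rule invert_memory_equation[OF \<kappa> _ l_int l_causal _ p _ q eq])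
    show "AE x in lborel. x \<in> {0<..<T} \<longrightarrow> line_conv \<kappa> (\<lambda>s. indicator {0<..<T} s * l s) x = 1"
      using inverse_kernels unfolding \<kappa>eq .
  qed (auto simp: \<kappa>_def p_def V_def U_def U0_def)
  then show ?thesis
    by eventually_elim (auto simp: p_def V_def U_def U0_def)
qed

section \<open>The inequality\<close>

theorem lemma7p1:
  fixes T M \<kappa> d :: real
    and \<iota> :: "'v::{real_inner, banach, second_countable_topology} \<Rightarrow>
              'h::{real_inner, banach, second_countable_topology}"
    and a :: "'v \<Rightarrow> 'v \<Rightarrow> real"
    and k l :: "real \<Rightarrow> real"
    and A_half :: "('h \<times> 'h) set"
    and u0 :: 'h
    and f :: "real \<Rightarrow> 'v \<Rightarrow>\<^sub>L real"
    and w :: "real \<Rightarrow> 'v"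
    and u :: "real \<Rightarrow> 'h"
  assumes "0 < T"
    and embedding: "bounded_linear \<iota>" "inj \<iota>" "closure (range \<iota>) = UNIV"
    and form: "bilinear a" "\<And>v v'. a v v' = a v' v"
    and constants: "0 < M" "0 < \<kappa>" "0 \<le> d"
    and bounded: "\<And>v' v. \<bar>a v' v\<bar> \<le> M * norm v' * norm v"
    and coercive: "\<And>v. a v v \<ge> \<kappa> * (norm v)\<^sup>2 - d * (norm (\<iota> v))\<^sup>2"
    and A_half: "is_operator_sqrt A_half
                   (form_operator \<iota> (\<lambda>v v'. a v v' + d * (\<iota> v \<bullet> \<iota> v')))"
    and kernels: "(k, l) \<in> PC" "completely_monotone k"
    and data: "f \<in> L2 T"
    and regularity: "w \<in> L2 T" "u \<in> L2 T"
    and initial: "\<exists>g. continuous_on {0..T} g \<and>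
                   (AE t in lborel. t \<in> {0<..<T} \<longrightarrow> conv k u t = g t) \<and> g 0 = 0"
    and equation: "\<And>v. \<exists>g'. has_generalized_derivative T
                     (\<lambda>t. conv k (\<lambda>\<tau>. u \<tau> - u0) t \<bullet> \<iota> v) g' \<and>
                     (AE t in lborel. t \<in> {0<..<T} \<longrightarrow>
                        g' t + a (w t) v = blinfun_apply (f t) v)"
  shows "let z = conv_backward T l (\<lambda>t. op_apply A_half (\<iota> (w t))) in
     ereal (LINT t:{0<..<T}|lborel. \<iota> (w t) \<bullet> u t)
     + ereal (1/2) * enn2ereal
         (\<integral>\<^sup>+ t\<in>{0<..<T}. ennreal ((k (T - t) + k t) * (norm (z t))\<^sup>2) \<partial>lborel)
     + ereal (1/2) * enn2ereal
         (\<integral>\<^sup>+ t\<in>{0<..<T}. (\<integral>\<^sup>+ s\<in>{0<..<t}.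
            ennreal (1/s * (k s - k (2 * s)) * (norm (z t - z (t - s)))\<^sup>2) \<partial>lborel) \<partial>lborel)
     \<le> ereal ((LINT t:{0<..<T}|lborel. u0 \<bullet> \<iota> (w t))
              + (LINT t:{0<..<T}|lborel. blinfun_apply (conv l f t) (w t))
              + d * (LINT t:{0<..<T}|lborel. \<iota> (w t) \<bullet> \<iota> (conv l w t)))"
proof -
  interpret \<iota>: bounded_linear \<iota> by (rule embedding)
  interpret convex_kernel_pair T "\<lambda>s. indicator {0<..} s * k s" "\<lambda>s. indicator {0<..<T} s * l s"
    by (rule PC_convex_kernel_pair[OF \<open>0 < T\<close> kernels])
  define l0 where "l0 = (\<lambda>s. indicator {0<..<T} s * l s)"
  have l0: "integrable lborel l0" unfolding l0_def by (rule l_int)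
  have [measurable]: "l0 \<in> borel_measurable borel" using l0 by auto
  have a_bil: "bounded_bilinear a"
    using form(1) bounded
    by (intro bounded_bilinear.intro exI[of _ M])
      (simp_all add: bilinear_ladd bilinear_radd bilinear_lmul bilinear_rmul mult_ac)
  define b where "b v v' = a v v' + d * (\<iota> v \<bullet> \<iota> v')" for v v'
  have \<iota>_bil: "bounded_bilinear (\<lambda>v v'. \<iota> v \<bullet> \<iota> v')"
    by (rule bounded_bilinear.comp[OF bounded_bilinear_inner embedding(1) embedding(1)])
  have b_bil: "bounded_bilinear b"
    unfolding b_def
  proof (rule bounded_bilinear.intro)
    interpret A: bounded_bilinear a by (rule a_bil)
    interpret I: bounded_bilinear "\<lambda>v v'. \<iota> v \<bullet> \<iota> v'" by (rule \<iota>_bil)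
    obtain K where K: "\<And>v v'. norm (\<iota> v \<bullet> \<iota> v') \<le> norm v * norm v' * K" using I.bounded by blast
    show "\<exists>K. \<forall>v v'. norm (a v v' + d * (\<iota> v \<bullet> \<iota> v')) \<le> norm v * norm v' * K"
    proof (intro exI[of _ "M + d * K"] allI)
      fix v v'
      have "d * \<bar>\<iota> v \<bullet> \<iota> v'\<bar> \<le> d * (norm v * norm v' * K)" using K[of v v'] constants(3) by (intro mult_left_mono) auto
      moreover have "\<bar>a v v' + d * (\<iota> v \<bullet> \<iota> v')\<bar> \<le> \<bar>a v v'\<bar> + d * \<bar>\<iota> v \<bullet> \<iota> v'\<bar>"
        using abs_triangle_ineq[of "a v v'" "d * (\<iota> v \<bullet> \<iota> v')"] constants(3) by (simp add: abs_mult)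
      ultimately show "norm (a v v' + d * (\<iota> v \<bullet> \<iota> v')) \<le> norm v * norm v' * (M + d * K)"
        using bounded[of v v'] by (simp add: algebra_simps)
    qed
  qed (simp_all add: bounded_bilinear.add_left[OF a_bil] bounded_bilinear.add_right[OF a_bil]
      bounded_bilinear.scaleR_left[OF a_bil] bounded_bilinear.scaleR_right[OF a_bil]
      \<iota>.add \<iota>.scaleR inner_add_left inner_add_right algebra_simps)
  define B where "B v = op_apply A_half (\<iota> v)" for v
  have b_coercive: "\<kappa> * (norm v)\<^sup>2 \<le> b v v" for v
    using coercive[of v] by (simp add: b_def power2_norm_eq_inner)
  have b_sym: "b v v' = b v' v" for v v' by (simp add: b_def form(2)[of v] inner_commute)
  have sqrt: "is_operator_sqrt A_half (form_operator \<iota> b)" using A_half by (simp add: b_def[abs_def])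
  have B_lin: "bounded_linear B"
    unfolding B_def by (rule second_representation_theorem(1)[OF b_bil b_sym constants(2) b_coercive embedding(1,2) sqrt])
  have B_b: "B v \<bullet> B v' = b v v'" for v v'
    unfolding B_def by (rule second_representation_theorem(2)[OF b_bil b_sym constants(2) b_coercive embedding(1,2) sqrt])

  define w0 where "w0 t = indicator {0<..<T} t *\<^sub>R w t" for t
  define f0 where "f0 t = indicator {0<..<T} t *\<^sub>R f t" for t
  define U where "U t = indicator {0<..<T} t *\<^sub>R u t" for t
  note w0 = L2_zero_extension[OF regularity(1), folded w0_def]
    and f0 = L2_zero_extension[OF data, folded f0_def]
    and U = L2_zero_extension[OF regularity(2), folded U_def]
  note [measurable] = w0(1) f0(1) U(1)
  have conv_w: "conv l w t = line_conv l0 w0 t" and conv_f: "conv l f t = line_conv l0 f0 t" if "t \<in> {0<..<T}" for t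
    using conv_eq_line_conv[of t T l w] conv_eq_line_conv[of t T l f] that
    by (auto simp: l0_def w0_def[abs_def] f0_def[abs_def])
  have \<iota>w0: "integrable lborel (\<lambda>t. (norm (\<iota> (w0 t)))\<^sup>2)" and Bw0: "integrable lborel (\<lambda>t. (norm (B (w0 t)))\<^sup>2)"
  proof -
    have *: "integrable lborel (\<lambda>t. (norm (C (w0 t)))\<^sup>2)" if C: "bounded_linear C" for C :: "'v \<Rightarrow> 'h"
    proof -
      obtain K where K: "\<And>x. norm (C x) \<le> norm x * K" using bounded_linear.bounded[OF C] by blast
      have [measurable]: "C \<in> borel_measurable borel"
        by (intro borel_measurable_continuous_onI linear_continuous_on C)
      show ?thesis
      proof (rule Bochner_Integration.integrable_bound[OF integrable_mult_left[OF w0(2), of "K\<^sup>2"]])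
        have "(norm (C (w0 t)))\<^sup>2 \<le> (norm (w0 t))\<^sup>2 * K\<^sup>2" for t
          using power_mono[OF K[of "w0 t"], of 2] by (simp add: power_mult_distrib)
        then show "AE t in lborel. norm ((norm (C (w0 t)))\<^sup>2) \<le> norm ((norm (w0 t))\<^sup>2 * K\<^sup>2)" by simp
      qed measurable
    qed
    show "integrable lborel (\<lambda>t. (norm (\<iota> (w0 t)))\<^sup>2)" "integrable lborel (\<lambda>t. (norm (B (w0 t)))\<^sup>2)"
      by (rule * embedding(1) B_lin)+
  qed
  have [measurable]: "\<iota> \<in> borel_measurable borel" "B \<in> borel_measurable borel"
    by (intro borel_measurable_continuous_onI linear_continuous_on embedding(1) B_lin)+
  have w0_out: "w0 t = 0" if "t \<notin> {0<..<T}" for t using that by (simp add: w0_def)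

  let ?eq = "\<lambda>t v. (u t - u0) \<bullet> \<iota> v = blinfun_apply (line_conv l0 f0 t) v - a (line_conv l0 w0 t) v"
  (* The equation after convolution with l, for a single v. *)
  have scalar: "AE t in lborel. t \<in> {0<..<T} \<longrightarrow>
      ?eq t v" for v
  proof -
    define q where "q t = blinfun_apply (f0 t) v - a (w0 t) v" for t
    have L1: "bounded_linear (\<lambda>F. blinfun_apply F v)" by (rule blinfun.bounded_linear_left)
    have L2: "bounded_linear (\<lambda>x. a x v)" by (rule bounded_bilinear.bounded_linear_left[OF a_bil])
    have i1: "integrable lborel (\<lambda>t. blinfun_apply (f0 t) v)" by (rule integrable_bounded_linear[OF L1 f0(3)])
    have i2: "integrable lborel (\<lambda>t. a (w0 t) v)" by (rule integrable_bounded_linear[OF L2 w0(3)])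
    have q: "integrable lborel q" unfolding q_def using i1 i2 by (rule Bochner_Integration.integrable_diff)
    have q0: "q t = 0" if "t \<notin> {0<..<T}" for t
      using that by (simp add: q_def w0_def f0_def bounded_bilinear.zero_left[OF a_bil])
    obtain g' where g': "has_generalized_derivative T (\<lambda>t. conv k (\<lambda>\<tau>. u \<tau> - u0) t \<bullet> \<iota> v) g'"
      "AE t in lborel. t \<in> {0<..<T} \<longrightarrow> g' t + a (w t) v = blinfun_apply (f t) v" using equation by blast
    have geq: "AE t in lborel. t \<in> {0<..<T} \<longrightarrow> g' t = q t"
      using g'(2) by eventually_elim (auto simp: q_def f0_def w0_def)
    have sol: "AE t in lborel. t \<in> {0<..<T} \<longrightarrow> (u t - u0) \<bullet> \<iota> v = line_conv l0 q t"
      unfolding l0_def by (rule memory_equation_solved[OF \<open>0 < T\<close> kernels regularity(2) q _ initial g'(1) geq]) (rule q0)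
    show ?thesis
      using sol line_conv_integrable(1)[OF l0 f0(3)] line_conv_integrable(1)[OF l0 w0(3)]
        line_conv_integrable(1)[OF l0 i1] line_conv_integrable(1)[OF l0 i2]
    proof eventually_elim
      case (elim t)
      have "line_conv l0 q t = line_conv l0 (\<lambda>t. blinfun_apply (f0 t) v) t - line_conv l0 (\<lambda>t. a (w0 t) v) t"
        unfolding line_conv_def q_def scaleR_diff_right using elim(4,5) by (rule Bochner_Integration.integral_diff)
      with elim(1) show ?case
        by (simp add: line_conv_bounded_linear[OF L1 elim(2)] line_conv_bounded_linear[OF L2 elim(3)])
    qed
  qed
  (* The exceptional null set depends on v. Separability makes it uniform, so that the
     time-dependent choice v = w t is admissible. *)
  obtain D :: "'v set" where D: "countable D" "\<And>X. open X \<Longrightarrow> X \<noteq> {} \<Longrightarrow> \<exists>x\<in>D. x \<in> X"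
    using countable_dense_setE by blast
  have dense: "closure D = UNIV"
  proof (rule ccontr)
    assume "closure D \<noteq> UNIV"
    then have "- closure D \<noteq> {}" by auto
    then obtain x where "x \<in> D" "x \<notin> closure D" using D(2)[of "- closure D"] by auto
    then show False using closure_subset by blast
  qed
  have all: "AE t in lborel. \<forall>v\<in>D. t \<in> {0<..<T} \<longrightarrow>
      ?eq t v"
    using D(1) scalar by (subst AE_ball_countable) auto
  have pointwise: "AE t in lborel. t \<in> {0<..<T} \<longrightarrow>
      ?eq t (w t)"
    using all
  proof eventually_elim
    case (elim t)
    show ?case
    proof
      assume t: "t \<in> {0<..<T}"
      have "closed {v. ?eq t v}"
        by (intro closed_Collect_eq continuous_intros bounded_bilinear.continuous_on[OF a_bil]
            linear_continuous_on embedding(1))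
      then have "closure D \<subseteq> {v. ?eq t v}"
        using elim t by (intro closure_minimal) auto
      then show "?eq t (w t)"
        using dense by blast
    qed
  qed

  (* The form of A turns the memory term into the pairing of g = A^(1/2) w with l * g. *)
  define g where "g t = B (w0 t)" for t
  have gm [measurable]: "g \<in> borel_measurable borel" unfolding g_def by measurable
  have g2: "integrable lborel (\<lambda>t. (norm (g t))\<^sup>2)" unfolding g_def by (rule Bw0)
  have g_out: "g t = 0" if "t \<notin> {0<..<T}" for t
    by (simp add: g_def w0_out[OF that] linear_0[OF bounded_linear.linear[OF B_lin]])
  have g1: "integrable lborel g" by (rule square_integrable_imp_integrable[OF gm g2 g_out])
  define I where "I = (LINT t|lborel. indicator {0<..<T} t * (memory g t \<bullet> g t))"
  have energy: "energy 0 (memory g) \<le> ennreal (2 * I)" and I0: "0 \<le> I"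
    unfolding I_def using energy_inequality[OF gm g2 g_out] by simp_all
  have I_fwd: "I = (LINT t|lborel. line_conv l0 g t \<bullet> g t)"
  proof -
    have "indicator {0<..<T} t * (memory g t \<bullet> g t) = (LINT s|lborel. l0 s *\<^sub>R g (t + s)) \<bullet> g t" for t
      using g_out[of t] by (cases "t \<in> {0<..<T}") (auto simp: memory_def l0_def)
    then show ?thesis unfolding I_def line_conv_inner_adjoint[OF l0 gm g1 g2] by (simp only:)
  qed

  let ?J = "\<lambda>F. LINT t:{0<..<T}|lborel. F t :: real"
  have set_eq: "?J F = integral\<^sup>L lborel G" if "\<And>t. t \<in> {0<..<T} \<Longrightarrow> F t = G t" "\<And>t. t \<notin> {0<..<T} \<Longrightarrow> G t = 0" for F G
    unfolding set_lebesgue_integral_def using that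
    by (intro Bochner_Integration.integral_cong refl) (auto simp: indicator_def)
  have inner_int: "integrable lborel (\<lambda>t. X t \<bullet> Y t)"
    if [measurable]: "X \<in> borel_measurable borel" "Y \<in> borel_measurable borel"
      and X2: "integrable lborel (\<lambda>t. (norm (X t))\<^sup>2)" and Y2: "integrable lborel (\<lambda>t. (norm (Y t))\<^sup>2)" for X Y :: "real \<Rightarrow> 'h"
  proof (rule norm_integral_le_AE(1)[OF Bochner_Integration.integrable_add[OF X2 Y2]])
    have "\<bar>X t \<bullet> Y t\<bar> \<le> (norm (X t))\<^sup>2 + (norm (Y t))\<^sup>2" for t
    proof -
      have "2 * (norm (X t) * norm (Y t)) \<le> (norm (X t))\<^sup>2 + (norm (Y t))\<^sup>2"
        using sum_squares_bound[of "norm (X t)" "norm (Y t)"] by simp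
      moreover have "0 \<le> norm (X t) * norm (Y t)" by simp
      ultimately show ?thesis using Cauchy_Schwarz_ineq2[of "X t" "Y t"] by linarith
    qed
    then show "AE t in lborel. norm (X t \<bullet> Y t) \<le> (norm (X t))\<^sup>2 + (norm (Y t))\<^sup>2" by simp
  qed measurable
  have iu: "integrable lborel (\<lambda>t. \<iota> (w0 t) \<bullet> U t)" by (rule inner_int[OF _ U(1) \<iota>w0 U(2)]) measurable
  have iu0: "integrable lborel (\<lambda>t. u0 \<bullet> \<iota> (w0 t))"
    using integrable_bounded_linear[OF embedding(1) w0(3)] by simp
  have if0: "integrable lborel (\<lambda>t. blinfun_apply (line_conv l0 f0 t) (w0 t))"
    by (rule integrable_bilinear_line_conv[OF bounded_bilinear_blinfun_apply l0 f0(1) w0(1) f0(3,2) w0(2)])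
  have id: "integrable lborel (\<lambda>t. \<iota> (line_conv l0 w0 t) \<bullet> \<iota> (w0 t))"
    by (rule integrable_bilinear_line_conv[OF \<iota>_bil l0 w0(1) w0(1) w0(3,2) w0(2)])
  have ig: "integrable lborel (\<lambda>t. line_conv l0 g t \<bullet> g t)"
    by (rule integrable_bilinear_line_conv[OF bounded_bilinear_inner l0 gm gm g1 g2 g2])
  have identity: "AE t in lborel. \<iota> (w0 t) \<bullet> U t + line_conv l0 g t \<bullet> g t
      = u0 \<bullet> \<iota> (w0 t) + blinfun_apply (line_conv l0 f0 t) (w0 t) + d * (\<iota> (line_conv l0 w0 t) \<bullet> \<iota> (w0 t))"
    using pointwise line_conv_integrable(1)[OF l0 w0(3)]
  proof eventually_elim
    case (elim t)
    show ?case
    proof (cases "t \<in> {0<..<T}")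
      case True
      have w: "w0 t = w t" "U t = u t" using True by (simp_all add: w0_def U_def)
      have "line_conv l0 g t = B (line_conv l0 w0 t)"
        unfolding g_def by (rule line_conv_bounded_linear[OF B_lin elim(2), symmetric])
      then have "line_conv l0 g t \<bullet> g t = a (line_conv l0 w0 t) (w t) + d * (\<iota> (line_conv l0 w0 t) \<bullet> \<iota> (w t))"
        by (simp add: g_def B_b b_def w)
      with elim(1) True show ?thesis by (simp add: w inner_diff_left inner_diff_right inner_commute)
    next
      case False
      then show ?thesis by (simp add: w0_out g_out \<iota>.zero U_def blinfun.zero_right)
    qed
  qed
  let ?i1 = "(LINT t|lborel. \<iota> (w0 t) \<bullet> U t)"
    and ?i2 = "(LINT t|lborel. u0 \<bullet> \<iota> (w0 t))"
    and ?i3 = "(LINT t|lborel. blinfun_apply (line_conv l0 f0 t) (w0 t))"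
    and ?i4 = "(LINT t|lborel. \<iota> (line_conv l0 w0 t) \<bullet> \<iota> (w0 t))"
  have "?i1 + I = (LINT t|lborel. \<iota> (w0 t) \<bullet> U t + line_conv l0 g t \<bullet> g t)"
    unfolding I_fwd using iu ig by simp
  also have "\<dots> = (LINT t|lborel. u0 \<bullet> \<iota> (w0 t) + blinfun_apply (line_conv l0 f0 t) (w0 t) + d * (\<iota> (line_conv l0 w0 t) \<bullet> \<iota> (w0 t)))"
    by (rule integral_cong_AE[OF _ _ identity])
      (use iu ig iu0 if0 id in \<open>auto intro!: borel_measurable_add borel_measurable_times borel_measurable_integrable\<close>)
  also have "\<dots> = ?i2 + ?i3 + d * ?i4"
    using iu0 if0 id by simp
  finally have balance: "?i1 + I
      = ?i2 + ?i3 + d * ?i4" .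
  have t1: "?J (\<lambda>t. \<iota> (w t) \<bullet> u t) = ?i1"
    by (rule set_eq) (auto simp: w0_def U_def \<iota>.zero)
  have t2: "?J (\<lambda>t. u0 \<bullet> \<iota> (w t)) = ?i2"
    by (rule set_eq) (auto simp: w0_def \<iota>.zero)
  have t3: "?J (\<lambda>t. blinfun_apply (conv l f t) (w t)) = ?i3"
    by (rule set_eq) (auto simp: w0_def conv_f blinfun.zero_right)
  have t4: "?J (\<lambda>t. \<iota> (w t) \<bullet> \<iota> (conv l w t)) = ?i4"
    by (rule set_eq) (auto simp: conv_w w0_out \<iota>.zero inner_commute, simp add: w0_def)

  define z where "z = conv_backward T l (\<lambda>t. op_apply A_half (\<iota> (w t)))"
  have z: "z t = memory g t" if "t \<in> {0<..<T}" for t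
  proof -
    have "indicator {0<..<T} r *\<^sub>R op_apply A_half (\<iota> (w r)) = g r" for r
      using g_out[of r] by (cases "r \<in> {0<..<T}") (auto simp: g_def B_def w0_def)
    then show ?thesis using that conv_backward_eq[of t T l "\<lambda>t. op_apply A_half (\<iota> (w t))"]
      by (simp add: z_def memory_def)
  qed
  define N1 where "N1 = (\<integral>\<^sup>+ t\<in>{0<..<T}. ennreal ((k (T - t) + k t) * (norm (z t))\<^sup>2) \<partial>lborel)"
  define N2 where "N2 = (\<integral>\<^sup>+ t\<in>{0<..<T}. (\<integral>\<^sup>+ s\<in>{0<..<t}.
            ennreal (1/s * (k s - k (2 * s)) * (norm (z t - z (t - s)))\<^sup>2) \<partial>lborel) \<partial>lborel)"
  let ?K = "\<lambda>t s. 1/s * (k s - k (2 * s)) * (norm (z t - z (t - s)))\<^sup>2"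
  let ?G = "\<lambda>t s. of_bool (0 < s) * (1/s * (indicator {0<..} s * k s - indicator {0<..} (2 * s) * k (2 * s))) * (norm (memory g t - memory g (t - s)))\<^sup>2"
  have "N1 + N2 = energy 0 (memory g)"
    unfolding N1_def N2_def energy_def
  proof (rule arg_cong2[where f="(+)"])
    show "(\<integral>\<^sup>+ t\<in>{0<..<T}. ennreal ((k (T - t) + k t) * (norm (z t))\<^sup>2) \<partial>lborel)
      = (\<integral>\<^sup>+ t\<in>{0<..<T}. ennreal ((of_bool (0 < T - t) * (indicator {0<..} (T - t) * k (T - t)) + of_bool (0 < t) * (indicator {0<..} t * k t)) * (norm (memory g t))\<^sup>2) \<partial>lborel)"
      by (intro nn_integral_cong) (auto simp: z indicator_def)
    show "(\<integral>\<^sup>+ t\<in>{0<..<T}. (\<integral>\<^sup>+ s\<in>{0<..<t}.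
            ennreal (?K t s) \<partial>lborel) \<partial>lborel)
      = (\<integral>\<^sup>+ t\<in>{0<..<T}. (\<integral>\<^sup>+ s\<in>{0<..<t}.
        ennreal (?G t s) \<partial>lborel) \<partial>lborel)"
    proof (intro nn_integral_cong)
      fix t :: real
      have "(\<integral>\<^sup>+ s\<in>{0<..<t}. ennreal (?K t s) \<partial>lborel)
        = (\<integral>\<^sup>+ s\<in>{0<..<t}. ennreal (?G t s) \<partial>lborel)"
        if "t \<in> {0<..<T}"
        using that by (intro nn_integral_cong) (auto simp: z indicator_def)
      then show "(\<integral>\<^sup>+ s\<in>{0<..<t}. ennreal (?K t s) \<partial>lborel) * indicator {0<..<T} t
        = (\<integral>\<^sup>+ s\<in>{0<..<t}. ennreal (?G t s) \<partial>lborel) * indicator {0<..<T} t"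
        by (cases "t \<in> {0<..<T}") simp_all
    qed
  qed
  with energy have N: "N1 + N2 \<le> ennreal (2 * I)" by simp
  then have "N1 < \<infinity>" "N2 < \<infinity>"
    by (auto simp: le_less_trans[OF _ ennreal_less_top] intro: le_less_trans[OF order_trans[OF _ N] ennreal_less_top])
  then obtain n1 n2 where n: "0 \<le> n1" "N1 = ennreal n1" "0 \<le> n2" "N2 = ennreal n2"
    by (cases N1; cases N2) auto
  have n12: "n1 + n2 \<le> 2 * I" using N n I0 by (simp add: ennreal_plus[symmetric] del: ennreal_plus)
  have "ereal (?J (\<lambda>t. \<iota> (w t) \<bullet> u t)) + ereal (1/2) * enn2ereal N1 + ereal (1/2) * enn2ereal N2
      \<le> ereal (?J (\<lambda>t. u0 \<bullet> \<iota> (w t)) + ?J (\<lambda>t. blinfun_apply (conv l f t) (w t)) + d * ?J (\<lambda>t. \<iota> (w t) \<bullet> \<iota> (conv l w t)))"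
    unfolding t1 t2 t3 t4 balance[symmetric] using n n12 by simp
  then show ?thesis by (simp only: Let_def N1_def N2_def z_def)
qed

end
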